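(* Let $(M,J,\nabla,\omega)$ be a special symplectic manifold. (i) Assume that $\omega^{11}$ is nondegenerate. Then the cotangent bundle $N=T^*M$ carries a canonical almost hyper-Hermitian structure $(J_1,J_2,J_3=J_1J_2=-J_2J_1,g_N)$ given by $$J_1=J^\nabla,\qquad J_2=J^{\omega^{11}},\qquad g_N=\mathrm{diag}(g,g^{-1}),$$ where $g=\omega^{11}(J\cdot,\cdot)$ is the Kähler metric on $M$. $J_1$ is the standard (integrable) complex structure on the cotangent bundle of the complex manifold $(M,J)$. The almost hyper-Hermitian manifold $(N,J_1,J_2,J_3,g_N)$ is hyper-Hermitian (i.e. the almost complex structures $J_1,J_2,J_3$ are integrable) if and only if $\nabla\omega^{11}=0$. In this case $(N,J_1,J_2,J_3,g_N)$ is a hyper-Kähler manifold. (ii) Assume that $\omega'=\omega^{20}+\omega^{02}$ is nondegenerate. Then the cotangent bundle $N=T^*M$ carries a canonical almost para-hypercomplex structure $(J_1,J_2)$, i.e. a commuting pair of almost complex structures, given by $$J_1=J^\nabla,\qquad J_2=J^{\omega'}.$$ $J_1$ is again the standard (integrable) complex structure, and $(J_1,J_2)$ is an (integrable) para-hypercomplex structure (i.e. $J_1$ and $J_2$ are integrable) if and only if $\nabla\omega^{20}=0$.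
   Context: Metrics (Kähler, hyper-Hermitian, hyper-Kähler) are allowed to be indefinite. A special symplectic manifold $(M,J,\nabla,\omega)$ is a complex manifold $(M,J)$ together with a flat torsionfree connection $\nabla$ on its real tangent bundle such that $d^\nabla J=0$, i.e. $(\nabla_XJ)Y=(\nabla_YJ)X$ for all $X,Y$, and a $\nabla$-parallel symplectic form $\omega$. $\omega=\omega^{11}+\omega^{20}+\omega^{02}$ is the Hodge decomposition with respect to $J$. If $\omega^{11}$ is nondegenerate, then $g=\omega^{11}(J\cdot,\cdot)$ is a Kähler metric on $(M,J)$. Let $\pi:N=T^*M\to M$. The connection $\nabla$ defines a decomposition $T_\xi N=\mathcal{H}^\nabla_\xi\oplus T^v_\xi N\cong T_pM\oplus T^*_pM$, $\xi\in N$, $p=\pi(\xi)$, where $T^v_\xi N$ is the vertical subspace, naturally identified with $T^*_pM$, and $\mathcal{H}^\nabla_\xi$ is the horizontal subspace defined by $\nabla$, identified with $T_pM$ via $d\pi$. With respect to this decomposition, $$J^\nabla=\begin{pmatrix}J&0\\0&J^*\end{pmatrix},\qquad J^\rho=\begin{pmatrix}0&-\rho^{-1}\\ \rho&0\end{pmatrix}$$ for a field $\rho$ of nondegenerate bilinear forms on $M$, considered as a map $TM\to T^*M$; here $J^*\xi=\xi\circ J$, and $g^{-1}$ is the metric on $T^*M$ inverse to $g$. An almost hyper-Hermitian structure on $N$ is a (pseudo-)Riemannian metric $g_N$ together with $g_N$-orthogonal almost complex structures $J_1,J_2,J_3=J_1J_2=-J_2J_1$. *)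

theory Defs
  imports "HOL-Analysis.Analysis"
begin

section \<open>Smooth maps and smooth manifolds\<close>

text \<open>\<open>Ck_on n S f\<close> says that \<open>f\<close> is \<open>n\<close> times continuously differentiable on \<open>S\<close>;
  it is only used for open sets \<open>S\<close>.\<close>

primrec Ck_on ::
  "nat \<Rightarrow> 'a::euclidean_space set \<Rightarrow> ('a \<Rightarrow> 'b::real_normed_vector) \<Rightarrow> bool" where
  "Ck_on 0 S f \<longleftrightarrow> continuous_on S f"
| "Ck_on (Suc n) S f \<longleftrightarrow> (\<forall>x\<in>S. f differentiable (at x)) \<and>
     (\<forall>v. Ck_on n S (\<lambda>x. frechet_derivative f (at x) v))"

definition smooth_on :: "'a::euclidean_space set \<Rightarrow> ('a \<Rightarrow> 'b::real_normed_vector) \<Rightarrow> bool" where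
  "smooth_on S f \<longleftrightarrow> (\<forall>n. Ck_on n S f)"

text \<open>A manifold is a topological space with an indexed atlas of charts
  \<open>chart M i : cdom M i \<rightarrow> 'e\<close>, \<open>i \<in> idx M\<close>. The atlas need not be maximal: the charts of the
  smooth structure it generates are given by \<open>smooth_chart\<close> below. Real dimension is \<open>DIM('e)\<close>.\<close>

record ('i, 'm, 'e) atlas =
  mtop  :: "'m topology"
  idx   :: "'i set"
  cdom  :: "'i \<Rightarrow> 'm set"
  chart :: "'i \<Rightarrow> 'm \<Rightarrow> 'e"

definition coord_dom :: "('i, 'm, 'e) atlas \<Rightarrow> 'i \<Rightarrow> 'e set" where
  "coord_dom M i = chart M i ` cdom M i"

definition overlap :: "('i, 'm, 'e) atlas \<Rightarrow> 'i \<Rightarrow> 'i \<Rightarrow> 'e set" where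
  "overlap M i j = chart M i ` (cdom M i \<inter> cdom M j)"

definition transition :: "('i, 'm, 'e) atlas \<Rightarrow> 'i \<Rightarrow> 'i \<Rightarrow> 'e \<Rightarrow> 'e" where
  "transition M i j = chart M j \<circ> inv_into (cdom M i) (chart M i)"

text \<open>Differential of the coordinate change from chart \<open>i\<close> to chart \<open>j\<close>, at coordinates \<open>x\<close>.\<close>

definition dtrans :: "('i, 'm, 'e::euclidean_space) atlas \<Rightarrow> 'i \<Rightarrow> 'i \<Rightarrow> 'e \<Rightarrow> 'e \<Rightarrow> 'e" where
  "dtrans M i j x = frechet_derivative (transition M i j) (at x)"

definition topological_chart :: "'m topology \<Rightarrow> 'm set \<Rightarrow> ('m \<Rightarrow> 'e::euclidean_space) \<Rightarrow> bool" where
  "topological_chart T V \<psi> \<longleftrightarrow> openin T V \<and> open (\<psi> ` V) \<and>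
     homeomorphic_map (subtopology T V) (top_of_set (\<psi> ` V)) \<psi>"

definition smooth_manifold :: "('i, 'm, 'e::euclidean_space) atlas \<Rightarrow> bool" where
  "smooth_manifold M \<longleftrightarrow>
     Hausdorff_space (mtop M) \<and> second_countable (mtop M) \<and>
     (\<Union>i\<in>idx M. cdom M i) = topspace (mtop M) \<and>
     (\<forall>i\<in>idx M. topological_chart (mtop M) (cdom M i) (chart M i)) \<and>
     (\<forall>i\<in>idx M. \<forall>j\<in>idx M. smooth_on (overlap M i j) (transition M i j))"

text \<open>The charts \<open>(V, \<psi>)\<close> of the maximal atlas.\<close>

definition smooth_chart ::
  "('i, 'm, 'e::euclidean_space) atlas \<Rightarrow> 'm set \<Rightarrow> ('m \<Rightarrow> 'e) \<Rightarrow> bool" where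
  "smooth_chart M V \<psi> \<longleftrightarrow> topological_chart (mtop M) V \<psi> \<and>
     (\<forall>i\<in>idx M.
        smooth_on (chart M i ` (cdom M i \<inter> V)) (\<psi> \<circ> inv_into (cdom M i) (chart M i)) \<and>
        smooth_on (\<psi> ` (cdom M i \<inter> V)) (chart M i \<circ> inv_into V \<psi>))"


section \<open>Tensor fields and connections\<close>

text \<open>Fields are families of component functions, one for each chart of the atlas, subject to the
  respective transformation rule. The argument \<open>x\<close> of the components is the coordinate vector of
  the point, ranging over \<open>coord_dom M i\<close>; the values elsewhere are irrelevant.\<close>

type_synonym ('i, 'e) endo = "'i \<Rightarrow> 'e \<Rightarrow> 'e \<Rightarrow> 'e"
type_synonym ('i, 'e, 'c) bilin = "'i \<Rightarrow> 'e \<Rightarrow> 'e \<Rightarrow> 'e \<Rightarrow> 'c"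

definition endo_field :: "('i, 'm, 'e::euclidean_space) atlas \<Rightarrow> ('i, 'e) endo \<Rightarrow> bool" where
  "endo_field M A \<longleftrightarrow> (\<forall>i\<in>idx M.
     (\<forall>x\<in>coord_dom M i. linear (A i x)) \<and>
     (\<forall>v. smooth_on (coord_dom M i) (\<lambda>x. A i x v)) \<and>
     (\<forall>j\<in>idx M. \<forall>x\<in>overlap M i j. \<forall>v.
        A j (transition M i j x) (dtrans M i j x v) = dtrans M i j x (A i x v)))"

definition bilin_field :: "('i, 'm, 'e::euclidean_space) atlas \<Rightarrow> ('i, 'e, real) bilin \<Rightarrow> bool" where
  "bilin_field M b \<longleftrightarrow> (\<forall>i\<in>idx M.
     (\<forall>x\<in>coord_dom M i. bilinear (b i x)) \<and>
     (\<forall>v w. smooth_on (coord_dom M i) (\<lambda>x. b i x v w)) \<and>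
     (\<forall>j\<in>idx M. \<forall>x\<in>overlap M i j. \<forall>v w.
        b j (transition M i j x) (dtrans M i j x v) (dtrans M i j x w) = b i x v w))"

definition nondegenerate :: "('i, 'm, 'e::euclidean_space) atlas \<Rightarrow> ('i, 'e, real) bilin \<Rightarrow> bool" where
  "nondegenerate M b \<longleftrightarrow>
     (\<forall>i\<in>idx M. \<forall>x\<in>coord_dom M i. \<forall>v. (\<forall>w. b i x v w = 0) \<longrightarrow> v = 0)"

definition alternating :: "('i, 'm, 'e::euclidean_space) atlas \<Rightarrow> ('i, 'e, real) bilin \<Rightarrow> bool" where
  "alternating M b \<longleftrightarrow> (\<forall>i\<in>idx M. \<forall>x\<in>coord_dom M i. \<forall>v w. b i x v w = - b i x w v)"

definition symmetric_field :: "('i, 'm, 'e::euclidean_space) atlas \<Rightarrow> ('i, 'e, real) bilin \<Rightarrow> bool" where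
  "symmetric_field M b \<longleftrightarrow> (\<forall>i\<in>idx M. \<forall>x\<in>coord_dom M i. \<forall>v w. b i x v w = b i x w v)"

text \<open>Exterior derivative of a 2-form, evaluated on coordinate-constant vector fields.\<close>

definition closed_form :: "('i, 'm, 'e::euclidean_space) atlas \<Rightarrow> ('i, 'e, real) bilin \<Rightarrow> bool" where
  "closed_form M b \<longleftrightarrow> (\<forall>i\<in>idx M. \<forall>x\<in>coord_dom M i. \<forall>u v w.
     frechet_derivative (\<lambda>y. b i y v w) (at x) u +
     frechet_derivative (\<lambda>y. b i y w u) (at x) v +
     frechet_derivative (\<lambda>y. b i y u v) (at x) w = 0)"

definition symplectic_form :: "('i, 'm, 'e::euclidean_space) atlas \<Rightarrow> ('i, 'e, real) bilin \<Rightarrow> bool" where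
  "symplectic_form M \<omega> \<longleftrightarrow>
     bilin_field M \<omega> \<and> alternating M \<omega> \<and> nondegenerate M \<omega> \<and> closed_form M \<omega>"

definition pseudo_riemannian :: "('i, 'm, 'e::euclidean_space) atlas \<Rightarrow> ('i, 'e, real) bilin \<Rightarrow> bool" where
  "pseudo_riemannian M g \<longleftrightarrow> bilin_field M g \<and> symmetric_field M g \<and> nondegenerate M g"

text \<open>A connection on the tangent bundle is given by its Christoffel maps:
  \<open>(\<nabla>\<^sub>v W)(x) = DW(x)v + \<Gamma> i x v (W x)\<close> in chart \<open>i\<close>. The rule below expresses that
  \<open>\<nabla>\<close> does not depend on the chart.\<close>

definition connection :: "('i, 'm, 'e::euclidean_space) atlas \<Rightarrow> ('i, 'e, 'e) bilin \<Rightarrow> bool" where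
  "connection M \<Gamma> \<longleftrightarrow> (\<forall>i\<in>idx M.
     (\<forall>x\<in>coord_dom M i. bilinear (\<Gamma> i x)) \<and>
     (\<forall>v w. smooth_on (coord_dom M i) (\<lambda>x. \<Gamma> i x v w)) \<and>
     (\<forall>j\<in>idx M. \<forall>x\<in>overlap M i j. \<forall>v w.
        dtrans M i j x (\<Gamma> i x v w) =
        frechet_derivative (\<lambda>y. dtrans M i j y w) (at x) v +
        \<Gamma> j (transition M i j x) (dtrans M i j x v) (dtrans M i j x w)))"

definition torsion_free :: "('i, 'm, 'e::euclidean_space) atlas \<Rightarrow> ('i, 'e, 'e) bilin \<Rightarrow> bool" where
  "torsion_free M \<Gamma> \<longleftrightarrow> (\<forall>i\<in>idx M. \<forall>x\<in>coord_dom M i. \<forall>v w. \<Gamma> i x v w = \<Gamma> i x w v)"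

text \<open>The curvature \<open>R(u,v)w = \<nabla>\<^sub>u \<nabla>\<^sub>v w - \<nabla>\<^sub>v \<nabla>\<^sub>u w\<close> for coordinate-constant \<open>u, v, w\<close>.\<close>

definition curvature :: "('i, 'e::euclidean_space, 'e) bilin \<Rightarrow> 'i \<Rightarrow> 'e \<Rightarrow> 'e \<Rightarrow> 'e \<Rightarrow> 'e \<Rightarrow> 'e" where
  "curvature \<Gamma> i x u v w =
     (frechet_derivative (\<lambda>y. \<Gamma> i y v w) (at x) u + \<Gamma> i x u (\<Gamma> i x v w)) -
     (frechet_derivative (\<lambda>y. \<Gamma> i y u w) (at x) v + \<Gamma> i x v (\<Gamma> i x u w))"

definition flat :: "('i, 'm, 'e::euclidean_space) atlas \<Rightarrow> ('i, 'e, 'e) bilin \<Rightarrow> bool" where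
  "flat M \<Gamma> \<longleftrightarrow> (\<forall>i\<in>idx M. \<forall>x\<in>coord_dom M i. \<forall>u v w. curvature \<Gamma> i x u v w = 0)"

text \<open>\<open>(\<nabla>\<^sub>u A) v = \<nabla>\<^sub>u (A v) - A (\<nabla>\<^sub>u v)\<close> and
  \<open>(\<nabla>\<^sub>u b)(v, w) = u (b(v, w)) - b(\<nabla>\<^sub>u v, w) - b(v, \<nabla>\<^sub>u w)\<close>
  for coordinate-constant \<open>u, v, w\<close>.\<close>

definition cov_endo ::
  "('i, 'e::euclidean_space, 'e) bilin \<Rightarrow> ('i, 'e) endo \<Rightarrow> 'i \<Rightarrow> 'e \<Rightarrow> 'e \<Rightarrow> 'e \<Rightarrow> 'e" where
  "cov_endo \<Gamma> A i x u v =
     (frechet_derivative (\<lambda>y. A i y v) (at x) u + \<Gamma> i x u (A i x v)) - A i x (\<Gamma> i x u v)"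

definition cov_bilin ::
  "('i, 'e::euclidean_space, 'e) bilin \<Rightarrow> ('i, 'e, 'c::real_normed_vector) bilin
     \<Rightarrow> 'i \<Rightarrow> 'e \<Rightarrow> 'e \<Rightarrow> 'e \<Rightarrow> 'e \<Rightarrow> 'c" where
  "cov_bilin \<Gamma> b i x u v w =
     frechet_derivative (\<lambda>y. b i y v w) (at x) u - b i x (\<Gamma> i x u v) w - b i x v (\<Gamma> i x u w)"

definition parallel ::
  "('i, 'm, 'e::euclidean_space) atlas \<Rightarrow> ('i, 'e, 'e) bilin
     \<Rightarrow> ('i, 'e, 'c::real_normed_vector) bilin \<Rightarrow> bool" where
  "parallel M \<Gamma> b \<longleftrightarrow>
     (\<forall>i\<in>idx M. \<forall>x\<in>coord_dom M i. \<forall>u v w. cov_bilin \<Gamma> b i x u v w = 0)"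


section \<open>Complex structures\<close>

definition almost_complex :: "('i, 'm, 'e::euclidean_space) atlas \<Rightarrow> ('i, 'e) endo \<Rightarrow> bool" where
  "almost_complex M J \<longleftrightarrow> smooth_manifold M \<and> endo_field M J \<and>
     (\<forall>i\<in>idx M. \<forall>x\<in>coord_dom M i. \<forall>v. J i x (J i x v) = - v)"

text \<open>A holomorphic chart identifies \<open>J\<close> with a constant complex structure \<open>j\<close> of the model
  vector space, i.e. its differential is complex linear from \<open>J\<close> to \<open>j\<close>.\<close>

definition holomorphic_chart ::
  "('i, 'm, 'e::euclidean_space) atlas \<Rightarrow> ('i, 'e) endo \<Rightarrow> 'm set \<Rightarrow> ('m \<Rightarrow> 'e) \<Rightarrow> ('e \<Rightarrow> 'e) \<Rightarrow> bool"
where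
  "holomorphic_chart M J V \<psi> j \<longleftrightarrow> smooth_chart M V \<psi> \<and> linear j \<and> (\<forall>v. j (j v) = - v) \<and>
     (\<forall>i\<in>idx M. \<forall>x\<in>chart M i ` (cdom M i \<inter> V). \<forall>v.
        frechet_derivative (\<psi> \<circ> inv_into (cdom M i) (chart M i)) (at x) (J i x v) =
        j (frechet_derivative (\<psi> \<circ> inv_into (cdom M i) (chart M i)) (at x) v))"

text \<open>Integrability in the original sense (existence of local holomorphic coordinates),
  not via the Nijenhuis tensor.\<close>

definition integrable_acs :: "('i, 'm, 'e::euclidean_space) atlas \<Rightarrow> ('i, 'e) endo \<Rightarrow> bool" where
  "integrable_acs M J \<longleftrightarrow>
     (\<forall>p\<in>topspace (mtop M). \<exists>V \<psi> j. p \<in> V \<and> holomorphic_chart M J V \<psi> j)"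

definition complex_manifold :: "('i, 'm, 'e::euclidean_space) atlas \<Rightarrow> ('i, 'e) endo \<Rightarrow> bool" where
  "complex_manifold M J \<longleftrightarrow> almost_complex M J \<and> integrable_acs M J"

definition endo_comp :: "('i, 'e) endo \<Rightarrow> ('i, 'e) endo \<Rightarrow> ('i, 'e) endo" where
  "endo_comp A B = (\<lambda>i x v. A i x (B i x v))"

definition orthogonal_endo ::
  "('i, 'm, 'e::euclidean_space) atlas \<Rightarrow> ('i, 'e, real) bilin \<Rightarrow> ('i, 'e) endo \<Rightarrow> bool" where
  "orthogonal_endo M g J \<longleftrightarrow>
     (\<forall>i\<in>idx M. \<forall>x\<in>coord_dom M i. \<forall>v w. g i x (J i x v) (J i x w) = g i x v w)"

text \<open>The bilinear field \<open>b(A \<cdot>, \<cdot>)\<close>.\<close>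

definition bilin_comp :: "('i, 'e, real) bilin \<Rightarrow> ('i, 'e) endo \<Rightarrow> ('i, 'e, real) bilin" where
  "bilin_comp b A = (\<lambda>i x v w. b i x (A i x v) w)"

text \<open>All metrics may be indefinite.\<close>

definition kaehler ::
  "('i, 'm, 'e::euclidean_space) atlas \<Rightarrow> ('i, 'e) endo \<Rightarrow> ('i, 'e, real) bilin \<Rightarrow> bool" where
  "kaehler M J g \<longleftrightarrow> complex_manifold M J \<and> pseudo_riemannian M g \<and> orthogonal_endo M g J \<and>
     closed_form M (bilin_comp g J)"

definition almost_hyper_hermitian ::
  "('i, 'm, 'e::euclidean_space) atlas \<Rightarrow> ('i, 'e) endo \<Rightarrow> ('i, 'e) endo \<Rightarrow> ('i, 'e) endo
     \<Rightarrow> ('i, 'e, real) bilin \<Rightarrow> bool" where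
  "almost_hyper_hermitian M J1 J2 J3 g \<longleftrightarrow>
     pseudo_riemannian M g \<and>
     almost_complex M J1 \<and> almost_complex M J2 \<and> almost_complex M J3 \<and>
     orthogonal_endo M g J1 \<and> orthogonal_endo M g J2 \<and> orthogonal_endo M g J3 \<and>
     (\<forall>i\<in>idx M. \<forall>x\<in>coord_dom M i. \<forall>v.
        J3 i x v = J1 i x (J2 i x v) \<and> J1 i x (J2 i x v) = - J2 i x (J1 i x v))"

definition hyper_hermitian ::
  "('i, 'm, 'e::euclidean_space) atlas \<Rightarrow> ('i, 'e) endo \<Rightarrow> ('i, 'e) endo \<Rightarrow> ('i, 'e) endo
     \<Rightarrow> ('i, 'e, real) bilin \<Rightarrow> bool" where
  "hyper_hermitian M J1 J2 J3 g \<longleftrightarrow> almost_hyper_hermitian M J1 J2 J3 g \<and>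
     integrable_acs M J1 \<and> integrable_acs M J2 \<and> integrable_acs M J3"

definition hyper_kaehler ::
  "('i, 'm, 'e::euclidean_space) atlas \<Rightarrow> ('i, 'e) endo \<Rightarrow> ('i, 'e) endo \<Rightarrow> ('i, 'e) endo
     \<Rightarrow> ('i, 'e, real) bilin \<Rightarrow> bool" where
  "hyper_kaehler M J1 J2 J3 g \<longleftrightarrow> hyper_hermitian M J1 J2 J3 g \<and>
     kaehler M J1 g \<and> kaehler M J2 g \<and> kaehler M J3 g"

definition almost_para_hypercomplex ::
  "('i, 'm, 'e::euclidean_space) atlas \<Rightarrow> ('i, 'e) endo \<Rightarrow> ('i, 'e) endo \<Rightarrow> bool" where
  "almost_para_hypercomplex M J1 J2 \<longleftrightarrow> almost_complex M J1 \<and> almost_complex M J2 \<and>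
     (\<forall>i\<in>idx M. \<forall>x\<in>coord_dom M i. \<forall>v. J1 i x (J2 i x v) = J2 i x (J1 i x v))"

definition para_hypercomplex ::
  "('i, 'm, 'e::euclidean_space) atlas \<Rightarrow> ('i, 'e) endo \<Rightarrow> ('i, 'e) endo \<Rightarrow> bool" where
  "para_hypercomplex M J1 J2 \<longleftrightarrow> almost_para_hypercomplex M J1 J2 \<and>
     integrable_acs M J1 \<and> integrable_acs M J2"


section \<open>Special symplectic manifolds and the Hodge decomposition\<close>

text \<open>\<open>d\<^sup>\<nabla>J = 0\<close> is the symmetry of \<open>(\<nabla>\<^sub>u J) v\<close> in \<open>u, v\<close>.\<close>

definition special_symplectic ::
  "('i, 'm, 'e::euclidean_space) atlas \<Rightarrow> ('i, 'e) endo \<Rightarrow> ('i, 'e, 'e) bilin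
     \<Rightarrow> ('i, 'e, real) bilin \<Rightarrow> bool" where
  "special_symplectic M J \<Gamma> \<omega> \<longleftrightarrow>
     complex_manifold M J \<and>
     connection M \<Gamma> \<and> flat M \<Gamma> \<and> torsion_free M \<Gamma> \<and>
     (\<forall>i\<in>idx M. \<forall>x\<in>coord_dom M i. \<forall>u v. cov_endo \<Gamma> J i x u v = cov_endo \<Gamma> J i x v u) \<and>
     symplectic_form M \<omega> \<and> parallel M \<Gamma> \<omega>"

text \<open>The complexified tangent space is encoded as \<open>'e \<times> 'e\<close>, with \<open>(a, b)\<close> standing for
  \<open>a + \<i> b\<close>. \<open>proj10 j\<close> and \<open>proj01 j\<close> are the projections \<open>(v \<mp> \<i> j v) / 2\<close> of a real vector to
  the \<open>\<plusminus>\<i>\<close>-eigenspaces of \<open>j\<close>.\<close>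

definition complex_ext :: "('e \<Rightarrow> 'e \<Rightarrow> real) \<Rightarrow> 'e \<times> 'e \<Rightarrow> 'e \<times> 'e \<Rightarrow> complex" where
  "complex_ext b Z W = Complex (b (fst Z) (fst W) - b (snd Z) (snd W))
                               (b (fst Z) (snd W) + b (snd Z) (fst W))"

definition proj10 :: "('e \<Rightarrow> 'e) \<Rightarrow> 'e \<Rightarrow> ('e::real_vector) \<times> 'e" where
  "proj10 j v = ((1/2) *\<^sub>R v, - (1/2) *\<^sub>R j v)"

definition proj01 :: "('e \<Rightarrow> 'e) \<Rightarrow> 'e \<Rightarrow> ('e::real_vector) \<times> 'e" where
  "proj01 j v = ((1/2) *\<^sub>R v, (1/2) *\<^sub>R j v)"

definition hodge20 :: "('i, 'e::euclidean_space) endo \<Rightarrow> ('i, 'e, real) bilin \<Rightarrow> ('i, 'e, complex) bilin" where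
  "hodge20 J \<omega> = (\<lambda>i x v w. complex_ext (\<omega> i x) (proj10 (J i x) v) (proj10 (J i x) w))"

definition hodge02 :: "('i, 'e::euclidean_space) endo \<Rightarrow> ('i, 'e, real) bilin \<Rightarrow> ('i, 'e, complex) bilin" where
  "hodge02 J \<omega> = (\<lambda>i x v w. complex_ext (\<omega> i x) (proj01 (J i x) v) (proj01 (J i x) w))"

definition hodge11 :: "('i, 'e::euclidean_space) endo \<Rightarrow> ('i, 'e, real) bilin \<Rightarrow> ('i, 'e, complex) bilin" where
  "hodge11 J \<omega> = (\<lambda>i x v w.
     complex_ext (\<omega> i x) (proj10 (J i x) v) (proj01 (J i x) w) +
     complex_ext (\<omega> i x) (proj01 (J i x) v) (proj10 (J i x) w))"

text \<open>\<open>\<omega>\<^sup>1\<^sup>1\<close> and \<open>\<omega>' = \<omega>\<^sup>2\<^sup>0 + \<omega>\<^sup>0\<^sup>2\<close> take real values on real vectors (see the two lemmas), so they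
  are regarded as real 2-forms.\<close>

definition omega11 :: "('i, 'e::euclidean_space) endo \<Rightarrow> ('i, 'e, real) bilin \<Rightarrow> ('i, 'e, real) bilin" where
  "omega11 J \<omega> = (\<lambda>i x v w. Re (hodge11 J \<omega> i x v w))"

definition omega_prime :: "('i, 'e::euclidean_space) endo \<Rightarrow> ('i, 'e, real) bilin \<Rightarrow> ('i, 'e, real) bilin" where
  "omega_prime J \<omega> = (\<lambda>i x v w. Re (hodge20 J \<omega> i x v w + hodge02 J \<omega> i x v w))"

lemma hodge11_real:
  assumes "bilinear (\<omega> i x)"
  shows "hodge11 J \<omega> i x v w = complex_of_real (omega11 J \<omega> i x v w)"
  using assms
  by (simp add: hodge11_def omega11_def complex_ext_def proj10_def proj01_def complex_eq_iff
      bilinear_lmul bilinear_rmul bilinear_lneg bilinear_rneg)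

lemma hodge20_plus_hodge02_real:
  assumes "bilinear (\<omega> i x)"
  shows "hodge20 J \<omega> i x v w + hodge02 J \<omega> i x v w = complex_of_real (omega_prime J \<omega> i x v w)"
  using assms
  by (simp add: hodge20_def hodge02_def omega_prime_def complex_ext_def proj10_def proj01_def
      complex_eq_iff bilinear_lmul bilinear_rmul bilinear_lneg bilinear_rneg)


section \<open>The cotangent bundle\<close>

text \<open>In each chart a covector is represented by the vector \<open>a\<close> of its components: its value on
  \<open>v\<close> is \<open>a \<bullet> v\<close>. \<open>covec f\<close> is the component vector of a linear form \<open>f\<close>.\<close>

definition covec :: "('e::euclidean_space \<Rightarrow> real) \<Rightarrow> 'e" where
  "covec f = (\<Sum>e\<in>Basis. f e *\<^sub>R e)"

text \<open>A covector at \<open>p\<close> is the compatible family of its component vectors in the charts around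
  \<open>p\<close> (padded with \<open>0\<close> at the other indices).\<close>

definition cotangent_space :: "('i, 'm, 'e::euclidean_space) atlas \<Rightarrow> 'm \<Rightarrow> ('i \<Rightarrow> 'e) set" where
  "cotangent_space M p = {\<xi>.
     (\<forall>i. \<not> (i \<in> idx M \<and> p \<in> cdom M i) \<longrightarrow> \<xi> i = 0) \<and>
     (\<forall>i\<in>idx M. \<forall>j\<in>idx M. p \<in> cdom M i \<inter> cdom M j \<longrightarrow>
        (\<forall>v. \<xi> i \<bullet> v = \<xi> j \<bullet> dtrans M i j (chart M i p) v))}"

definition cotangent_points :: "('i, 'm, 'e::euclidean_space) atlas \<Rightarrow> 'm set \<Rightarrow> ('m \<times> ('i \<Rightarrow> 'e)) set" where
  "cotangent_points M V = Sigma V (cotangent_space M)"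

definition cotangent_bundle ::
  "('i, 'm, 'e::euclidean_space) atlas \<Rightarrow> ('i, 'm \<times> ('i \<Rightarrow> 'e), 'e \<times> 'e) atlas" where
  "cotangent_bundle M = \<lparr>
     mtop = topology (\<lambda>W. W \<subseteq> cotangent_points M (topspace (mtop M)) \<and>
       (\<forall>i\<in>idx M. open ((\<lambda>(p, \<xi>). (chart M i p, \<xi> i)) ` (W \<inter> cotangent_points M (cdom M i))))),
     idx = idx M,
     cdom = (\<lambda>i. cotangent_points M (cdom M i)),
     chart = (\<lambda>i (p, \<xi>). (chart M i p, \<xi> i)) \<rparr>"

text \<open>The bundle chart of \<open>T\<^sup>*M\<close> over an arbitrary smooth chart \<open>(V, \<psi>)\<close> of \<open>M\<close>. The components
  of a covector with respect to \<open>\<psi>\<close> do not depend on the chosen index \<open>i\<close>.\<close>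

definition bundle_chart ::
  "('i, 'm, 'e::euclidean_space) atlas \<Rightarrow> 'm set \<Rightarrow> ('m \<Rightarrow> 'e) \<Rightarrow> 'm \<times> ('i \<Rightarrow> 'e) \<Rightarrow> 'e \<times> 'e" where
  "bundle_chart M V \<psi> = (\<lambda>(p, \<xi>).
     let i = (SOME i. i \<in> idx M \<and> p \<in> cdom M i) in
     (\<psi> p, covec (\<lambda>v. \<xi> i \<bullet> frechet_derivative (chart M i \<circ> inv_into V \<psi>) (at (\<psi> p)) v)))"

text \<open>A real covector \<open>a\<close> on \<open>('e, j)\<close> corresponds to the complex linear form with real part
  \<open>a\<close>; \<open>times_i j a\<close> is the covector corresponding to \<open>\<i>\<close> times that form.\<close>

definition complex_form :: "('e::euclidean_space \<Rightarrow> 'e) \<Rightarrow> 'e \<Rightarrow> 'e \<Rightarrow> complex" where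
  "complex_form j a v = complex_of_real (a \<bullet> v) - \<i> * complex_of_real (a \<bullet> j v)"

definition times_i :: "('e::euclidean_space \<Rightarrow> 'e) \<Rightarrow> 'e \<Rightarrow> 'e" where
  "times_i j a = covec (\<lambda>v. Re (\<i> * complex_form j a v))"

text \<open>The standard complex structure of the cotangent bundle of a complex manifold: bundle charts
  over holomorphic charts of \<open>M\<close> are holomorphic, where the fibre coordinates are complex linear
  forms.\<close>

definition standard_cotangent_complex_structure ::
  "('i, 'm, 'e::euclidean_space) atlas \<Rightarrow> ('i, 'e) endo \<Rightarrow> ('i, 'e \<times> 'e) endo \<Rightarrow> bool" where
  "standard_cotangent_complex_structure M J K \<longleftrightarrow>
     almost_complex (cotangent_bundle M) K \<and>
     (\<forall>V \<psi> j. holomorphic_chart M J V \<psi> j \<longrightarrow>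
        holomorphic_chart (cotangent_bundle M) K (cotangent_points M V) (bundle_chart M V \<psi>)
          (\<lambda>(v, a). (j v, times_i j a)))"


section \<open>Structures on the cotangent bundle induced by the connection\<close>

text \<open>At the point of \<open>T\<^sup>*M\<close> with coordinates \<open>(x, a)\<close> the horizontal lift of \<open>v\<close> is the velocity
  of a parallel covector field along a curve with velocity \<open>v\<close>. \<open>hv_iso\<close> is the isomorphism
  from \<open>T\<^sub>pM \<oplus> T\<^sup>*\<^sub>pM\<close> to the tangent space of \<open>T\<^sup>*M\<close> given by the splitting into horizontal and
  vertical vectors.\<close>

definition horizontal_lift :: "('i, 'e::euclidean_space, 'e) bilin \<Rightarrow> 'i \<Rightarrow> 'e \<times> 'e \<Rightarrow> 'e \<Rightarrow> 'e \<times> 'e" where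
  "horizontal_lift \<Gamma> i z v = (v, covec (\<lambda>w. snd z \<bullet> \<Gamma> i (fst z) v w))"

definition hv_iso :: "('i, 'e::euclidean_space, 'e) bilin \<Rightarrow> 'i \<Rightarrow> 'e \<times> 'e \<Rightarrow> 'e \<times> 'e \<Rightarrow> 'e \<times> 'e" where
  "hv_iso \<Gamma> i z = (\<lambda>(v, b). horizontal_lift \<Gamma> i z v + (0, b))"

text \<open>\<open>hv_endo\<close> and \<open>hv_bilin\<close> transport fields on \<open>TM \<oplus> T\<^sup>*M\<close>, given at the base point, to
  fields on the manifold \<open>T\<^sup>*M\<close>.\<close>

definition hv_endo ::
  "('i, 'e::euclidean_space, 'e) bilin \<Rightarrow> ('i \<Rightarrow> 'e \<Rightarrow> 'e \<times> 'e \<Rightarrow> 'e \<times> 'e) \<Rightarrow> ('i, 'e \<times> 'e) endo" where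
  "hv_endo \<Gamma> P = (\<lambda>i z Z. hv_iso \<Gamma> i z (P i (fst z) (inv (hv_iso \<Gamma> i z) Z)))"

definition hv_bilin ::
  "('i, 'e::euclidean_space, 'e) bilin \<Rightarrow> ('i \<Rightarrow> 'e \<Rightarrow> 'e \<times> 'e \<Rightarrow> 'e \<times> 'e \<Rightarrow> real)
     \<Rightarrow> ('i, 'e \<times> 'e, real) bilin" where
  "hv_bilin \<Gamma> Q = (\<lambda>i z Z W. Q i (fst z) (inv (hv_iso \<Gamma> i z) Z) (inv (hv_iso \<Gamma> i z) W))"

definition flat_map :: "('e::euclidean_space \<Rightarrow> 'e \<Rightarrow> real) \<Rightarrow> 'e \<Rightarrow> 'e" where
  "flat_map b v = covec (\<lambda>w. b v w)"

definition dual_endo :: "('e::euclidean_space \<Rightarrow> 'e) \<Rightarrow> 'e \<Rightarrow> 'e" where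
  "dual_endo j a = covec (\<lambda>v. a \<bullet> j v)"

definition inverse_metric :: "('e::euclidean_space \<Rightarrow> 'e \<Rightarrow> real) \<Rightarrow> 'e \<Rightarrow> 'e \<Rightarrow> real" where
  "inverse_metric g a b = g (inv (flat_map g) a) (inv (flat_map g) b)"

definition J_nabla ::
  "('i, 'e::euclidean_space, 'e) bilin \<Rightarrow> ('i, 'e) endo \<Rightarrow> ('i, 'e \<times> 'e) endo" where
  "J_nabla \<Gamma> J = hv_endo \<Gamma> (\<lambda>i x (v, a). (J i x v, dual_endo (J i x) a))"

definition J_bilin ::
  "('i, 'e::euclidean_space, 'e) bilin \<Rightarrow> ('i, 'e, real) bilin \<Rightarrow> ('i, 'e \<times> 'e) endo" where
  "J_bilin \<Gamma> \<rho> = hv_endo \<Gamma> (\<lambda>i x (v, a). (- inv (flat_map (\<rho> i x)) a, flat_map (\<rho> i x) v))"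

definition diag_metric ::
  "('i, 'e::euclidean_space, 'e) bilin \<Rightarrow> ('i, 'e, real) bilin \<Rightarrow> ('i, 'e \<times> 'e, real) bilin" where
  "diag_metric \<Gamma> g = hv_bilin \<Gamma> (\<lambda>i x (v, a) (w, b). g i x v w + inverse_metric (g i x) a b)"

end

(* Write (v, b) for the tangent vector of T*M with horizontal part v and vertical part b. For a
   parallel frame (e_k) of the flat connection, the functions a_k = a(e_k) on T*M satisfy
   da_k (v, b) = b(e_k), so with the 1-forms eta_k = rho(., e_k) pulled back from M one has
   da_k o J^rho = eta_k and eta_k o J^rho = - da_k. If rho is d^nabla-closed, the eta_k are closed,
   locally eta_k = d beta_k, and (beta_k, a_k) are holomorphic coordinates for J^rho. Conversely,
   integrability makes d eta_k invariant under J^rho; as J^rho exchanges horizontal and vertical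
   vectors and d eta_k comes from the base, d eta_k = 0. Thus J^rho is integrable if and only if
   d^nabla rho = 0. For alternating rho this means nabla rho = 0, since a trilinear form that is
   symmetric in its first two and alternating in its last two arguments vanishes. In part (i),
   J_3 = J^sigma with sigma = rho(., J .), and nabla rho = 0 makes sigma satisfy the same Codazzi
   condition. The Kaehler forms of J_2 and J_3 are exact, with primitives a o J and a; the one of
   J_1 is the sum of -rho and a form with constant coefficients in the da_k. The frame and the
   beta_k come from one existence theorem for flat linear systems D f(x) v = A(x)(v, f(x)). *)

theory Submission
  imports Defs
begin

section \<open>Calculus of smooth maps\<close>

text \<open>Fields are given by components evaluated at fixed vectors, so the calculus below is that
  of families that are linear in the remaining arguments. Integrability is the existence of
  holomorphic charts: sufficiency has to produce coordinates, whereas necessity takes only the easy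
  half of Newlander-Nirenberg, that holomorphic charts force the Nijenhuis identity.
  \<open>J_nabla\<close> is handled without frames. In a holomorphic chart of M let T be the
  Christoffel map of \<nabla>, which is symmetric. Then d^\<nabla> J = 0 amounts to T(Ju, v) = T(u,
  Jv), and this is what makes the differential of the bundle chart complex linear. Although \<omega>
  is parallel, its Hodge components need not be, because J need not be parallel. The (1,1) part is
  still closed: the derivatives of J cancel in the cyclic sum. In part (ii) the (2,0) part is
  (\<omega>' - i \<omega>'(J., .)) / 2, so parallelism of \<omega>' has to be extended to
  \<omega>'(J., .); the obstruction \<omega>'((\<nabla>J)., .) has the symmetries that force a
  trilinear form to vanish.\<close>

abbreviation D :: "('a::real_normed_vector \<Rightarrow> 'b::real_normed_vector) \<Rightarrow> 'a \<Rightarrow> 'a \<Rightarrow> 'b"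
  where "D f x \<equiv> frechet_derivative f (at x)"

lemma D_eqI: "(f has_derivative f') (at x) \<Longrightarrow> D f x = f'"
  by (metis frechet_derivative_at)

lemma has_derivative_D: "f differentiable (at x) \<Longrightarrow> (f has_derivative D f x) (at x)"
  by (simp add: frechet_derivative_works)

lemma D_cong_open:
  assumes "open S" "x \<in> S" "\<And>y. y \<in> S \<Longrightarrow> f y = g y"
  shows "D f x = D g x"
proof -
  have "(f has_derivative f') (at x) \<longleftrightarrow> (g has_derivative f') (at x)" for f'
    by (metis assms has_derivative_transform_within_open)
  then show ?thesis by (simp add: frechet_derivative_def)
qed

lemma Ck_on_cong:
  assumes "open S" "\<And>x. x \<in> S \<Longrightarrow> f x = g x" "Ck_on n S f"
  shows "Ck_on n S g"
  using assms(2,3)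
proof (induction n arbitrary: f g)
  case 0
  then show ?case by (auto cong: continuous_on_cong)
next
  case (Suc n)
  have "g differentiable (at x)" if "x \<in> S" for x
    using Suc.prems that assms(1) by (metis Ck_on.simps(2) differentiable_def has_derivative_transform_within_open)
  moreover have "Ck_on n S (\<lambda>x. D g x v)" for v
    by (rule Suc.IH[of "\<lambda>x. D f x v"]) (use Suc.prems D_cong_open[OF assms(1)] in \<open>auto, metis\<close>)
  ultimately show ?case by simp
qed

lemma Ck_on_subset: "Ck_on n S f \<Longrightarrow> T \<subseteq> S \<Longrightarrow> Ck_on n T f"
proof (induction n arbitrary: f)
  case 0 then show ?case by (auto intro: continuous_on_subset)
next
  case (Suc n) then show ?case by auto
qed

lemma Ck_on_SucD: "Ck_on (Suc n) S f \<Longrightarrow> Ck_on n S f"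
proof (induction n arbitrary: f)
  case 0 then show ?case
    by (auto intro!: continuous_at_imp_continuous_on differentiable_imp_continuous_within)
next
  case (Suc n)
  then show ?case by (metis Ck_on.simps(2))
qed

text \<open>Lets any explicit formula stand in for \<open>frechet_derivative\<close>, with which it
  agrees by uniqueness; the closure properties below supply such formulas.\<close>

lemma Ck_on_SucI:
  assumes "open S" "\<And>x. x \<in> S \<Longrightarrow> (f has_derivative f' x) (at x)" "\<And>v. Ck_on n S (\<lambda>x. f' x v)"
  shows "Ck_on (Suc n) S f"
proof -
  have "Ck_on n S (\<lambda>x. D f x v)" for v
    by (rule Ck_on_cong[OF assms(1) _ assms(3)[of v]]) (metis D_eqI assms(2))
  then show ?thesis using assms(2) by (auto simp: differentiable_def)
qed

lemma Ck_on_SucE: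
  assumes "Ck_on (Suc n) S f" "x \<in> S"
  shows "(f has_derivative D f x) (at x)"
  using assms by (simp add: has_derivative_D)

section \<open>Closure properties of finite differentiability\<close>

lemma Ck_on_const: "Ck_on n S (\<lambda>x. c)"
proof (induction n arbitrary: c)
  case (Suc n)
  then show ?case by simp
qed simp

lemma Ck_on_bounded_linear:
  assumes "bounded_linear L" "open S"
  shows "Ck_on n S f \<Longrightarrow> Ck_on n S (\<lambda>x. L (f x))"
proof (induction n arbitrary: f)
  case 0
  then show ?case using assms(1) by (simp add: bounded_linear.continuous_on)
next
  case (Suc n)
  have "((\<lambda>x. L (f x)) has_derivative (\<lambda>v. L (D f x v))) (at x)" if "x \<in> S" for x
    by (rule bounded_linear.has_derivative[OF assms(1) Ck_on_SucE[OF Suc.prems that]])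
  then show ?case by (rule Ck_on_SucI[OF assms(2)]) (use Suc in auto)
qed

lemma Ck_on_id: "open S \<Longrightarrow> Ck_on n S (\<lambda>x. x)"
  by (cases n) (auto intro!: Ck_on_SucI[where f'="\<lambda>_ v. v"] Ck_on_const derivative_eq_intros)

lemma Ck_on_add:
  assumes "open S"
  shows "Ck_on n S f \<Longrightarrow> Ck_on n S g \<Longrightarrow> Ck_on n S (\<lambda>x. f x + g x)"
proof (induction n arbitrary: f g)
  case 0 then show ?case by (simp add: continuous_on_add)
next
  case (Suc n)
  have "((\<lambda>x. f x + g x) has_derivative (\<lambda>v. D f x v + D g x v)) (at x)" if "x \<in> S" for x
    by (intro has_derivative_add Ck_on_SucE[OF Suc.prems(1) that] Ck_on_SucE[OF Suc.prems(2) that])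
  then show ?case by (rule Ck_on_SucI[OF assms]) (use Suc in auto)
qed

lemma Ck_on_sum:
  assumes "open S" "\<And>i. i \<in> I \<Longrightarrow> Ck_on n S (f i)"
  shows "Ck_on n S (\<lambda>x. \<Sum>i\<in>I. f i x)"
  using assms(2) by (induction I rule: infinite_finite_induct) (auto intro: Ck_on_const Ck_on_add assms(1))

lemma Ck_on_bilinear:
  assumes "bounded_bilinear pr" "open S"
  shows "Ck_on n S f \<Longrightarrow> Ck_on n S g \<Longrightarrow> Ck_on n S (\<lambda>x. pr (f x) (g x))"
proof (induction n arbitrary: f g)
  case 0 then show ?case using assms(1) by (simp add: bounded_bilinear.continuous_on)
next
  case (Suc n)
  have "((\<lambda>x. pr (f x) (g x)) has_derivative (\<lambda>v. pr (f x) (D g x v) + pr (D f x v) (g x))) (at x)"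
    if "x \<in> S" for x
    by (intro bounded_bilinear.FDERIV[OF assms(1)] Ck_on_SucE[OF Suc.prems(1) that] Ck_on_SucE[OF Suc.prems(2) that])
  then show ?case
  proof (rule Ck_on_SucI[OF assms(2)])
    show "Ck_on n S (\<lambda>x. pr (f x) (D g x v) + pr (D f x v) (g x))" for v
      using Suc.prems by (intro Ck_on_add Suc.IH assms(2)) (auto dest: Ck_on_SucD simp del: Ck_on.simps, auto)
  qed
qed

lemma linear_euclidean_sum:
  fixes L :: "'a::euclidean_space \<Rightarrow> 'b::real_vector"
  assumes "linear L" shows "L v = (\<Sum>b\<in>Basis. (v \<bullet> b) *\<^sub>R L b)"
  by (subst euclidean_representation[symmetric, of v]) (simp add: linear_sum[OF assms] linear_cmul[OF assms])

text \<open>Fields such as \<open>J i x v\<close> are controlled only for fixed \<open>v\<close>.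
  When the argument moves with the point, expansion in the basis reduces the claim to products of
  scalar functions with evaluations at basis vectors.\<close>

lemma Ck_on_linear_apply:
  fixes A :: "'a::euclidean_space \<Rightarrow> 'b::euclidean_space \<Rightarrow> 'c::real_normed_vector"
  assumes "open S" "\<And>x. x \<in> S \<Longrightarrow> linear (A x)" "\<And>v. Ck_on n S (\<lambda>x. A x v)" "Ck_on n S f"
  shows "Ck_on n S (\<lambda>x. A x (f x))"
proof (rule Ck_on_cong[OF assms(1)])
  show "Ck_on n S (\<lambda>x. \<Sum>b\<in>Basis. (f x \<bullet> b) *\<^sub>R A x b)"
    by (intro Ck_on_sum Ck_on_bilinear[OF bounded_bilinear_scaleR] assms
        Ck_on_bounded_linear[OF bounded_linear_inner_left])
qed (simp add: linear_euclidean_sum[OF assms(2)])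

text \<open>Order n + 1 reduces to order n because the chain rule expresses the derivative by the
  linear family \<open>D g\<close> along \<open>f\<close>, evaluated at the moving vector
  \<open>D f x v\<close>.\<close>

lemma Ck_on_compose:
  fixes g :: "'b::euclidean_space \<Rightarrow> 'c::real_normed_vector" and f :: "'a::euclidean_space \<Rightarrow> 'b"
  assumes "open S" "open T" "f ` S \<subseteq> T"
  shows "Ck_on n T g \<Longrightarrow> Ck_on n S f \<Longrightarrow> Ck_on n S (\<lambda>x. g (f x))"
  using assms(3)
proof (induction n arbitrary: g)
  case 0 then show ?case by (simp add: continuous_on_compose2)
next
  case (Suc n)
  have der: "((\<lambda>x. g (f x)) has_derivative (\<lambda>v. D g (f x) (D f x v))) (at x)" if "x \<in> S" for x
    using has_derivative_compose[OF Ck_on_SucE[OF Suc.prems(2) that] Ck_on_SucE[OF Suc.prems(1)]] that Suc.prems(3)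
    by blast
  show ?case
  proof (rule Ck_on_SucI[OF assms(1) der])
    fix v
    show "Ck_on n S (\<lambda>x. D g (f x) (D f x v))"
    proof (rule Ck_on_linear_apply[OF assms(1)])
      show "linear (D g (f x))" if "x \<in> S" for x
        using Suc.prems that by (auto intro!: linear_frechet_derivative)
      show "Ck_on n S (\<lambda>x. D g (f x) w)" for w
        by (rule Suc.IH) (use Suc.prems Ck_on_SucD[OF Suc.prems(2)] in auto)
      show "Ck_on n S (\<lambda>x. D f x v)" using Suc.prems by auto
    qed
  qed
qed

section \<open>Smooth maps and product rules for linear families\<close>

lemma smooth_onD_Ck: "smooth_on S f \<Longrightarrow> Ck_on n S f"
  by (simp add: smooth_on_def)

lemma smooth_on_continuous: "smooth_on S f \<Longrightarrow> continuous_on S f"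
  using smooth_onD_Ck[of S f 0] by simp

lemma smooth_on_has_derivative: "smooth_on S f \<Longrightarrow> x \<in> S \<Longrightarrow> (f has_derivative D f x) (at x)"
  using Ck_on_SucE smooth_on_def by blast

lemma smooth_on_differentiable: "smooth_on S f \<Longrightarrow> x \<in> S \<Longrightarrow> f differentiable (at x)"
  using smooth_on_has_derivative differentiable_def by blast

lemma smooth_on_linear_D: "smooth_on S f \<Longrightarrow> x \<in> S \<Longrightarrow> linear (D f x)"
  using smooth_on_differentiable linear_frechet_derivative by blast

lemma smooth_on_D: "smooth_on S f \<Longrightarrow> smooth_on S (\<lambda>x. D f x v)"
  unfolding smooth_on_def by (metis Ck_on.simps(2))

lemma smooth_on_cong: "open S \<Longrightarrow> (\<And>x. x \<in> S \<Longrightarrow> f x = g x) \<Longrightarrow> smooth_on S f \<Longrightarrow> smooth_on S g"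
  unfolding smooth_on_def by (metis Ck_on_cong)

lemma smooth_on_subset: "smooth_on S f \<Longrightarrow> T \<subseteq> S \<Longrightarrow> smooth_on T f"
  unfolding smooth_on_def by (metis Ck_on_subset)

lemma smooth_on_const: "smooth_on S (\<lambda>x. c)"
  by (simp add: smooth_on_def Ck_on_const)

lemma smooth_on_bounded_linear: "bounded_linear L \<Longrightarrow> open S \<Longrightarrow> smooth_on S f \<Longrightarrow> smooth_on S (\<lambda>x. L (f x))"
  by (simp add: smooth_on_def Ck_on_bounded_linear)

lemma smooth_on_id: "open S \<Longrightarrow> smooth_on S (\<lambda>x. x)"
  by (simp add: smooth_on_def Ck_on_id)

lemma smooth_on_add: "open S \<Longrightarrow> smooth_on S f \<Longrightarrow> smooth_on S g \<Longrightarrow> smooth_on S (\<lambda>x. f x + g x)"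
  by (simp add: smooth_on_def Ck_on_add)

lemma smooth_on_minus: "open S \<Longrightarrow> smooth_on S f \<Longrightarrow> smooth_on S (\<lambda>x. - f x)"
  by (rule smooth_on_bounded_linear[OF bounded_linear_minus[OF bounded_linear_ident]])

lemma smooth_on_diff: "open S \<Longrightarrow> smooth_on S f \<Longrightarrow> smooth_on S g \<Longrightarrow> smooth_on S (\<lambda>x. f x - g x)"
  using smooth_on_add[of S f "\<lambda>x. - g x"] smooth_on_minus[of S g] by simp

lemma smooth_on_sum:
  "open S \<Longrightarrow> (\<And>i. i \<in> I \<Longrightarrow> smooth_on S (f i)) \<Longrightarrow> smooth_on S (\<lambda>x. \<Sum>i\<in>I. f i x)"
  by (simp add: smooth_on_def Ck_on_sum)

lemma smooth_on_bilinear: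
  "bounded_bilinear pr \<Longrightarrow> open S \<Longrightarrow> smooth_on S f \<Longrightarrow> smooth_on S g \<Longrightarrow> smooth_on S (\<lambda>x. pr (f x) (g x))"
  by (simp add: smooth_on_def Ck_on_bilinear)

lemmas smooth_on_scaleR = smooth_on_bilinear[OF bounded_bilinear_scaleR]
  and smooth_on_inner = smooth_on_bilinear[OF bounded_bilinear_inner]

lemma smooth_on_linear_apply:
  fixes A :: "'a::euclidean_space \<Rightarrow> 'b::euclidean_space \<Rightarrow> 'c::real_normed_vector"
  assumes "open S" "\<And>x. x \<in> S \<Longrightarrow> linear (A x)" "\<And>v. smooth_on S (\<lambda>x. A x v)" "smooth_on S f"
  shows "smooth_on S (\<lambda>x. A x (f x))"
  using assms unfolding smooth_on_def by (auto intro: Ck_on_linear_apply)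

lemma smooth_on_bilinear_apply:
  fixes A :: "'a::euclidean_space \<Rightarrow> 'b::euclidean_space \<Rightarrow> 'd::euclidean_space \<Rightarrow> 'c::real_normed_vector"
  assumes "open S" "\<And>x. x \<in> S \<Longrightarrow> bilinear (A x)" "\<And>v w. smooth_on S (\<lambda>x. A x v w)"
    "smooth_on S f" "smooth_on S g"
  shows "smooth_on S (\<lambda>x. A x (f x) (g x))"
  by (rule smooth_on_linear_apply[where A="\<lambda>x. A x (f x)"], rule assms,
      use assms(2) in \<open>simp add: bilinear_def\<close>,
      rule smooth_on_linear_apply[where A="\<lambda>x v. A x v w" for w])
    (use assms in \<open>auto simp: bilinear_def\<close>)

lemma smooth_on_compose:
  fixes g :: "'b::euclidean_space \<Rightarrow> 'c::real_normed_vector" and f :: "'a::euclidean_space \<Rightarrow> 'b"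
  assumes "open S" "open T" "smooth_on T g" "smooth_on S f" "f ` S \<subseteq> T"
  shows "smooth_on S (\<lambda>x. g (f x))"
  using assms unfolding smooth_on_def by (auto intro: Ck_on_compose[of S T])

lemma smooth_on_Pair:
  assumes "open S" "smooth_on S f" "smooth_on S g"
  shows "smooth_on S (\<lambda>x. (f x, g x))"
proof -
  have "smooth_on S (\<lambda>x. (f x, 0) + (0, g x))"
    by (intro smooth_on_add assms
        smooth_on_bounded_linear[where L="\<lambda>y. (y, 0)"] smooth_on_bounded_linear[where L="\<lambda>y. (0, y)"]
        bounded_linear_Pair bounded_linear_ident bounded_linear_zero)
  then show ?thesis by simp
qed

lemmas smooth_on_fst = smooth_on_bounded_linear[OF bounded_linear_fst]
  and smooth_on_snd = smooth_on_bounded_linear[OF bounded_linear_snd]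

lemma D_compose:
  fixes g :: "'b::euclidean_space \<Rightarrow> 'c::real_normed_vector" and f :: "'a::euclidean_space \<Rightarrow> 'b"
  assumes "f differentiable (at x)" "g differentiable (at (f x))"
  shows "D (\<lambda>y. g (f y)) x v = D g (f x) (D f x v)"
  using frechet_derivative_compose[OF assms] by (simp add: o_def)

text \<open>The product rule when differentiability of \<open>A\<close> is known only for its
  evaluations at fixed vectors.\<close>

lemma has_derivative_linear_apply:
  fixes A :: "'a::euclidean_space \<Rightarrow> 'b::euclidean_space \<Rightarrow> 'c::real_normed_vector"
  assumes "open S" "x \<in> S" "\<And>x. x \<in> S \<Longrightarrow> linear (A x)"
    and dA: "\<And>v. ((\<lambda>x. A x v) has_derivative (\<lambda>u. A' u v)) (at x)" and df: "(f has_derivative f') (at x)"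
  shows "((\<lambda>x. A x (f x)) has_derivative (\<lambda>u. A' u (f x) + A x (f' u))) (at x)"
proof -
  \<comment> \<open>Linearity of the derivative in the vector argument is inherited from
    \<open>A\<close> by uniqueness of derivatives.\<close>
  have lin': "linear (A' u)" for u
  proof (rule linearI)
    have "((\<lambda>x. A x (v + w)) has_derivative (\<lambda>u. A' u v + A' u w)) (at x)" for v w
      by (rule has_derivative_transform_within_open[OF has_derivative_add[OF dA[of v] dA[of w]] assms(1,2)])
        (simp add: linear_add[OF assms(3)])
    from has_derivative_unique[OF this dA] show "A' u (v + w) = A' u v + A' u w" for v w
      by metis
    have "((\<lambda>x. A x (c *\<^sub>R v)) has_derivative (\<lambda>u. c *\<^sub>R A' u v)) (at x)" for v c
      by (rule has_derivative_transform_within_open[OF has_derivative_scaleR_right[OF dA[of v]] assms(1,2)])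
        (simp add: linear_cmul[OF assms(3)])
    from has_derivative_unique[OF this dA] show "A' u (c *\<^sub>R v) = c *\<^sub>R A' u v" for v c
      by metis
  qed
  have "((\<lambda>x. \<Sum>b\<in>Basis. (f x \<bullet> b) *\<^sub>R A x b) has_derivative
      (\<lambda>u. \<Sum>b\<in>Basis. (f x \<bullet> b) *\<^sub>R A' u b + (f' u \<bullet> b) *\<^sub>R A x b)) (at x)"
    by (intro has_derivative_sum has_derivative_scaleR has_derivative_inner_left df dA)
  moreover have "(\<Sum>b\<in>Basis. (f x \<bullet> b) *\<^sub>R A' u b + (f' u \<bullet> b) *\<^sub>R A x b) = A' u (f x) + A x (f' u)" for u
    using assms(2,3) by (simp add: sum.distrib linear_euclidean_sum[OF lin', of u "f x"] linear_euclidean_sum[of "A x" "f' u"])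
  ultimately have *: "((\<lambda>x. \<Sum>b\<in>Basis. (f x \<bullet> b) *\<^sub>R A x b) has_derivative (\<lambda>u. A' u (f x) + A x (f' u))) (at x)"
    by simp
  show ?thesis
    by (rule has_derivative_transform_within_open[OF * assms(1,2)])
      (simp add: linear_euclidean_sum[OF assms(3), symmetric])
qed

lemma smooth_on_D_linear_apply:
  fixes A :: "'a::euclidean_space \<Rightarrow> 'b::euclidean_space \<Rightarrow> 'c::real_normed_vector"
  assumes "open S" "x \<in> S" "\<And>x. x \<in> S \<Longrightarrow> linear (A x)" "\<And>v. smooth_on S (\<lambda>x. A x v)" "smooth_on S f"
  shows "D (\<lambda>x. A x (f x)) x u = D (\<lambda>y. A y (f x)) x u + A x (D f x u)"
  using D_eqI[OF has_derivative_linear_apply[OF assms(1,2,3), where A'="\<lambda>u v. D (\<lambda>x. A x v) x u"],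
      OF _ _ smooth_on_has_derivative[OF assms(5,2)]] smooth_on_has_derivative[OF assms(4,2)]
  by simp

lemma smooth_on_D_bilinear_apply:
  fixes A :: "'a::euclidean_space \<Rightarrow> 'b::euclidean_space \<Rightarrow> 'd::euclidean_space \<Rightarrow> 'c::real_normed_vector"
  assumes S: "open S" "x \<in> S" "\<And>x. x \<in> S \<Longrightarrow> bilinear (A x)" "\<And>v w. smooth_on S (\<lambda>x. A x v w)"
    and fg: "smooth_on S f" "smooth_on S g"
  shows "D (\<lambda>x. A x (f x) (g x)) x u =
    D (\<lambda>y. A y (f x) (g x)) x u + A x (D f x u) (g x) + A x (f x) (D g x u)"
proof -
  have 1: "linear (\<lambda>v. A y v w)" "linear (A y v)" if "y \<in> S" for y v w
    using S(3)[OF that] by (auto simp: bilinear_def)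
  have 2: "smooth_on S (\<lambda>x. A x (f x) w)" for w
    by (rule smooth_on_linear_apply[where A="\<lambda>x v. A x v w"]) (use S fg 1 in auto)
  have "D (\<lambda>x. A x (f x) (g x)) x u = D (\<lambda>y. A y (f y) (g x)) x u + A x (f x) (D g x u)"
    by (rule smooth_on_D_linear_apply[where A="\<lambda>x. A x (f x)"]) (use S fg 1 2 in auto)
  also have "D (\<lambda>y. A y (f y) (g x)) x u = D (\<lambda>y. A y (f x) (g x)) x u + A x (D f x u) (g x)"
    by (rule smooth_on_D_linear_apply[where A="\<lambda>y v. A y v (g x)"]) (use S fg 1 2 in auto)
  finally show ?thesis by simp
qed

text \<open>Both sides are the limit of the second difference \<open>\<Delta> u v h\<close> divided
  by \<open>h^2\<close>, and \<open>\<Delta>\<close> is symmetric in \<open>u\<close> and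
  \<open>v\<close>. The limit comes from the mean value inequality along one edge of the
  parallelogram.\<close>

lemma symmetric_second_derivative:
  fixes f :: "'a::euclidean_space \<Rightarrow> 'b::real_normed_vector"
  assumes "open S" "x \<in> S" "smooth_on S f"
  shows "D (\<lambda>y. D f y u) x v = D (\<lambda>y. D f y v) x u"
proof -
  define \<Delta> where "\<Delta> u v h = f (x + h *\<^sub>R u + h *\<^sub>R v) - f (x + h *\<^sub>R u) - f (x + h *\<^sub>R v) + f x" for u v and h :: real
  have key: "\<exists>d>0. \<forall>h. 0 < h \<and> h < d \<longrightarrow> norm (\<Delta> u v h - h^2 *\<^sub>R D (\<lambda>y. D f y u) x v) \<le> e * h^2"
    if "e > 0" for u v e
  proof -
    \<comment> \<open>\<open>C\<close> bounds \<open>norm u + norm v\<close>, so that the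
      parallelogram of size \<open>h\<close> stays within distance \<open>h * C\<close> of
      \<open>x\<close>; the summand 1 keeps it positive.\<close>
    define C where "C = 2 * norm u + norm v + 1"
    have C: "C > 0" by (simp add: C_def add_nonneg_pos)
    define L where "L = D (\<lambda>y. D f y u) x"
    \<comment> \<open>Half of \<open>e\<close> for each of the two points at which \<open>G'\<close>
      evaluates \<open>D f\<close>; \<open>C\<close> undoes the bound \<open>h * C\<close> on their
      distance from \<open>x\<close>.\<close>
    have "e / (2 * C) > 0" using C that by simp
    moreover have "((\<lambda>y. D f y u) has_derivative L) (at x)"
      unfolding L_def by (rule smooth_on_has_derivative[OF smooth_on_D[OF assms(3)] assms(2)])
    ultimately obtain d1 where d1: "d1 > 0" "\<And>y. norm (y - x) < d1 \<Longrightarrow>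
        norm (D f y u - D f x u - L (y - x)) \<le> e / (2 * C) * norm (y - x)"
      and linL: "linear L"
      unfolding has_derivative_at_alt by (meson bounded_linear.linear)
    obtain d2 where d2: "d2 > 0" "ball x d2 \<subseteq> S" using assms(1,2) open_contains_ball by blast
    define d where "d = min d1 d2 / C"
    have "norm (\<Delta> u v h - h^2 *\<^sub>R L v) \<le> e * h^2" if h: "0 < h" "h < d" for h
    proof -
      have hC: "h * C < d1" "h * C < d2" using h C d1 d2 by (auto simp: d_def field_simps)
      have small: "norm (s *\<^sub>R u + r *\<^sub>R v) \<le> h * C" if "s \<in> {0..h}" "r \<in> {0..h}" for s r
      proof -
        have "norm (s *\<^sub>R u + r *\<^sub>R v) \<le> s * norm u + r * norm v"
          using norm_triangle_ineq[of "s *\<^sub>R u" "r *\<^sub>R v"] that by simp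
        also have "\<dots> \<le> h * norm u + h * norm v" using that by (intro add_mono mult_right_mono) auto
        also have "\<dots> \<le> h * C" using h by (simp add: C_def algebra_simps)
        finally show ?thesis .
      qed
      have in_S: "x + (s *\<^sub>R u + r *\<^sub>R v) \<in> S" if "s \<in> {0..h}" "r \<in> {0..h}" for s r
      proof -
        have "dist x (x + (s *\<^sub>R u + r *\<^sub>R v)) = norm (s *\<^sub>R u + r *\<^sub>R v)"
          by (metis add_diff_cancel_left' dist_commute dist_norm)
        then show ?thesis using small[OF that] hC(2) d2(2) by (auto simp: subset_iff)
      qed
      \<comment> \<open>A first difference of \<open>f\<close> in direction \<open>v\<close>, minus
        its expected linear growth; its increment over \<open>{0..h}\<close> is exactly the error of
        the second difference.\<close>
      define G where "G s = f (x + (s *\<^sub>R u + h *\<^sub>R v)) - f (x + (s *\<^sub>R u + 0 *\<^sub>R v)) - s *\<^sub>R (h *\<^sub>R L v)" for s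
      define G' where "G' s = D f (x + (s *\<^sub>R u + h *\<^sub>R v)) u - D f (x + (s *\<^sub>R u + 0 *\<^sub>R v)) u - h *\<^sub>R L v" for s
      have G: "(G has_derivative (\<lambda>t. t *\<^sub>R G' s)) (at s within {0..h})" if "s \<in> {0..h}" for s
      proof -
        have 1: "((\<lambda>s. f (x + (s *\<^sub>R u + r *\<^sub>R v))) has_derivative (\<lambda>t. D f (x + (s *\<^sub>R u + r *\<^sub>R v)) (t *\<^sub>R u))) (at s within {0..h})"
          if "r \<in> {0..h}" for r
        proof (rule has_derivative_compose[where g=f])
          show "((\<lambda>s. x + (s *\<^sub>R u + r *\<^sub>R v)) has_derivative (\<lambda>t. t *\<^sub>R u)) (at s within {0..h})"
            by (auto intro!: derivative_eq_intros)
        qed (rule smooth_on_has_derivative[OF assms(3) in_S[OF \<open>s \<in> {0..h}\<close> that]])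
        have 2: "linear (D f (x + (s *\<^sub>R u + r *\<^sub>R v)))" if "r \<in> {0..h}" for r
          by (rule smooth_on_linear_D[OF assms(3) in_S[OF \<open>s \<in> {0..h}\<close> that]])
        have "(G has_derivative (\<lambda>t. D f (x + (s *\<^sub>R u + h *\<^sub>R v)) (t *\<^sub>R u)
            - D f (x + (s *\<^sub>R u + 0 *\<^sub>R v)) (t *\<^sub>R u) - t *\<^sub>R (h *\<^sub>R L v))) (at s within {0..h})"
          unfolding G_def
          by (intro has_derivative_diff 1 bounded_linear_imp_has_derivative bounded_linear_scaleR_left)
            (use h in auto)
        then show ?thesis
          by (rule has_derivative_eq_rhs)
            (use h 2[of 0] 2[of h] in \<open>simp add: G'_def linear_cmul scaleR_right_diff_distrib\<close>)
      qed
      have "norm (G' s) \<le> e * h" if "s \<in> {0..h}" for s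
      proof -
        have a: "norm (D f (x + (s *\<^sub>R u + r *\<^sub>R v)) u - D f x u - L (s *\<^sub>R u + r *\<^sub>R v)) \<le> e / 2 * h"
          if r: "r \<in> {0..h}" for r
        proof -
          have "norm (D f (x + (s *\<^sub>R u + r *\<^sub>R v)) u - D f x u - L (s *\<^sub>R u + r *\<^sub>R v))
              \<le> e / (2 * C) * norm (s *\<^sub>R u + r *\<^sub>R v)"
            using d1(2)[of "x + (s *\<^sub>R u + r *\<^sub>R v)"] small[OF \<open>s \<in> {0..h}\<close> r] hC by simp
          also have "\<dots> \<le> e / (2 * C) * (h * C)"
            using small[OF \<open>s \<in> {0..h}\<close> r] \<open>e > 0\<close> C by (intro mult_left_mono) auto
          finally show ?thesis using C by simp
        qed
        have "G' s = (D f (x + (s *\<^sub>R u + h *\<^sub>R v)) u - D f x u - L (s *\<^sub>R u + h *\<^sub>R v))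
            - (D f (x + (s *\<^sub>R u + 0 *\<^sub>R v)) u - D f x u - L (s *\<^sub>R u + 0 *\<^sub>R v))"
          by (simp add: G'_def linear_add[OF linL] linear_cmul[OF linL] linear_0[OF linL])
        also have "norm \<dots> \<le> e / 2 * h + e / 2 * h"
          by (rule norm_triangle_le_diff, rule add_mono[OF a[of h] a[of 0]]) (use h in auto)
        finally show ?thesis by simp
      qed
      then have "norm (G h - G 0) \<le> (e * h) * norm (h - 0)"
        using h by (intro differentiable_bound[OF _ G]) (auto intro!: onorm_le simp: mult.commute mult_left_mono)
      moreover have "G h - G 0 = \<Delta> u v h - h^2 *\<^sub>R L v"
        by (simp add: G_def \<Delta>_def power2_eq_square algebra_simps)
      ultimately show ?thesis using h by (simp add: power2_eq_square)
    qed
    then show ?thesis using d1 d2 C unfolding L_def by (intro exI[of _ d]) (auto simp: d_def)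
  qed
  show ?thesis
  proof (rule ccontr)
    define a where "a = D (\<lambda>y. D f y u) x v - D (\<lambda>y. D f y v) x u"
    assume "\<not> ?thesis"
    then have a: "norm a > 0" by (simp add: a_def)
    obtain d1 where d1: "d1 > 0" "\<And>h. 0 < h \<and> h < d1 \<Longrightarrow> norm (\<Delta> u v h - h^2 *\<^sub>R D (\<lambda>y. D f y u) x v) \<le> norm a / 3 * h^2"
      using key[of "norm a / 3" u v] a by auto
    obtain d2 where d2: "d2 > 0" "\<And>h. 0 < h \<and> h < d2 \<Longrightarrow> norm (\<Delta> v u h - h^2 *\<^sub>R D (\<lambda>y. D f y v) x u) \<le> norm a / 3 * h^2"
      using key[of "norm a / 3" v u] a by auto
    define h where "h = min d1 d2 / 2"
    have h: "0 < h" "h < d1" "h < d2" using d1 d2 by (auto simp: h_def)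
    have "h^2 *\<^sub>R a = (\<Delta> v u h - h^2 *\<^sub>R D (\<lambda>y. D f y v) x u) - (\<Delta> u v h - h^2 *\<^sub>R D (\<lambda>y. D f y u) x v)"
      by (simp add: a_def \<Delta>_def algebra_simps)
    then have "norm (h^2 *\<^sub>R a) \<le> norm a / 3 * h^2 + norm a / 3 * h^2"
      using norm_triangle_le_diff[OF add_mono[OF d2(2)[of h] d1(2)[of h]]] h by simp
    moreover have "norm (h^2 *\<^sub>R a) = norm a * h^2" by simp
    moreover have "norm a * h^2 > 0" using a h by simp
    ultimately show False by simp
  qed
qed

section \<open>Families of linear maps: derivatives, bounds and inverses\<close>

lemma linear_D_family:
  fixes A :: "'a::euclidean_space \<Rightarrow> 'b::euclidean_space \<Rightarrow> 'c::real_normed_vector"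
  assumes "open S" "x \<in> S" "\<And>x. x \<in> S \<Longrightarrow> linear (A x)" "\<And>v. smooth_on S (\<lambda>x. A x v)"
  shows "linear (\<lambda>v. D (\<lambda>x. A x v) x u)"
proof (rule linearI)
  have dA: "((\<lambda>x. A x v) has_derivative D (\<lambda>x. A x v) x) (at x)" for v
    by (rule smooth_on_has_derivative[OF assms(4,2)])
  have "((\<lambda>x. A x (v + w)) has_derivative (\<lambda>u. D (\<lambda>x. A x v) x u + D (\<lambda>x. A x w) x u)) (at x)" for v w
    by (rule has_derivative_transform_within_open[OF has_derivative_add[OF dA[of v] dA[of w]] assms(1,2)])
      (simp add: linear_add[OF assms(3)])
  from D_eqI[OF this] show "D (\<lambda>x. A x (v + w)) x u = D (\<lambda>x. A x v) x u + D (\<lambda>x. A x w) x u" for v w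
    by simp
  have "((\<lambda>x. A x (c *\<^sub>R v)) has_derivative (\<lambda>u. c *\<^sub>R D (\<lambda>x. A x v) x u)) (at x)" for v c
    by (rule has_derivative_transform_within_open[OF has_derivative_scaleR_right[OF dA[of v]] assms(1,2)])
      (simp add: linear_cmul[OF assms(3)])
  from D_eqI[OF this] show "D (\<lambda>x. A x (c *\<^sub>R v)) x u = c *\<^sub>R D (\<lambda>x. A x v) x u" for v c
    by simp
qed

lemma bilinear_D_family:
  fixes A :: "'a::euclidean_space \<Rightarrow> 'b::euclidean_space \<Rightarrow> 'd::euclidean_space \<Rightarrow> 'c::real_normed_vector"
  assumes "open S" "x \<in> S" "\<And>x. x \<in> S \<Longrightarrow> bilinear (A x)" "\<And>v w. smooth_on S (\<lambda>x. A x v w)"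
  shows "bilinear (\<lambda>v w. D (\<lambda>x. A x v w) x u)"
  unfolding bilinear_def
  using linear_D_family[OF assms(1,2), of "\<lambda>x v. A x v w" for w]
    linear_D_family[OF assms(1,2), of "\<lambda>x. A x v" for v] assms(3,4)
  by (simp add: bilinear_def)

text \<open>Transfers bounds from pairs of basis vectors to all vectors. The separate factor
  \<open>m\<close> becomes 1, \<open>norm u\<close> or \<open>(norm (y - x))^2\<close> in the
  applications, so that one table of constants \<open>B\<close> serves all of them.\<close>

lemma bilinear_euclidean_bound:
  fixes T :: "'a::euclidean_space \<Rightarrow> 'b::euclidean_space \<Rightarrow> 'c::real_normed_vector"
  assumes "bilinear T" "\<And>e f. e \<in> Basis \<Longrightarrow> f \<in> Basis \<Longrightarrow> norm (T e f) \<le> B e f * m"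
  shows "norm (T v w) \<le> (\<Sum>e\<in>Basis. \<Sum>f\<in>Basis. B e f) * m * norm v * norm w"
proof -
  have l: "linear (T v)" "linear (\<lambda>v. T v w)" for v w using assms(1) by (auto simp: bilinear_def)
  have "T v w = (\<Sum>e\<in>Basis. (v \<bullet> e) *\<^sub>R (\<Sum>f\<in>Basis. (w \<bullet> f) *\<^sub>R T e f))"
    by (subst linear_euclidean_sum[OF l(2)]) (simp only: linear_euclidean_sum[OF l(1), of _ w])
  also have "norm \<dots> \<le> (\<Sum>e\<in>Basis. norm v * (\<Sum>f\<in>Basis. norm w * (B e f * m)))"
  proof (rule sum_norm_le)
    fix e :: 'a assume e: "e \<in> Basis"
    have "norm (\<Sum>f\<in>Basis. (w \<bullet> f) *\<^sub>R T e f) \<le> (\<Sum>f\<in>Basis. norm w * (B e f * m))"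
      by (rule sum_norm_le) (use e assms(2) in \<open>auto intro!: mult_mono Basis_le_norm\<close>)
    then show "norm ((v \<bullet> e) *\<^sub>R (\<Sum>f\<in>Basis. (w \<bullet> f) *\<^sub>R T e f)) \<le> norm v * (\<Sum>f\<in>Basis. norm w * (B e f * m))"
      using Basis_le_norm[OF e, of v] by (auto intro!: mult_mono)
  qed
  also have "\<dots> = (\<Sum>e\<in>Basis. \<Sum>f\<in>Basis. B e f) * m * norm v * norm w"
    by (simp add: sum_distrib_left sum_distrib_right mult_ac)
  finally show ?thesis .
qed

text \<open>Pointwise continuity at the finitely many basis vectors already gives closeness in
  operator norm.\<close>

lemma linear_family_close:
  fixes A :: "'a::euclidean_space \<Rightarrow> 'b::euclidean_space \<Rightarrow> 'c::real_normed_vector"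
  assumes "open S" "x0 \<in> S" "\<And>x. x \<in> S \<Longrightarrow> linear (A x)" "\<And>v. continuous_on S (\<lambda>x. A x v)" "e > 0"
  shows "\<forall>\<^sub>F x in at x0. x \<in> S \<and> (\<forall>w. norm (A x w - A x0 w) \<le> e * norm w)"
proof -
  define d where "d = e / DIM('b)"
  have d: "d > 0" using assms(5) by (simp add: d_def)
  have "\<forall>\<^sub>F x in at x0. \<forall>b\<in>Basis. dist (A x b) (A x0 b) < d"
    using assms(1,2,4) d
    by (intro eventually_ball_finite) (auto intro!: tendstoD simp: continuous_on_eq_continuous_at isCont_def)
  moreover have "\<forall>\<^sub>F x in at x0. x \<in> S" using assms(1,2) eventually_at_topological by blast
  ultimately show ?thesis
  proof eventually_elim
    case (elim x)
    have "norm (A x w - A x0 w) \<le> e * norm w" for w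
    proof -
      have "A x w - A x0 w = (\<Sum>b\<in>Basis. (w \<bullet> b) *\<^sub>R (A x b - A x0 b))"
        using elim assms(2)
        by (simp add: linear_euclidean_sum[OF assms(3), of _ w] sum_subtractf scaleR_right_diff_distrib)
      also have "norm \<dots> \<le> (\<Sum>b\<in>(Basis::'b set). norm w * d)"
        using elim(1) by (intro sum_norm_le)
          (auto intro!: mult_mono Basis_le_norm simp: dist_norm less_imp_le)
      finally show ?thesis by (simp add: d_def mult_ac)
    qed
    then show ?case using elim by blast
  qed
qed

lemma linear_inj_bij:
  fixes L :: "'a::euclidean_space \<Rightarrow> 'a"
  assumes "linear L" "inj L" shows "bij L" "linear (inv L)" "L (inv L v) = v" "inv L (L v) = v"
proof -
  show "bij L" using linear_injective_imp_surjective[OF assms] assms(2) by (simp add: bij_def)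
  then show 1: "L (inv L v) = v" for v by (simp add: bij_is_surj surj_f_inv_f)
  show "inv L (L v) = v" by (simp add: assms(2))
  show "linear (inv L)"
  proof (rule linearI)
    show "inv L (v + w) = inv L v + inv L w" for v w
      by (rule injD[OF assms(2)]) (simp add: 1 linear_add[OF assms(1)])
    show "inv L (c *\<^sub>R v) = c *\<^sub>R inv L v" for v c
      by (rule injD[OF assms(2)]) (simp add: 1 linear_cmul[OF assms(1)])
  qed
qed

text \<open>The lower bound \<open>c\<close> of \<open>A x0\<close> survives as \<open>c / 2\<close>
  for nearby \<open>A x\<close>, so the difference of the inverses at \<open>v\<close> is at most
  \<open>2 / c\<close> times the change of \<open>A\<close> at the fixed vector
  \<open>inv (A x0) v\<close>.\<close>

lemma continuous_linear_inv:
  fixes A :: "'a::euclidean_space \<Rightarrow> 'b::euclidean_space \<Rightarrow> 'b"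
  assumes "open S" "\<And>x. x \<in> S \<Longrightarrow> linear (A x)" "\<And>x. x \<in> S \<Longrightarrow> inj (A x)" "\<And>v. continuous_on S (\<lambda>x. A x v)"
  shows "continuous_on S (\<lambda>x. inv (A x) v)"
proof -
  have "((\<lambda>x. inv (A x) v) \<longlongrightarrow> inv (A x0) v) (at x0)" if x0: "x0 \<in> S" for x0
  proof -
    obtain c where c: "c > 0" "\<And>w. norm (A x0 w) \<ge> c * norm w"
      using linear_inj_bounded_below_pos[OF assms(2,3)[OF x0]] by (metis mult.commute)
    let ?w = "inv (A x0) v"
    have "\<forall>\<^sub>F x in at x0. norm (inv (A x) v - ?w) \<le> 2 / c * norm (A x ?w - A x0 ?w)"
    proof -
      have "\<forall>\<^sub>F x in at x0. x \<in> S \<and> (\<forall>w. norm (A x w - A x0 w) \<le> c / 2 * norm w)"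
        using linear_family_close[OF assms(1) x0 assms(2,4), of "c / 2"] c(1) by simp
      then show ?thesis
      proof eventually_elim
        case (elim x)
        let ?d = "inv (A x) v - ?w"
        note L = linear_inj_bij[OF assms(2,3)]
        have "c * norm ?d \<le> norm (A x0 ?d)" by (rule c)
        also have "\<dots> \<le> norm (A x ?d) + norm (A x ?d - A x0 ?d)"
          using norm_triangle_ineq4[of "A x ?d" "A x ?d - A x0 ?d"] by simp
        also have "\<dots> \<le> norm (A x ?d) + c * norm ?d / 2" using elim by simp
        finally have "c * norm ?d \<le> 2 * norm (A x ?d)" by simp
        also have "A x ?d = - (A x ?w - A x0 ?w)"
          using elim x0 by (simp add: linear_diff[OF assms(2)] L)
        finally show ?case using c by (simp only: norm_minus_cancel) (simp add: field_simps)
      qed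
    qed
    moreover have "((\<lambda>x. 2 / c * norm (A x ?w - A x0 ?w)) \<longlongrightarrow> 0) (at x0)"
    proof -
      have "((\<lambda>x. A x ?w) \<longlongrightarrow> A x0 ?w) (at x0)"
        using assms(1,4) x0 by (simp add: continuous_on_eq_continuous_at isCont_def)
      then show ?thesis using c(1) by (auto intro!: tendsto_eq_intros)
    qed
    ultimately have "((\<lambda>x. inv (A x) v - ?w) \<longlongrightarrow> 0) (at x0)"
      by (rule Lim_null_comparison)
    then show ?thesis by (simp add: LIM_zero_iff)
  qed
  then show ?thesis by (simp add: continuous_at_imp_continuous_on isCont_def)
qed

text \<open>At a zero of \<phi>, continuity of the other factor is enough. This serves for
  \<open>inv (A y)\<close>, which is not yet known to be differentiable when its derivative is
  computed.\<close>

lemma has_derivative_scaleR_vanishing: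
  fixes \<phi> :: "'a::real_normed_vector \<Rightarrow> real"
  assumes "(\<phi> has_derivative \<phi>') (at x)" "\<phi> x = 0" "isCont \<psi> x"
  shows "((\<lambda>y. \<phi> y *\<^sub>R \<psi> y) has_derivative (\<lambda>u. \<phi>' u *\<^sub>R \<psi> x)) (at x)"
proof -
  have bl: "bounded_linear \<phi>'" using assms(1) by (rule has_derivative_bounded_linear)
  \<comment> \<open>After division by \<open>norm (y - x)\<close>, the first summand is the
    vanishing remainder of \<phi> times a convergent factor, the second a bounded quotient times a
    factor tending to 0.\<close>
  have eq: "\<phi> y *\<^sub>R \<psi> y - \<phi> x *\<^sub>R \<psi> x - \<phi>' (y - x) *\<^sub>R \<psi> x =
      (\<phi> y - \<phi> x - \<phi>' (y - x)) *\<^sub>R \<psi> y + \<phi>' (y - x) *\<^sub>R (\<psi> y - \<psi> x)" for y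
    by (simp add: assms(2) algebra_simps)
  have 1: "((\<lambda>y. ((\<phi> y - \<phi> x - \<phi>' (y - x)) / norm (y - x)) *\<^sub>R \<psi> y) \<longlongrightarrow> 0 *\<^sub>R \<psi> x) (at x)"
    by (rule tendsto_scaleR) (use assms in \<open>auto simp: has_derivative_at_within isCont_def divide_inverse mult.commute\<close>)
  obtain K where K: "\<And>u. norm (\<phi>' u) \<le> norm u * K" using bounded_linear.bounded[OF bl] by blast
  have 2: "((\<lambda>y. (\<phi>' (y - x) / norm (y - x)) *\<^sub>R (\<psi> y - \<psi> x)) \<longlongrightarrow> 0) (at x)"
  proof (rule Lim_null_comparison)
    show "\<forall>\<^sub>F y in at x. norm ((\<phi>' (y - x) / norm (y - x)) *\<^sub>R (\<psi> y - \<psi> x)) \<le> K * norm (\<psi> y - \<psi> x)"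
      using eventually_at_filter[of "\<lambda>y. y \<noteq> x"]
    proof -
      have "norm ((\<phi>' (y - x) / norm (y - x)) *\<^sub>R (\<psi> y - \<psi> x)) \<le> K * norm (\<psi> y - \<psi> x)" if "y \<noteq> x" for y
      proof -
        have "\<bar>\<phi>' (y - x) / norm (y - x)\<bar> \<le> K" using K[of "y - x"] that by (simp add: field_simps)
        then show ?thesis by (simp add: mult_right_mono del: abs_divide)
      qed
      then show ?thesis by (simp add: eventually_at_filter)
    qed
    show "((\<lambda>y. K * norm (\<psi> y - \<psi> x)) \<longlongrightarrow> 0) (at x)"
      using assms(3) unfolding isCont_def by (auto intro!: tendsto_eq_intros)
  qed
  have "((\<lambda>y. (\<phi> y *\<^sub>R \<psi> y - \<phi> x *\<^sub>R \<psi> x - \<phi>' (y - x) *\<^sub>R \<psi> x) /\<^sub>R norm (y - x)) \<longlongrightarrow> 0) (at x)"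
    using tendsto_add[OF 1 2] unfolding eq
    by (simp add: scaleR_right_distrib divide_inverse mult.commute)
  then show ?thesis
    unfolding has_derivative_at_within
    by (intro conjI bounded_linear_scaleR_const bl) simp
qed

text \<open>With \<open>w = inv (A x) v\<close> one has
  \<open>inv (A y) v = w + inv (A y) (v - A y w)\<close>, and \<open>v - A y w\<close> vanishes at
  \<open>y = x\<close>; expanded in the basis, \<open>has_derivative_scaleR_vanishing\<close>
  applies to each summand.\<close>

lemma has_derivative_linear_inv:
  fixes A :: "'a::euclidean_space \<Rightarrow> 'b::euclidean_space \<Rightarrow> 'b"
  assumes "open S" "x \<in> S" "\<And>x. x \<in> S \<Longrightarrow> linear (A x)" "\<And>x. x \<in> S \<Longrightarrow> inj (A x)" "\<And>v. smooth_on S (\<lambda>x. A x v)"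
  shows "((\<lambda>x. inv (A x) v) has_derivative (\<lambda>u. - inv (A x) (D (\<lambda>y. A y (inv (A x) v)) x u))) (at x)"
proof -
  define w where "w = inv (A x) v"
  define L where "L = D (\<lambda>y. A y w) x"
  note inv = linear_inj_bij[OF assms(3,4)]
  have dA: "((\<lambda>y. A y w) has_derivative L) (at x)"
    unfolding L_def by (rule smooth_on_has_derivative[OF assms(5,2)])
  have cont: "continuous_on S (\<lambda>x. inv (A x) v)" for v
    by (rule continuous_linear_inv[OF assms(1,3,4)]) (auto intro: smooth_on_continuous assms)
  have "((\<lambda>y. w + (\<Sum>b\<in>Basis. ((v - A y w) \<bullet> b) *\<^sub>R inv (A y) b)) has_derivative
      (\<lambda>u. 0 + (\<Sum>b\<in>Basis. (((0 - L u) \<bullet> b) *\<^sub>R inv (A x) b)))) (at x)"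
    by (intro has_derivative_add has_derivative_const has_derivative_sum has_derivative_scaleR_vanishing
        has_derivative_inner_left has_derivative_diff dA)
      (use cont assms(1,2) inv in \<open>auto simp: continuous_on_eq_continuous_at w_def\<close>)
  also have "(\<lambda>u. 0 + (\<Sum>b\<in>Basis. (((0 - L u) \<bullet> b) *\<^sub>R inv (A x) b))) = (\<lambda>u. - inv (A x) (L u))"
    by (simp only: linear_euclidean_sum[OF inv(2)[OF assms(2,2)], symmetric])
      (simp add: linear_neg[OF inv(2)[OF assms(2,2)]])
  finally show ?thesis unfolding L_def w_def
  proof (rule has_derivative_transform_within_open[OF _ assms(1,2)])
    fix y assume y: "y \<in> S"
    show "inv (A x) v + (\<Sum>b\<in>Basis. ((v - A y (inv (A x) v)) \<bullet> b) *\<^sub>R inv (A y) b) = inv (A y) v"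
      using y by (simp only: linear_euclidean_sum[OF inv(2)[OF y y], symmetric])
        (simp add: linear_diff[OF inv(2)[OF y y]] inv(4)[OF y y])
  qed
qed

text \<open>The derivative formula contains the inverse itself undifferentiated, hence the induction
  on the order, generalised over \<open>v\<close>.\<close>

lemma Ck_on_linear_inv:
  fixes A :: "'a::euclidean_space \<Rightarrow> 'b::euclidean_space \<Rightarrow> 'b"
  assumes "open S" "\<And>x. x \<in> S \<Longrightarrow> linear (A x)" "\<And>x. x \<in> S \<Longrightarrow> inj (A x)" "\<And>v. smooth_on S (\<lambda>x. A x v)"
  shows "Ck_on n S (\<lambda>x. inv (A x) v)"
proof (induction n arbitrary: v)
  case 0
  then show ?case using continuous_linear_inv[OF assms(1-3)] assms(4) by (simp add: smooth_on_continuous)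
next
  case (Suc n)
  note inv = linear_inj_bij[OF assms(2,3)]
  show ?case
  proof (rule Ck_on_SucI[OF assms(1) has_derivative_linear_inv[OF assms(1) _ assms(2-4)]])
    fix u
    have 1: "Ck_on n S (\<lambda>x. D (\<lambda>y. A y (inv (A x) v)) x u)"
      by (rule Ck_on_linear_apply[where A="\<lambda>x w. D (\<lambda>y. A y w) x u"])
        (use Suc.IH assms in \<open>auto intro!: linear_D_family smooth_onD_Ck smooth_on_D\<close>)
    have "Ck_on n S (\<lambda>x. inv (A x) (D (\<lambda>y. A y (inv (A x) v)) x u))"
      by (rule Ck_on_linear_apply[where A="\<lambda>x. inv (A x)"]) (use inv(2) assms(1) 1 Suc.IH in auto)
    then show "Ck_on n S (\<lambda>x. - inv (A x) (D (\<lambda>y. A y (inv (A x) v)) x u))"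
      by (rule Ck_on_bounded_linear[OF bounded_linear_minus[OF bounded_linear_ident] assms(1)])
  qed
qed

lemma smooth_on_linear_inv:
  fixes A :: "'a::euclidean_space \<Rightarrow> 'b::euclidean_space \<Rightarrow> 'b"
  assumes "open S" "\<And>x. x \<in> S \<Longrightarrow> linear (A x)" "\<And>x. x \<in> S \<Longrightarrow> inj (A x)" "\<And>v. smooth_on S (\<lambda>x. A x v)"
  shows "smooth_on S (\<lambda>x. inv (A x) v)"
  by (simp add: smooth_on_def Ck_on_linear_inv[OF assms])

text \<open>Since \<open>D g y v = (D f (g y))\<^sup>-\<^sup>1 v\<close> involves \<open>g\<close> undifferentiated only, the regularity of
  the inverse \<open>g\<close> bootstraps.\<close>

lemma smooth_local_inverse:
  fixes f :: "'a::euclidean_space \<Rightarrow> 'a"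
  assumes "open S" "smooth_on S f" "x0 \<in> S" "inj (D f x0)"
  obtains U g where "open U" "x0 \<in> U" "U \<subseteq> S" "open (f ` U)" "smooth_on (f ` U) g" "\<And>x. x \<in> U \<Longrightarrow> g (f x) = x"
proof -
  \<comment> \<open>The inverse function theorem expects the derivative as a continuous map into
    bounded linear functions; in finite dimension continuity can be checked on evaluations.\<close>
  define F where "F x = Blinfun (D f x)" for x
  have F: "blinfun_apply (F x) = D f x" if "x \<in> S" for x
    unfolding F_def
    by (rule bounded_linear_Blinfun_apply)
      (use smooth_on_has_derivative[OF assms(2) that] in \<open>auto dest: has_derivative_bounded_linear\<close>)
  have contF: "continuous_on S F"
    by (rule continuous_on_blinfun_componentwise)
      (rule continuous_on_eq[OF smooth_on_continuous[OF smooth_on_D[OF assms(2)]]], simp add: F)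
  note inv0 = linear_inj_bij[OF smooth_on_linear_D[OF assms(2,3)] assms(4)]
  have "Blinfun (inv (D f x0)) o\<^sub>L F x0 = id_blinfun"
    using F[OF assms(3)] inv0
    by (intro blinfun_eqI) (simp add: bounded_linear_Blinfun_apply linear_conv_bounded_linear)
  then obtain U V g g' where U: "open U" "U \<subseteq> S" "x0 \<in> U" "open V" "homeomorphism U V f g"
    and g: "\<And>y. y \<in> V \<Longrightarrow> (g has_derivative (g' y)) (at y)"
      "\<And>y. y \<in> V \<Longrightarrow> g' y = inv (blinfun_apply (F (g y)))"
      "\<And>y. y \<in> V \<Longrightarrow> bij (blinfun_apply (F (g y)))"
    using inverse_function_theorem[OF assms(1) _ contF assms(3), of f] F smooth_on_has_derivative[OF assms(2)]
    by (metis (no_types, lifting))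
  have fU: "f ` U = V" and gV: "\<And>y. y \<in> V \<Longrightarrow> g y \<in> U" and gf: "\<And>x. x \<in> U \<Longrightarrow> g (f x) = x"
    using U(5) by (auto simp: homeomorphism_def)
  have injD: "inj (D f x)" if "x \<in> U" for x
    using g(3)[of "f x"] gf[OF that] fU that F U(2) by (metis bij_is_inj image_eqI subsetD)
  have Dinv: "smooth_on U (\<lambda>x. inv (D f x) v)" for v
    by (rule smooth_on_linear_inv[OF U(1)])
      (use injD U(2) smooth_on_subset[OF assms(2) U(2)] in \<open>auto intro: smooth_on_linear_D smooth_on_D\<close>)
  have "Ck_on n V g" for n
  proof (induction n)
    case 0 then show ?case using U(5) by (simp add: homeomorphism_def)
  next
    case (Suc n)
    show ?case
    proof (rule Ck_on_SucI[OF U(4) g(1)])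
      fix v
      have "Ck_on n V (\<lambda>y. inv (D f (g y)) v)"
        by (rule Ck_on_compose[OF U(4,1) _ smooth_onD_Ck[OF Dinv] Suc.IH]) (use gV in blast)
      then show "Ck_on n V (\<lambda>y. g' y v)"
        by (rule Ck_on_cong[OF U(4), rotated]) (metis F gV U(2) g(2) subsetD)
    qed
  qed
  then show thesis using that[of U g] U fU gf by (simp add: smooth_on_def)
qed

section \<open>Flat linear systems\<close>

text \<open>Picard iteration as a series. The factor 1/2 makes it converge like a geometric series
  on the whole unit interval, which also yields the bound \<open>2 * norm c\<close>.\<close>

lemma contractive_linear_ode:
  fixes L :: "real \<Rightarrow> 'f::euclidean_space \<Rightarrow> 'f"
  assumes lin: "\<And>t. t \<in> {0..1} \<Longrightarrow> linear (L t)"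
    and cont: "\<And>v. continuous_on {0..1} (\<lambda>t. L t v)"
    and bd: "\<And>t v. t \<in> {0..1} \<Longrightarrow> norm (L t v) \<le> norm v / 2"
  obtains g where "g 0 = c" "\<And>t. t \<in> {0..1} \<Longrightarrow> (g has_vector_derivative L t (g t)) (at t within {0..1})"
    "\<And>t. t \<in> {0..1} \<Longrightarrow> norm (g t) \<le> 2 * norm c"
proof -
  \<comment> \<open>\<open>G n\<close> is the n-th summand of the series, not the n-th
    iterate.\<close>
  define G where "G = rec_nat (\<lambda>t. c) (\<lambda>n g t. integral {0..t} (\<lambda>s. L s (g s)))"
  have G0: "G 0 t = c" and GS: "G (Suc n) t = integral {0..t} (\<lambda>s. L s (G n s))" for n t
    by (simp_all add: G_def)
  have cont_L: "continuous_on {0..1} (\<lambda>t. L t (h t))" if "continuous_on {0..1} h" for h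
  proof (rule continuous_on_eq)
    show "continuous_on {0..1} (\<lambda>t. \<Sum>b\<in>Basis. (h t \<bullet> b) *\<^sub>R L t b)"
      by (intro continuous_intros cont that)
  qed (simp add: linear_euclidean_sum[OF lin, symmetric])
  have G: "continuous_on {0..1} (G n) \<and> (\<forall>t\<in>{0..1}. norm (G n t) \<le> (1/2)^n * norm c)" for n
  proof (induction n)
    case 0 then show ?case by (simp add: G0)
  next
    case (Suc n)
    have cL: "continuous_on {0..1} (\<lambda>t. L t (G n t))" using cont_L Suc by blast
    have "continuous_on {0..1} (G (Suc n))"
      unfolding GS using indefinite_integral_continuous_1[OF integrable_continuous_real[OF cL]] .
    moreover have "norm (G (Suc n) t) \<le> (1/2)^Suc n * norm c" if t: "t \<in> {0..1}" for t
    proof -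
      have "norm (L s (G n s)) \<le> (1/2)^Suc n * norm c" if "s \<in> {0..t}" for s
      proof -
        have s: "s \<in> {0..1}" using that t by auto
        have "norm (L s (G n s)) \<le> norm (G n s) / 2" by (rule bd[OF s])
        also have "\<dots> \<le> (1/2)^n * norm c / 2" using Suc s by (intro divide_right_mono) auto
        finally show ?thesis by simp
      qed
      then have "norm (G (Suc n) t) \<le> (1/2)^Suc n * norm c * (t - 0)"
        unfolding GS using t by (intro integral_bound continuous_on_subset[OF cL]) auto
      also have "\<dots> \<le> (1/2)^Suc n * norm c * 1"
        using t by (intro mult_left_mono) auto
      finally show ?thesis by simp
    qed
    ultimately show ?case by blast
  qed
  have sumb: "summable (\<lambda>n. (1/2)^(n + k) * norm c)" for k
    unfolding power_add by (intro summable_mult2 summable_geometric) auto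
  have summ: "summable (\<lambda>n. G (n + k) t)" "norm (\<Sum>n. G (n + k) t) \<le> 2 * (1/2)^k * norm c" if t: "t \<in> {0..1}" for t k
  proof -
    show "summable (\<lambda>n. G (n + k) t)"
      by (rule summable_comparison_test[OF _ sumb[of k]]) (use G t in auto)
    have sn: "summable (\<lambda>n. norm (G (n + k) t))"
      by (rule summable_comparison_test[OF _ sumb[of k]]) (use G t in auto)
    have "norm (\<Sum>n. G (n + k) t) \<le> (\<Sum>n. norm (G (n + k) t))" by (rule summable_norm[OF sn])
    also have "\<dots> \<le> (\<Sum>n. (1/2)^(n + k) * norm c)"
      by (rule suminf_le[OF _ sn sumb]) (use G t in auto)
    also have "\<dots> = (\<Sum>n. (1/2::real)^n) * ((1/2)^k * norm c)"
      by (simp add: suminf_mult2[OF summable_geometric] power_add mult.assoc)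
    finally show "norm (\<Sum>n. G (n + k) t) \<le> 2 * (1/2)^k * norm c" by (simp add: suminf_geometric)
  qed
  define g where "g t = (\<Sum>n. G n t)" for t
  have g: "(\<lambda>n. G n t) sums g t" if "t \<in> {0..1}" for t
    using summ(1)[OF that, of 0] by (simp add: g_def summable_sums)
  \<comment> \<open>The zeroth summand is constant; the derivative of each later one is
    \<open>L\<close> applied to its predecessor.\<close>
  define f' where "f' n t h = h *\<^sub>R (case n of 0 \<Rightarrow> 0 | Suc m \<Rightarrow> L t (G m t))" for n t and h :: real
  have G': "(G n has_derivative f' n t) (at t within {0..1})" if "t \<in> {0..1}" for n t
  proof (cases n)
    case 0 then show ?thesis by (simp add: f'_def[abs_def] G0[abs_def])
  next
    case (Suc m)
    have cL: "continuous_on {0..1} (\<lambda>t. L t (G m t))" using cont_L G by blast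
    show ?thesis
      using integral_has_vector_derivative[OF cL that]
      by (simp add: Suc f'_def[abs_def] has_vector_derivative_def GS[abs_def])
  qed
  \<comment> \<open>By the index shift, \<open>n\<close> derivatives add up to \<open>L\<close>
    applied to \<open>n - 1\<close> summands, so the error is \<open>L\<close> applied to a tail of
    the series.\<close>
  have tail: "\<forall>\<^sub>F n in sequentially. \<forall>t\<in>{0..1}. \<forall>h. norm ((\<Sum>i<n. f' i t h) - h *\<^sub>R L t (g t)) \<le> e * norm h"
    if "e > 0" for e
  proof -
    have "(\<lambda>n. (1/2::real)^n * norm c) \<longlonglongrightarrow> 0"
      by (rule tendsto_mult_left_zero) (simp add: LIMSEQ_power_zero)
    then have "\<forall>\<^sub>F n in sequentially. (1/2)^n * norm c < e"
      using that by (auto simp: order_tendsto_iff)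
    then obtain N where N: "\<And>n. n \<ge> N \<Longrightarrow> (1/2)^n * norm c < e" by (auto simp: eventually_sequentially)
    have "norm ((\<Sum>i<n. f' i t h) - h *\<^sub>R L t (g t)) \<le> e * norm h" if n: "n \<ge> Suc N" and t: "t \<in> {0..1}" for n t h
    proof -
      obtain m where m: "n = Suc m" "m \<ge> N" using n by (cases n) auto
      have "(\<Sum>i<n. f' i t h) = (\<Sum>i<m. h *\<^sub>R L t (G i t))"
        by (simp only: m sum.lessThan_Suc_shift) (simp add: f'_def)
      also have "\<dots> = h *\<^sub>R L t (\<Sum>i<m. G i t)"
        by (simp add: linear_sum[OF lin[OF t]] scaleR_sum_right)
      finally have "(\<Sum>i<n. f' i t h) - h *\<^sub>R L t (g t) = - (h *\<^sub>R L t (g t - (\<Sum>i<m. G i t)))"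
        by (simp add: linear_diff[OF lin[OF t]] scaleR_right_diff_distrib)
      also have "g t - (\<Sum>i<m. G i t) = (\<Sum>i. G (i + m) t)"
        using suminf_split_initial_segment[of "\<lambda>n. G n t" m] summ(1)[OF t, of 0] by (simp add: g_def)
      finally have *: "norm ((\<Sum>i<n. f' i t h) - h *\<^sub>R L t (g t)) = \<bar>h\<bar> * norm (L t (\<Sum>i. G (i + m) t))"
        by simp
      have "norm (L t (\<Sum>i. G (i + m) t)) \<le> (2 * (1/2)^m * norm c) / 2"
        by (rule order_trans[OF bd[OF t] divide_right_mono[OF summ(2)[OF t]]]) simp
      also have "(2 * (1/2)^m * norm c) / 2 \<le> e" using N[OF m(2)] by simp
      finally show ?thesis unfolding * real_norm_def mult.commute[of e] by (rule mult_left_mono) simp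
    qed
    then show ?thesis unfolding eventually_sequentially by blast
  qed
  have "\<exists>g1. \<forall>t\<in>{0..1}. (\<lambda>n. G n t) sums g1 t \<and> (g1 has_derivative (\<lambda>h. h *\<^sub>R L t (g t))) (at t within {0..1})"
    using has_derivative_series[OF _ G' tail _ g[of 0]] by auto
  then obtain g1 where g1: "\<And>t. t \<in> {0..1} \<Longrightarrow> (\<lambda>n. G n t) sums g1 t"
    "\<And>t. t \<in> {0..1} \<Longrightarrow> (g1 has_derivative (\<lambda>h. h *\<^sub>R L t (g t))) (at t within {0..1})"
    by blast
  have eq: "g1 t = g t" if "t \<in> {0..1}" for t using sums_unique2[OF g1(1) g] that by auto
  show thesis
  proof
    have "G (Suc n) 0 = 0" for n unfolding GS by simp
    then have "G n 0 = 0" if "n \<notin> {0}" for n using that by (cases n) auto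
    then have "(\<lambda>n. G n 0) sums c" using sums_finite[of "{0}" "\<lambda>n. G n 0"] by (simp add: G0)
    then show "g 0 = c" using sums_unique2[OF g[of 0]] by simp
    show "(g has_vector_derivative L t (g t)) (at t within {0..1})" if "t \<in> {0..1}" for t
      unfolding has_vector_derivative_def
      by (rule has_derivative_transform[OF that eq[symmetric] g1(2)[OF that]])
    show "norm (g t) \<le> 2 * norm c" if "t \<in> {0..1}" for t
      using summ(2)[OF that, of 0] by (simp add: g_def)
  qed
qed

text \<open>Compactness bounds \<phi> and its first two derivatives, and convexity turns this into a
  bound for the Taylor remainder. One constant for all three estimates keeps the later bookkeeping
  short.\<close>

lemma smooth_quadratic_bound:
  fixes \<phi> :: "'a::euclidean_space \<Rightarrow> 'b::euclidean_space"
  assumes "open S" "smooth_on S \<phi>" "compact K" "convex K" "K \<subseteq> S"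
  obtains B where "B \<ge> 0" "\<And>x. x \<in> K \<Longrightarrow> norm (\<phi> x) \<le> B"
    "\<And>x u. x \<in> K \<Longrightarrow> norm (D \<phi> x u) \<le> B * norm u"
    "\<And>x y. x \<in> K \<Longrightarrow> y \<in> K \<Longrightarrow> norm (\<phi> y - \<phi> x - D \<phi> x (y - x)) \<le> B * (norm (y - x))^2"
proof -
  have bnd: "\<exists>B\<ge>0. \<forall>x\<in>K. norm (\<psi> x) \<le> B" if "smooth_on S \<psi>" for \<psi> :: "'a \<Rightarrow> 'b"
  proof -
    have "bounded (\<psi> ` K)"
      by (intro compact_imp_bounded compact_continuous_image assms(3)
          continuous_on_subset[OF smooth_on_continuous[OF that] assms(5)])
    then show ?thesis unfolding bounded_pos by (meson imageI less_imp_le)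
  qed
  have Dbnd: "\<exists>B\<ge>0. \<forall>x\<in>K. \<forall>u. norm (D \<psi> x u) \<le> B * norm u" if "smooth_on S \<psi>" for \<psi> :: "'a \<Rightarrow> 'b"
  proof -
    obtain B where B: "\<And>b. B b \<ge> 0" "\<And>b x. x \<in> K \<Longrightarrow> norm (D \<psi> x b) \<le> B b"
      using bnd[OF smooth_on_D[OF \<open>smooth_on S \<psi>\<close>]] by metis
    have "norm (D \<psi> x u) \<le> (\<Sum>b\<in>Basis. B b) * norm u" if x: "x \<in> K" for x u
    proof -
      have "D \<psi> x u = (\<Sum>b\<in>Basis. (u \<bullet> b) *\<^sub>R D \<psi> x b)"
        by (rule linear_euclidean_sum[OF smooth_on_linear_D[OF \<open>smooth_on S \<psi>\<close>]]) (use x assms in auto)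
      also have "norm \<dots> \<le> (\<Sum>b\<in>Basis. norm u * B b)"
        by (rule sum_norm_le) (use B x in \<open>auto intro!: mult_mono Basis_le_norm\<close>)
      finally show ?thesis by (simp add: sum_distrib_left mult.commute)
    qed
    then show ?thesis using B(1) by (intro exI[of _ "\<Sum>b\<in>Basis. B b"]) (auto intro: sum_nonneg)
  qed
  obtain B0 where B0: "B0 \<ge> 0" "\<And>x. x \<in> K \<Longrightarrow> norm (\<phi> x) \<le> B0" using bnd[OF assms(2)] by blast
  obtain B1 where B1: "B1 \<ge> 0" "\<And>x u. x \<in> K \<Longrightarrow> norm (D \<phi> x u) \<le> B1 * norm u" using Dbnd[OF assms(2)] by blast
  obtain B2 where B2: "\<And>b. B2 b \<ge> 0" "\<And>b x u. x \<in> K \<Longrightarrow> norm (D (\<lambda>y. D \<phi> y b) x u) \<le> B2 b * norm u"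
    using Dbnd[OF smooth_on_D[OF assms(2)]] by metis
  define C where "C = (\<Sum>b\<in>Basis. B2 b)"
  have C: "C \<ge> 0" by (simp add: C_def sum_nonneg B2)
  have lip: "norm (D \<phi> y u - D \<phi> x u) \<le> C * norm (y - x) * norm u" if "x \<in> K" "y \<in> K" for x y u
  proof -
    have lin: "linear (D \<phi> x)" if "x \<in> K" for x using smooth_on_linear_D[OF assms(2)] that assms(5) by blast
    have "D \<phi> y u - D \<phi> x u = (\<Sum>b\<in>Basis. (u \<bullet> b) *\<^sub>R (D \<phi> y b - D \<phi> x b))"
      by (simp add: linear_euclidean_sum[OF lin, of _ u] that sum_subtractf scaleR_right_diff_distrib)
    also have "norm \<dots> \<le> (\<Sum>b\<in>Basis. norm u * (B2 b * norm (y - x)))"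
    proof (rule sum_norm_le)
      fix b :: 'a assume b: "b \<in> Basis"
      have "norm (D \<phi> y b - D \<phi> x b) \<le> B2 b * norm (y - x)"
      proof (rule differentiable_bound[OF assms(4)])
        show "((\<lambda>y. D \<phi> y b) has_derivative D (\<lambda>y. D \<phi> y b) z) (at z within K)" if "z \<in> K" for z
          by (rule has_derivative_at_withinI[OF smooth_on_has_derivative[OF smooth_on_D[OF assms(2)]]])
            (use that assms(5) in blast)
        show "onorm (D (\<lambda>y. D \<phi> y b) z) \<le> B2 b" if "z \<in> K" for z
          by (rule onorm_le) (rule B2(2)[OF that])
      qed (use that in auto)
      then show "norm ((u \<bullet> b) *\<^sub>R (D \<phi> y b - D \<phi> x b)) \<le> norm u * (B2 b * norm (y - x))"
        using Basis_le_norm[OF b, of u] by (auto intro!: mult_mono)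
    qed
    finally show ?thesis by (simp add: C_def sum_distrib_left sum_distrib_right mult_ac)
  qed
  have taylor: "norm (\<phi> y - \<phi> x - D \<phi> x (y - x)) \<le> C * (norm (y - x))^2" if "x \<in> K" "y \<in> K" for x y
  proof -
    let ?K = "closed_segment x y"
    have sub: "?K \<subseteq> K" using that assms(4) by (simp add: closed_segment_subset)
    have "norm (\<phi> y - \<phi> x - D \<phi> x (y - x)) \<le> norm (y - x) * (C * norm (y - x))"
    proof (rule differentiable_bound_linearization[where S="?K"])
      show "x + t *\<^sub>R (y - x) \<in> ?K" if "t \<in> {0..1}" for t
        using that by (auto simp: closed_segment_def algebra_simps intro!: exI[of _ t])
      show "(\<phi> has_derivative D \<phi> z) (at z within ?K)" if "z \<in> ?K" for z
        by (rule has_derivative_at_withinI[OF smooth_on_has_derivative[OF assms(2)]])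
          (use that sub assms(5) in blast)
      show "onorm (D \<phi> z - D \<phi> x) \<le> C * norm (y - x)" if z: "z \<in> ?K" for z
      proof (rule onorm_le)
        fix u
        have "norm ((D \<phi> z - D \<phi> x) u) \<le> C * norm (z - x) * norm u"
          using lip[of x z u] z sub \<open>x \<in> K\<close> by auto
        also have "\<dots> \<le> C * norm (y - x) * norm u"
          using segment_bound1[OF z] C by (intro mult_right_mono mult_left_mono) auto
        finally show "norm ((D \<phi> z - D \<phi> x) u) \<le> C * norm (y - x) * norm u" .
      qed
    qed auto
    then show ?thesis by (simp add: power2_eq_square mult_ac)
  qed
  show thesis
  proof (rule that[of "max B0 (max B1 C)"])
    show "norm (D \<phi> x u) \<le> max B0 (max B1 C) * norm u" if "x \<in> K" for x u
      by (rule order_trans[OF B1(2)[OF that]]) (auto intro: mult_right_mono)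
    show "norm (\<phi> y - \<phi> x - D \<phi> x (y - x)) \<le> max B0 (max B1 C) * (norm (y - x))^2" if "x \<in> K" "y \<in> K" for x y
      by (rule order_trans[OF taylor[OF that]]) (auto intro: mult_right_mono)
  qed (use B0 in \<open>auto simp: le_max_iff_disj\<close>)
qed

lemma has_derivative_compose_at:
  assumes "(f has_derivative f') (at x within s)" "(g has_derivative g') (at y)" "f x = y"
  shows "((\<lambda>x. g (f x)) has_derivative (\<lambda>x. g' (f' x))) (at x within s)"
  using has_derivative_compose[of f f' x s g g'] assms by simp

text \<open>The solution is \<open>f x = g x 1\<close>, where \<open>g x\<close> solves the system along the ray through \<open>x\<close>.
  For \<open>h = y - x\<close>, the error \<open>E t = g y t - g x t - t A(t x) h (g x t)\<close> satisfies
  \<open>\<bar>E'\<bar> \<le> \<bar>E\<bar> / 2 + O(\<bar>h\<bar>\<^sup>2)\<close> because the terms linear in \<open>h\<close> cancel by flatness; so \<open>E 1 = O(\<bar>h\<bar>\<^sup>2)\<close>,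
  which says that \<open>f\<close> has the required derivative. No dependence of ODEs on parameters is needed.\<close>

lemma flat_system_solution_aux:
  fixes A :: "'e::euclidean_space \<Rightarrow> 'e \<Rightarrow> 'f::euclidean_space \<Rightarrow> 'f"
  assumes S: "open S" "0 \<in> S" and bil: "\<And>x. x \<in> S \<Longrightarrow> bilinear (A x)"
    and sm: "\<And>v w. smooth_on S (\<lambda>x. A x v w)"
    and flat: "\<And>x u v w. x \<in> S \<Longrightarrow>
      D (\<lambda>y. A y v w) x u + A x v (A x u w) = D (\<lambda>y. A y u w) x v + A x u (A x v w)"
  obtains r where "r > 0" "ball 0 r \<subseteq> S"
    "\<And>c. \<exists>f. f 0 = c \<and> (\<forall>x\<in>ball 0 r. (f has_derivative (\<lambda>v. A x v (f x))) (at x))"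
proof -
  obtain R where R: "R > 0" "cball 0 R \<subseteq> S" using S open_contains_cball by blast
  let ?K = "cball (0::'e) R"
  have "\<exists>B\<ge>0. (\<forall>x\<in>?K. norm (A x v w) \<le> B) \<and> (\<forall>x\<in>?K. \<forall>u. norm (D (\<lambda>y. A y v w) x u) \<le> B * norm u) \<and>
      (\<forall>x\<in>?K. \<forall>y\<in>?K. norm (A y v w - A x v w - D (\<lambda>y. A y v w) x (y - x)) \<le> B * (norm (y - x))^2)" for v w
    by (rule smooth_quadratic_bound[OF S(1) sm[of v w] compact_cball convex_cball R(2)]) blast
  then obtain B where B: "\<And>v w. B v w \<ge> 0" "\<And>x v w. x \<in> ?K \<Longrightarrow> norm (A x v w) \<le> B v w * 1"
    "\<And>x u v w. x \<in> ?K \<Longrightarrow> norm (D (\<lambda>y. A y v w) x u) \<le> B v w * norm u"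
    "\<And>x y v w. x \<in> ?K \<Longrightarrow> y \<in> ?K \<Longrightarrow> norm (A y v w - A x v w - D (\<lambda>y. A y v w) x (y - x)) \<le> B v w * (norm (y - x))^2"
    by (metis mult.right_neutral)
  \<comment> \<open>The added 1 gives \<open>C \<ge> 1\<close>, which is used to replace
    \<open>C\<close> by \<open>C^2\<close> and to deduce \<open>r \<le> 1/2\<close> from
    \<open>C * r \<le> 1/2\<close>.\<close>
  define C where "C = (\<Sum>e\<in>Basis. \<Sum>f\<in>Basis. B e f) + 1"
  have C: "C \<ge> 1" "C - 1 \<le> C" using B(1) by (simp_all add: C_def sum_nonneg)
  have KS: "x \<in> S" if "x \<in> ?K" for x using that R by blast
  have bilD: "bilinear (\<lambda>v w. D (\<lambda>y. A y v w) x u)" if "x \<in> S" for x u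
    by (rule bilinear_D_family[OF S(1) that bil sm])
  have le_C: "(C - 1) * a * norm v * norm w \<le> C * a * norm v * norm w" if "a \<ge> 0" for a and v :: 'e and w :: 'f
    using that C by (intro mult_right_mono) auto
  have b0: "norm (A x v w) \<le> C * norm v * norm w" if "x \<in> ?K" for x v w
    using bilinear_euclidean_bound[OF bil[OF KS[OF that]] B(2)[OF that], of v w] le_C[of 1 v w]
    by (simp add: C_def)
  have b1: "norm (D (\<lambda>y. A y v w) x u) \<le> C * norm u * norm v * norm w" if "x \<in> ?K" for x u v w
    using bilinear_euclidean_bound[OF bilD[OF KS[OF that], of u] B(3)[OF that], of v w] le_C[of "norm u" v w]
    by (simp add: C_def)
  have b2: "norm (A y v w - A x v w - D (\<lambda>y. A y v w) x (y - x)) \<le> C * (norm (y - x))^2 * norm v * norm w"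
    if "x \<in> ?K" "y \<in> ?K" for x y v w
  proof -
    have "bilinear (\<lambda>v w. A y v w - A x v w - D (\<lambda>y. A y v w) x (y - x))"
      using bil[OF KS[OF that(1)]] bil[OF KS[OF that(2)]] bilD[OF KS[OF that(1)], of "y - x"]
      unfolding bilinear_def by (auto intro!: linear_compose_sub)
    from bilinear_euclidean_bound[OF this B(4)[OF that], of v w] le_C[of "(norm (y - x))^2" v w]
    show ?thesis by (simp add: C_def)
  qed
  have b3: "norm (A y v w - A x v w) \<le> C * norm (y - x) * norm v * norm w" if "x \<in> ?K" "y \<in> ?K" for x y v w
  proof -
    have "norm (A y v w - A x v w) \<le> (C * norm v * norm w) * norm (y - x)"
    proof (rule differentiable_bound[where S="?K" and f="\<lambda>y. A y v w"])
      show "((\<lambda>y. A y v w) has_derivative D (\<lambda>y. A y v w) z) (at z within ?K)" if "z \<in> ?K" for z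
        by (rule has_derivative_at_withinI[OF smooth_on_has_derivative[OF sm KS[OF that]]])
      show "onorm (D (\<lambda>y. A y v w) z) \<le> C * norm v * norm w" if "z \<in> ?K" for z
        by (rule onorm_le) (use b1[OF that, of v w] in \<open>simp add: mult_ac\<close>)
    qed (use that in auto)
    then show ?thesis by (simp add: mult_ac)
  qed
  \<comment> \<open>\<open>C * r \<le> 1/2\<close> is the contraction hypothesis for the equation
    along a ray, and later halves the error term \<open>E\<close>.\<close>
  define r where "r = min R (1 / (2 * C))"
  have r: "r > 0" "r \<le> R" "C * r \<le> 1/2" using R C by (auto simp: r_def min_def field_simps)
  have seg: "t *\<^sub>R x \<in> ball 0 r" if "x \<in> ball 0 r" "t \<in> {0..1}" for t and x :: 'e
    using that by (auto intro: le_less_trans[OF mult_left_le_one_le])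
  have rK: "x \<in> ?K" if "x \<in> ball 0 r" for x :: 'e using that r by auto
  have ode: "\<exists>g. g 0 = c \<and> (\<forall>t\<in>{0..1}. (g has_vector_derivative A (t *\<^sub>R x) x (g t)) (at t within {0..1})) \<and>
      (\<forall>t\<in>{0..1}. norm (g t) \<le> 2 * norm c)" if x: "x \<in> ball 0 r" for x c
  proof (rule contractive_linear_ode[of "\<lambda>t. A (t *\<^sub>R x) x"])
    fix t :: real assume t: "t \<in> {0..1}"
    show "linear (A (t *\<^sub>R x) x)" using bil[OF KS[OF rK[OF seg[OF x t]]]] by (simp add: bilinear_def)
    show "norm (A (t *\<^sub>R x) x v) \<le> norm v / 2" for v
    proof -
      have "norm (A (t *\<^sub>R x) x v) \<le> C * norm x * norm v" by (rule b0[OF rK[OF seg[OF x t]]])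
      also have "\<dots> \<le> (C * r) * norm v" using x C by (intro mult_right_mono mult_left_mono) auto
      also have "\<dots> \<le> 1/2 * norm v" using r by (intro mult_right_mono) auto
      finally show ?thesis by simp
    qed
  next
    show "continuous_on {0..1} (\<lambda>t. A (t *\<^sub>R x) x v)" for v
      by (rule continuous_on_compose2[OF smooth_on_continuous[OF sm]])
        (use KS[OF rK[OF seg[OF x]]] in \<open>auto intro!: continuous_intros\<close>)
  qed blast
  have "\<exists>f. f 0 = c \<and> (\<forall>x\<in>ball 0 r. (f has_derivative (\<lambda>v. A x v (f x))) (at x))" for c
  proof -
    obtain g where g: "\<And>x. x \<in> ball 0 r \<Longrightarrow> g x 0 = c"
      "\<And>x t. x \<in> ball 0 r \<Longrightarrow> t \<in> {0..1} \<Longrightarrow> (g x has_vector_derivative A (t *\<^sub>R x) x (g x t)) (at t within {0..1})"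
      "\<And>x t. x \<in> ball 0 r \<Longrightarrow> t \<in> {0..1} \<Longrightarrow> norm (g x t) \<le> 2 * norm c"
      using ode[of _ c] by metis
    define f where "f x = g x 1" for x
    \<comment> \<open>Four quadratic remainders, each at most
      \<open>C^2 * (norm h)^2 * norm w\<close>, with \<open>norm w \<le> 2 * norm c\<close>.\<close>
    define Q where "Q = 8 * C^2 * norm c"
    have main: "norm (f y - f x - A x (y - x) (f x)) \<le> 2 * Q * (norm (y - x))^2"
      if x: "x \<in> ball 0 r" and y: "y \<in> ball 0 r" for x y
    proof -
      define h where "h = y - x"
      define E where "E t = g y t - g x t - t *\<^sub>R A (t *\<^sub>R x) h (g x t)" for t
      define E' where "E' t = A (t *\<^sub>R y) y (g y t) - A (t *\<^sub>R x) x (g x t) - A (t *\<^sub>R x) h (g x t)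
         - t *\<^sub>R (D (\<lambda>z. A z h (g x t)) (t *\<^sub>R x) x + A (t *\<^sub>R x) h (A (t *\<^sub>R x) x (g x t)))" for t
      have xh: "y = x + h" by (simp add: h_def)
      have nxy: "norm x \<le> 1/2" "norm y \<le> 1/2"
      proof -
        have "1 * r \<le> C * r" using r C by (intro mult_right_mono) auto
        then have "r \<le> 1/2" using r(3) by linarith
        then show "norm x \<le> 1/2" "norm y \<le> 1/2" using x y by auto
      qed
      have E: "(E has_vector_derivative E' t) (at t within {0..1})" if t: "t \<in> {0..1}" for t
      proof -
        have pK: "t *\<^sub>R x \<in> S" using KS[OF rK[OF seg[OF x t]]] .
        have lin: "linear (D (\<lambda>z. A z h w) (t *\<^sub>R x))" for w by (rule smooth_on_linear_D[OF sm pK])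
        have gx: "(g x has_derivative (\<lambda>s. s *\<^sub>R A (t *\<^sub>R x) x (g x t))) (at t within {0..1})"
          using g(2)[OF x t] by (simp add: has_vector_derivative_def)
        have ray: "((\<lambda>s. A (s *\<^sub>R x) h b) has_derivative (\<lambda>s. D (\<lambda>z. A z h b) (t *\<^sub>R x) (s *\<^sub>R x))) (at t within {0..1})" for b
          by (rule has_derivative_compose_at[where f="\<lambda>s. s *\<^sub>R x", OF _ smooth_on_has_derivative[OF sm[of h b] pK] refl])
            (auto intro!: derivative_eq_intros)
        \<comment> \<open>The product rule along the ray, within \<open>{0..1}\<close>, again by
          expansion in the basis.\<close>
        have "((\<lambda>s. \<Sum>b\<in>Basis. (g x s \<bullet> b) *\<^sub>R A (s *\<^sub>R x) h b) has_derivative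
            (\<lambda>s. \<Sum>b\<in>Basis. (g x t \<bullet> b) *\<^sub>R D (\<lambda>z. A z h b) (t *\<^sub>R x) (s *\<^sub>R x) +
              (s *\<^sub>R A (t *\<^sub>R x) x (g x t) \<bullet> b) *\<^sub>R A (t *\<^sub>R x) h b)) (at t within {0..1})"
          by (intro has_derivative_sum has_derivative_scaleR has_derivative_inner_left gx ray)
        also have "(\<lambda>s. \<Sum>b\<in>Basis. (g x t \<bullet> b) *\<^sub>R D (\<lambda>z. A z h b) (t *\<^sub>R x) (s *\<^sub>R x) +
              (s *\<^sub>R A (t *\<^sub>R x) x (g x t) \<bullet> b) *\<^sub>R A (t *\<^sub>R x) h b) =
            (\<lambda>s. s *\<^sub>R (D (\<lambda>z. A z h (g x t)) (t *\<^sub>R x) x + A (t *\<^sub>R x) h (A (t *\<^sub>R x) x (g x t))))"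
        proof
          fix s
          have l1: "linear (\<lambda>w. D (\<lambda>z. A z h w) (t *\<^sub>R x) (s *\<^sub>R x))" and l2: "linear (A (t *\<^sub>R x) h)"
            using bilD[OF pK] bil[OF pK] by (auto simp: bilinear_def)
          show "(\<Sum>b\<in>Basis. (g x t \<bullet> b) *\<^sub>R D (\<lambda>z. A z h b) (t *\<^sub>R x) (s *\<^sub>R x) +
              (s *\<^sub>R A (t *\<^sub>R x) x (g x t) \<bullet> b) *\<^sub>R A (t *\<^sub>R x) h b) =
            s *\<^sub>R (D (\<lambda>z. A z h (g x t)) (t *\<^sub>R x) x + A (t *\<^sub>R x) h (A (t *\<^sub>R x) x (g x t)))"
            unfolding sum.distrib linear_euclidean_sum[OF l1, symmetric] linear_euclidean_sum[OF l2, symmetric]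
            by (simp add: linear_cmul[OF lin] linear_cmul[OF l2] scaleR_right_distrib)
        qed
        finally have "((\<lambda>s. A (s *\<^sub>R x) h (g x s)) has_vector_derivative
            (D (\<lambda>z. A z h (g x t)) (t *\<^sub>R x) x + A (t *\<^sub>R x) h (A (t *\<^sub>R x) x (g x t)))) (at t within {0..1})"
          unfolding has_vector_derivative_def
        proof (rule has_derivative_transform[OF t, rotated])
          fix s :: real assume s: "s \<in> {0..1}"
          have l2: "linear (A (s *\<^sub>R x) h)" using bil[OF KS[OF rK[OF seg[OF x s]]]] by (simp add: bilinear_def)
          show "A (s *\<^sub>R x) h (g x s) = (\<Sum>b\<in>Basis. (g x s \<bullet> b) *\<^sub>R A (s *\<^sub>R x) h b)"
            by (rule linear_euclidean_sum[OF l2])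
        qed
        note dA = this
        have "(E has_vector_derivative A (t *\<^sub>R y) y (g y t) - A (t *\<^sub>R x) x (g x t)
            - (t *\<^sub>R (D (\<lambda>z. A z h (g x t)) (t *\<^sub>R x) x + A (t *\<^sub>R x) h (A (t *\<^sub>R x) x (g x t)))
              + 1 *\<^sub>R A (t *\<^sub>R x) h (g x t))) (at t within {0..1})"
          unfolding E_def
          by (intro has_vector_derivative_diff g(2) x y t has_vector_derivative_scaleR dA DERIV_ident)
        then show ?thesis by (simp add: E'_def algebra_simps)
      qed
      have E0: "E 0 = 0" using g(1) x y by (simp add: E_def)
      have contE: "continuous_on {0..1} (\<lambda>t. norm (E t))"
        by (intro continuous_on_norm) (meson E continuous_on_eq_continuous_within has_vector_derivative_continuous)
      \<comment> \<open>Evaluating the estimate at the maximum of \<open>norm (E t)\<close> absorbs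
        half of it into the left side; this takes the place of Gronwall's inequality.\<close>
      obtain s where s: "s \<in> {0..1}" "\<And>t. t \<in> {0..1} \<Longrightarrow> norm (E t) \<le> norm (E s)"
        using continuous_attains_sup[OF _ _ contE] by auto
      have E': "norm (E' t) \<le> norm (E s) / 2 + Q * (norm h)^2" if t: "t \<in> {0..1}" for t
      proof -
        define p where "p = t *\<^sub>R x"
        define q where "q = t *\<^sub>R y"
        define w where "w = g x t"
        have pK: "p \<in> ?K" and qK: "q \<in> ?K" using rK[OF seg[OF x t]] rK[OF seg[OF y t]] by (auto simp: p_def q_def)
        note pS = KS[OF pK] and qS = KS[OF qK]
        have qp: "q - p = t *\<^sub>R h" by (simp add: p_def q_def h_def scaleR_right_diff_distrib)
        have linD: "linear (D (\<lambda>z. A z v w) p)" for v w by (rule smooth_on_linear_D[OF sm pS])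
        note bl = bilinear_ladd[OF bil[OF pS]] bilinear_radd[OF bil[OF pS]] bilinear_lmul[OF bil[OF pS]] bilinear_rmul[OF bil[OF pS]]
          bilinear_ladd[OF bil[OF qS]] bilinear_radd[OF bil[OF qS]] bilinear_lmul[OF bil[OF qS]] bilinear_rmul[OF bil[OF qS]]
          bilinear_ladd[OF bilD[OF pS]]
        have gy: "g y t = E t + w + t *\<^sub>R A p h w" by (simp add: E_def w_def p_def)
        have fl: "D (\<lambda>z. A z h w) p x + A p h (A p x w) = D (\<lambda>z. A z x w) p h + A p x (A p h w)"
          by (rule flat[OF pS])
        let ?T1 = "A q y w - A p y w - D (\<lambda>z. A z y w) p (q - p)"
        let ?T2 = "D (\<lambda>z. A z h w) p h"
        let ?T3 = "A q y (A p h w) - A p y (A p h w)"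
        let ?T4 = "A p h (A p h w)"
        have "E' t = A q y (g y t) - A p x w - A p h w - t *\<^sub>R (D (\<lambda>z. A z h w) p x + A p h (A p x w))"
          by (simp add: E'_def p_def q_def w_def)
        \<comment> \<open>Flatness exchanges the roles of \<open>x\<close> and \<open>h\<close> in
          the derivative of \<open>A\<close>, which then matches the first-order Taylor term of
          \<open>A q y w\<close>; apart from the term in \<open>E t\<close>, what remains is
          quadratic in \<open>h\<close>.\<close>
        also have "\<dots> = A q y (E t) + ?T1 + t *\<^sub>R (?T2 + ?T3 + ?T4)"
        proof -
          have 1: "D (\<lambda>z. A z y w) p (q - p) = t *\<^sub>R (D (\<lambda>z. A z x w) p h + ?T2)"
            unfolding qp linear_cmul[OF linD] by (simp add: xh bl)
          show ?thesis unfolding 1 gy fl by (simp add: bl xh algebra_simps)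
        qed
        also have "norm \<dots> \<le> norm (E s) / 2 + Q * (norm h)^2"
        proof -
          have nw: "norm w \<le> 2 * norm c" using g(3)[OF x t] by (simp add: w_def)
          have CC: "C \<le> C^2" using C by (simp add: self_le_power)
          have tt: "t^2 \<le> 1" using t by (simp add: power_le_one)
          have Ch: "C * (norm h)^2 * norm w \<le> C^2 * (norm h)^2 * norm w"
            using CC by (intro mult_right_mono) auto
          have "norm (A q y (E t)) \<le> C * norm y * norm (E t)" by (rule b0[OF qK])
          also have "\<dots> \<le> C * r * norm (E s)" using y s t C r(1) by (intro mult_mono mult_left_mono) auto
          also have "\<dots> \<le> 1/2 * norm (E s)" using r by (intro mult_right_mono) auto
          finally have n0: "norm (A q y (E t)) \<le> norm (E s) / 2" by simp
          have "norm ?T1 \<le> C * (norm (q - p))^2 * norm y * norm w" by (rule b2[OF pK qK])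
          also have "\<dots> \<le> C * (norm h)^2 * 1 * norm w"
            unfolding qp using tt nxy C
            by (intro mult_right_mono mult_mono mult_left_mono) (auto simp: power_mult_distrib intro!: mult_left_le_one_le)
          finally have n1: "norm ?T1 \<le> C^2 * (norm h)^2 * norm w" using Ch by simp
          have "norm ?T2 \<le> C * norm h * norm h * norm w" by (rule b1[OF pK])
          then have n2: "norm ?T2 \<le> C^2 * (norm h)^2 * norm w" using Ch by (simp add: power2_eq_square mult_ac)
          have nAh: "norm (A p h w) \<le> C * norm h * norm w" by (rule b0[OF pK])
          have "norm ?T4 \<le> C * norm h * norm (A p h w)" by (rule b0[OF pK])
          also have "\<dots> \<le> C * norm h * (C * norm h * norm w)" using nAh C by (intro mult_left_mono) auto
          finally have n4: "norm ?T4 \<le> C^2 * (norm h)^2 * norm w" by (simp add: power2_eq_square mult_ac)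
          have "norm ?T3 \<le> C * norm (q - p) * norm y * norm (A p h w)" by (rule b3[OF pK qK])
          also have "\<dots> \<le> C * norm h * 1 * (C * norm h * norm w)"
            unfolding qp using t nxy C nAh
            by (intro mult_mono mult_left_mono) (auto intro!: mult_left_le_one_le)
          finally have n3: "norm ?T3 \<le> C^2 * (norm h)^2 * norm w" by (simp add: power2_eq_square mult_ac)
          have "norm (t *\<^sub>R (?T2 + ?T3 + ?T4)) \<le> norm (?T2 + ?T3 + ?T4)"
            using t by (auto intro!: mult_left_le_one_le)
          also have "\<dots> \<le> norm ?T2 + norm ?T3 + norm ?T4" by (meson add_right_mono norm_triangle_ineq order_trans)
          finally have n5: "norm (t *\<^sub>R (?T2 + ?T3 + ?T4)) \<le> 3 * (C^2 * (norm h)^2 * norm w)"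
            using n2 n3 n4 by linarith
          have "norm (A q y (E t) + ?T1 + t *\<^sub>R (?T2 + ?T3 + ?T4)) \<le>
              norm (A q y (E t)) + norm ?T1 + norm (t *\<^sub>R (?T2 + ?T3 + ?T4))"
            by (meson add_right_mono norm_triangle_ineq order_trans)
          also have "\<dots> \<le> norm (E s) / 2 + 4 * (C^2 * (norm h)^2 * norm w)" using n0 n1 n5 by linarith
          also have "C^2 * (norm h)^2 * norm w \<le> C^2 * (norm h)^2 * (2 * norm c)"
            using nw by (intro mult_left_mono) auto
          finally show ?thesis by (simp add: Q_def mult_ac)
        qed
        finally show ?thesis .
      qed
      have "norm (E t - E 0) \<le> (norm (E s) / 2 + Q * (norm h)^2) * norm (t - 0)" if t: "t \<in> {0..1}" for t
      proof (rule differentiable_bound[where S="{0..1::real}"])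
        show "(E has_derivative (\<lambda>k. k *\<^sub>R E' t)) (at t within {0..1})" if "t \<in> {0..1}" for t
          using E[OF that] by (simp add: has_vector_derivative_def)
        show "onorm (\<lambda>k. k *\<^sub>R E' t) \<le> norm (E s) / 2 + Q * (norm h)^2" if "t \<in> {0..1}" for t
          using E'[OF that] by (intro onorm_le) (simp add: mult.commute mult_left_mono)
      qed (use t in auto)
      then have "norm (E t) \<le> norm (E s) / 2 + Q * (norm h)^2" if t: "t \<in> {0..1}" for t
      proof -
        assume a: "\<And>t. t \<in> {0..1} \<Longrightarrow> norm (E t - E 0) \<le> (norm (E s) / 2 + Q * (norm h)^2) * norm (t - 0)"
        have "norm (E t) \<le> (norm (E s) / 2 + Q * (norm h)^2) * t" using a[OF t] t E0 by simp
        also have "\<dots> \<le> norm (E s) / 2 + Q * (norm h)^2"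
          using t C by (intro mult_right_le_one_le) (auto simp: Q_def)
        finally show ?thesis .
      qed
      from this[OF s(1)] s(2)[of 1] have "norm (E 1) \<le> 2 * Q * (norm h)^2" by simp
      then show ?thesis by (simp add: E_def f_def h_def)
    qed
    \<comment> \<open>Along the ray through 0 the equation reads \<open>g' = 0\<close>, because
      \<open>A 0 0 w = 0\<close>.\<close>
    have "f 0 = c"
    proof -
      have "0 \<in> ball (0::'e) r" using r by simp
      note g0 = g(1)[OF this] g(2)[OF this]
      have "A 0 0 w = 0" for w using bilinear_lzero[OF bil[OF S(2)]] .
      then have "(g 0 has_derivative (\<lambda>h. 0)) (at t within {0..1})" if "t \<in> {0..1}" for t
        using g0(2)[OF that] by (simp add: has_vector_derivative_def)
      then obtain k where "\<And>t. t \<in> {0..1} \<Longrightarrow> g 0 t = k"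
        using has_derivative_zero_constant[of "{0..1::real}" "g 0"] by auto
      then show ?thesis using g0(1) by (force simp: f_def)
    qed
    moreover have "(f has_derivative (\<lambda>v. A x v (f x))) (at x)" if x: "x \<in> ball 0 r" for x
    proof -
      have xS: "x \<in> S" by (rule KS[OF rK[OF x]])
      have "linear (\<lambda>v. A x v (f x))" using bil[OF xS] by (simp add: bilinear_def)
      moreover have "\<exists>d>0. \<forall>y. norm (y - x) < d \<longrightarrow> norm (f y - f x - A x (y - x) (f x)) \<le> e * norm (y - x)"
        if e: "e > 0" for e
      proof -
        have Q: "Q \<ge> 0" by (simp add: Q_def)
        obtain d1 where d1: "d1 > 0" "ball x d1 \<subseteq> ball 0 r" using x by (metis open_ball open_contains_ball)
        define d where "d = min d1 (e / (2 * Q + 1))"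
        have d: "d > 0" "d \<le> d1" "d * (2 * Q) \<le> e" using e d1 Q
          by (auto simp: d_def min_def field_simps)
        have "norm (f y - f x - A x (y - x) (f x)) \<le> e * norm (y - x)" if y: "norm (y - x) < d" for y
        proof -
          have "y \<in> ball 0 r" using y d d1 by (auto simp: dist_norm norm_minus_commute subset_iff)
          from main[OF x this] have "norm (f y - f x - A x (y - x) (f x)) \<le> (norm (y - x) * (2 * Q)) * norm (y - x)"
            by (simp add: power2_eq_square mult_ac)
          also have "\<dots> \<le> e * norm (y - x)"
            using y d Q mult_right_mono[of "norm (y - x)" d "2 * Q"] by (intro mult_right_mono) auto
          finally show ?thesis .
        qed
        then show ?thesis using d by blast
      qed
      ultimately show ?thesis unfolding has_derivative_at_alt linear_conv_bounded_linear by blast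
    qed
    ultimately show ?thesis by blast
  qed
  moreover have "ball 0 r \<subseteq> S" using KS rK by blast
  ultimately show thesis using that r by blast
qed

text \<open>A translation moves the centre to \<open>x0\<close>. Smoothness bootstraps, since the
  derivative \<open>A x v (F c x)\<close> contains the solution undifferentiated. One radius serves
  all initial values, which allows solutions to be assembled into a frame.\<close>

theorem flat_system_solution:
  fixes A :: "'e::euclidean_space \<Rightarrow> 'e \<Rightarrow> 'f::euclidean_space \<Rightarrow> 'f"
  assumes S: "open S" "x0 \<in> S" and bil: "\<And>x. x \<in> S \<Longrightarrow> bilinear (A x)"
    and sm: "\<And>v w. smooth_on S (\<lambda>x. A x v w)"
    and flat: "\<And>x u v w. x \<in> S \<Longrightarrow>
      D (\<lambda>y. A y v w) x u + A x v (A x u w) = D (\<lambda>y. A y u w) x v + A x u (A x v w)"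
  obtains r F where "r > 0" "ball x0 r \<subseteq> S" "\<And>c. F c x0 = c" "\<And>c. smooth_on (ball x0 r) (F c)"
    "\<And>c x. x \<in> ball x0 r \<Longrightarrow> (F c has_derivative (\<lambda>v. A x v (F c x))) (at x)"
proof -
  define T where "T = (+) (- x0) ` S"
  have T: "x \<in> T \<longleftrightarrow> x0 + x \<in> S" for x unfolding T_def by (force simp: image_iff)
  have dA: "D (\<lambda>y. A (x0 + y) v w) x u = D (\<lambda>y. A y v w) (x0 + x) u" if "x \<in> T" for x u v w
    using D_compose[of "\<lambda>y. x0 + y" x "\<lambda>y. A y v w" u] smooth_on_differentiable[OF sm] that T
    by (simp add: frechet_derivative_at[OF has_derivative_add[OF has_derivative_const has_derivative_ident], symmetric] differentiable_def)
      (auto intro!: exI has_derivative_add[OF has_derivative_const has_derivative_ident] simp: D_eqI[OF has_derivative_add[OF has_derivative_const has_derivative_ident]])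
  have oT: "open T" unfolding T_def by (rule open_translation[OF S(1)])
  obtain r where r: "r > 0" "ball 0 r \<subseteq> T"
    "\<And>c. \<exists>f. f 0 = c \<and> (\<forall>x\<in>ball 0 r. (f has_derivative (\<lambda>v. A (x0 + x) v (f x))) (at x))"
  proof (rule flat_system_solution_aux[of T "\<lambda>x. A (x0 + x)"])
    show "smooth_on T (\<lambda>x. A (x0 + x) v w)" for v w
      by (rule smooth_on_compose[OF oT S(1) sm]) (use T oT in \<open>auto intro!: smooth_on_add smooth_on_const smooth_on_id\<close>)
  qed (use oT T S bil flat dA in auto)
  obtain f where f: "\<And>c. f c 0 = c" "\<And>c x. x \<in> ball 0 r \<Longrightarrow> (f c has_derivative (\<lambda>v. A (x0 + x) v (f c x))) (at x)"
    using r(3) by metis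
  define F where "F c x = f c (x - x0)" for c x
  have sub: "ball x0 r \<subseteq> S" using r(2) T by (force simp: dist_norm norm_minus_commute subset_iff)
  have F: "(F c has_derivative (\<lambda>v. A x v (F c x))) (at x)" if "x \<in> ball x0 r" for c x
  proof -
    have "x - x0 \<in> ball 0 r" using that by (simp add: dist_norm norm_minus_commute)
    moreover have "((\<lambda>x. x - x0) has_derivative (\<lambda>v. v)) (at x)"
      by (auto intro!: derivative_eq_intros)
    ultimately show ?thesis unfolding F_def
      using has_derivative_compose_at[OF _ f(2) refl] by fastforce
  qed
  have "Ck_on n (ball x0 r) (F c)" for n c
  proof (induction n)
    case 0
    then show ?case using F by (auto intro!: continuous_at_imp_continuous_on has_derivative_continuous)
  next
    case (Suc n)
    show ?case
    proof (rule Ck_on_SucI[OF open_ball F])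
      show "Ck_on n (ball x0 r) (\<lambda>x. A x v (F c x))" for v
        by (rule Ck_on_linear_apply[where A="\<lambda>x. A x v", OF open_ball])
          (use sub bil Suc smooth_onD_Ck[OF smooth_on_subset[OF sm sub]] in \<open>auto simp: bilinear_def\<close>)
    qed
  qed
  then show thesis using that[of r F] r f(1) sub F by (simp add: smooth_on_def F_def)
qed

section \<open>Charts and integrability\<close>

text \<open>Transfers openness along a coordinate change: in each direction the set is a preimage
  under one of the two continuous maps.\<close>

lemma open_image_iff_homeo:
  assumes "open A" "open B" "continuous_on A f" "continuous_on B g"
    "f ` A = B" "\<And>x. x \<in> A \<Longrightarrow> g (f x) = x" "W \<subseteq> A"
  shows "open (f ` W) \<longleftrightarrow> open W"
proof
  assume "open W"
  moreover have "f ` W = {y \<in> B. g y \<in> W}" using assms(6,7) unfolding assms(5)[symmetric] by auto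
  ultimately show "open (f ` W)"
    using continuous_open_preimage[OF assms(4,2)] by (simp add: vimage_def Int_def conj_commute)
next
  assume "open (f ` W)"
  moreover have "W = {x \<in> A. f x \<in> f ` W}"
  proof -
    have "inj_on f A" by (metis assms(6) inj_onI)
    then show ?thesis using assms(7) by (auto, metis inj_onD subsetD)
  qed
  ultimately show "open W"
    using continuous_open_preimage[OF assms(3,1), of "f ` W"] by (simp add: vimage_def Int_def conj_commute)
qed

text \<open>Condenses the homeomorphism between subtopologies into injectivity and an equivalence of
  openness, the form in which charts are checked below.\<close>

lemma topological_chart_iff:
  "topological_chart T V \<psi> \<longleftrightarrow>
     openin T V \<and> inj_on \<psi> V \<and> (\<forall>U. U \<subseteq> V \<longrightarrow> (openin T U \<longleftrightarrow> open (\<psi> ` U)))"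
proof
  assume L: "topological_chart T V \<psi>"
  then have V: "openin T V" "open (\<psi> ` V)" "homeomorphic_map (subtopology T V) (top_of_set (\<psi> ` V)) \<psi>"
    by (auto simp: topological_chart_def)
  have top: "topspace (subtopology T V) = V"
    using openin_subset[OF V(1)] by auto
  have "inj_on \<psi> V" using homeomorphic_imp_injective_map[OF V(3)] top by simp
  moreover have "openin T U \<longleftrightarrow> open (\<psi> ` U)" if "U \<subseteq> V" for U
  proof -
    have "openin T U \<longleftrightarrow> openin (subtopology T V) U"
      using that V(1) by (simp add: openin_open_subtopology)
    also have "\<dots> \<longleftrightarrow> openin (top_of_set (\<psi> ` V)) (\<psi> ` U)"
      using homeomorphic_map_openness_eq[OF V(3), of U] that top by auto
    also have "\<dots> \<longleftrightarrow> open (\<psi> ` U)" using V(2) that by (auto simp: openin_open_eq)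
    finally show ?thesis .
  qed
  ultimately show "openin T V \<and> inj_on \<psi> V \<and> (\<forall>U. U \<subseteq> V \<longrightarrow> (openin T U \<longleftrightarrow> open (\<psi> ` U)))"
    using V by blast
next
  assume R: "openin T V \<and> inj_on \<psi> V \<and> (\<forall>U. U \<subseteq> V \<longrightarrow> (openin T U \<longleftrightarrow> open (\<psi> ` U)))"
  have top: "topspace (subtopology T V) = V"
    using openin_subset[of T V] R by auto
  have oV: "open (\<psi> ` V)" using R by auto
  have "homeomorphic_map (subtopology T V) (top_of_set (\<psi> ` V)) \<psi>"
  proof (rule bijective_open_imp_homeomorphic_map)
    show "continuous_map (subtopology T V) (top_of_set (\<psi> ` V)) \<psi>"
      unfolding continuous_map
    proof (intro conjI allI impI)
      fix U assume "openin (top_of_set (\<psi> ` V)) U"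
      then have U: "open U" "U \<subseteq> \<psi> ` V" using oV by (auto simp: openin_open_eq)
      have "\<psi> ` {x \<in> V. \<psi> x \<in> U} = U" using U(2) by auto
      moreover have "{x \<in> V. \<psi> x \<in> U} \<subseteq> V" by auto
      ultimately have "openin T {x \<in> V. \<psi> x \<in> U}" using R U(1) by metis
      then show "openin (subtopology T V) {x \<in> topspace (subtopology T V). \<psi> x \<in> U}"
        unfolding top using R by (auto simp add: openin_open_subtopology)
    qed (use top in \<open>auto simp del: topspace_subtopology\<close>)
    show "open_map (subtopology T V) (top_of_set (\<psi> ` V)) \<psi>"
      unfolding open_map_def
    proof (intro allI impI)
      fix U assume "openin (subtopology T V) U"
      then have "openin T U" "U \<subseteq> V" using R by (auto simp: openin_open_subtopology)
      then show "openin (top_of_set (\<psi> ` V)) (\<psi> ` U)" using R oV by (auto simp: openin_open_eq)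
    qed
  qed (use R top in \<open>auto simp del: topspace_subtopology\<close>)
  then show "topological_chart T V \<psi>" using R oV by (simp add: topological_chart_def)
qed

section \<open>Manifolds and their coordinate changes\<close>

locale smooth_mfd =
  fixes M :: "('i, 'm, 'e::euclidean_space) atlas"
  assumes sm: "smooth_manifold M"
begin

lemma chart_top: "i \<in> idx M \<Longrightarrow> topological_chart (mtop M) (cdom M i) (chart M i)"
  using sm by (simp add: smooth_manifold_def)

lemma cover: "p \<in> topspace (mtop M) \<Longrightarrow> \<exists>i\<in>idx M. p \<in> cdom M i"
  using sm unfolding smooth_manifold_def by blast

lemma cdom_topspace: "i \<in> idx M \<Longrightarrow> cdom M i \<subseteq> topspace (mtop M)"
  using sm unfolding smooth_manifold_def by blast

lemma openin_cdom: "i \<in> idx M \<Longrightarrow> openin (mtop M) (cdom M i)"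
  using chart_top topological_chart_iff by blast

lemma chart_inj: "i \<in> idx M \<Longrightarrow> inj_on (chart M i) (cdom M i)"
  using chart_top by (simp add: topological_chart_iff)

lemma chart_open_iff: "i \<in> idx M \<Longrightarrow> U \<subseteq> cdom M i \<Longrightarrow> open (chart M i ` U) \<longleftrightarrow> openin (mtop M) U"
  using chart_top by (simp add: topological_chart_iff)

lemma open_coord_dom: "i \<in> idx M \<Longrightarrow> open (coord_dom M i)"
  by (simp add: coord_dom_def chart_open_iff openin_cdom)

lemma open_overlap: "i \<in> idx M \<Longrightarrow> j \<in> idx M \<Longrightarrow> open (overlap M i j)"
  by (simp add: overlap_def chart_open_iff openin_cdom openin_Int)

lemma overlap_subset: "overlap M i j \<subseteq> coord_dom M i"
  by (auto simp: overlap_def coord_dom_def)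

lemma inv_chart: "i \<in> idx M \<Longrightarrow> p \<in> cdom M i \<Longrightarrow> inv_into (cdom M i) (chart M i) (chart M i p) = p"
  by (simp add: chart_inj)

lemma transition_chart: "i \<in> idx M \<Longrightarrow> p \<in> cdom M i \<Longrightarrow> transition M i j (chart M i p) = chart M j p"
  by (simp add: transition_def inv_chart)

lemma overlapE:
  assumes "x \<in> overlap M i j"
  obtains p where "p \<in> cdom M i" "p \<in> cdom M j" "x = chart M i p"
  using assms by (auto simp: overlap_def)

lemma coord_domE:
  assumes "x \<in> coord_dom M i"
  obtains p where "p \<in> cdom M i" "x = chart M i p"
  using assms by (auto simp: coord_dom_def)

lemma overlapI: "p \<in> cdom M i \<Longrightarrow> p \<in> cdom M j \<Longrightarrow> chart M i p \<in> overlap M i j"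
  by (auto simp: overlap_def)

lemma coord_domI: "p \<in> cdom M i \<Longrightarrow> chart M i p \<in> coord_dom M i"
  by (auto simp: coord_dom_def)

lemma transition_overlap: "i \<in> idx M \<Longrightarrow> x \<in> overlap M i j \<Longrightarrow> transition M i j x \<in> overlap M j i"
  by (auto simp: transition_chart overlap_def)

lemma transition_coord_dom: "i \<in> idx M \<Longrightarrow> x \<in> overlap M i j \<Longrightarrow> transition M i j x \<in> coord_dom M j"
  using transition_overlap overlap_subset by blast

lemma transition_inverse:
  "i \<in> idx M \<Longrightarrow> j \<in> idx M \<Longrightarrow> x \<in> overlap M i j \<Longrightarrow> transition M j i (transition M i j x) = x"
  by (auto simp: transition_chart elim!: overlapE)

lemma transition_self: "i \<in> idx M \<Longrightarrow> x \<in> coord_dom M i \<Longrightarrow> transition M i i x = x"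
  by (auto simp: transition_chart elim!: coord_domE)

lemma smooth_transition: "i \<in> idx M \<Longrightarrow> j \<in> idx M \<Longrightarrow> smooth_on (overlap M i j) (transition M i j)"
  using sm by (simp add: smooth_manifold_def)

lemma transition_has_derivative:
  "i \<in> idx M \<Longrightarrow> j \<in> idx M \<Longrightarrow> x \<in> overlap M i j \<Longrightarrow>
    (transition M i j has_derivative dtrans M i j x) (at x)"
  unfolding dtrans_def by (rule smooth_on_has_derivative[OF smooth_transition])

lemma linear_dtrans: "i \<in> idx M \<Longrightarrow> j \<in> idx M \<Longrightarrow> x \<in> overlap M i j \<Longrightarrow> linear (dtrans M i j x)"
  using transition_has_derivative has_derivative_linear by blast

lemma dtrans_self: "i \<in> idx M \<Longrightarrow> x \<in> coord_dom M i \<Longrightarrow> dtrans M i i x v = v"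
  unfolding dtrans_def
  by (subst D_cong_open[OF open_coord_dom _ transition_self]) auto

lemma dtrans_cocycle:
  assumes "i \<in> idx M" "j \<in> idx M" "k \<in> idx M" "p \<in> cdom M i" "p \<in> cdom M j" "p \<in> cdom M k"
  shows "dtrans M j k (chart M j p) (dtrans M i j (chart M i p) v) = dtrans M i k (chart M i p) v"
proof -
  let ?x = "chart M i p"
  let ?O = "chart M i ` (cdom M i \<inter> cdom M j \<inter> cdom M k)"
  have O: "open ?O" "?x \<in> ?O"
    using assms by (auto simp: chart_open_iff openin_cdom openin_Int Int_assoc)
  have "((\<lambda>x. transition M j k (transition M i j x)) has_derivative
      (\<lambda>v. dtrans M j k (chart M j p) (dtrans M i j ?x v))) (at ?x)"
    using assms
    by (intro has_derivative_compose_at[OF transition_has_derivative transition_has_derivative])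
      (auto intro: overlapI simp: transition_chart)
  then have "(transition M i k has_derivative
      (\<lambda>v. dtrans M j k (chart M j p) (dtrans M i j ?x v))) (at ?x)"
    by (rule has_derivative_transform_within_open[OF _ O]) (use assms in \<open>auto simp: transition_chart\<close>)
  from D_eqI[OF this] show ?thesis by (simp add: dtrans_def)
qed

lemma dtrans_inverse:
  assumes "i \<in> idx M" "j \<in> idx M" "x \<in> overlap M i j"
  shows "dtrans M j i (transition M i j x) (dtrans M i j x v) = v"
proof -
  obtain p where "p \<in> cdom M i" "p \<in> cdom M j" "x = chart M i p" using assms(3) by (rule overlapE)
  then show ?thesis
    using dtrans_cocycle[of i j i p v] assms by (simp add: transition_chart dtrans_self coord_domI)
qed

lemma dtrans_inverse':
  assumes "i \<in> idx M" "j \<in> idx M" "x \<in> overlap M i j"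
  shows "dtrans M i j x (dtrans M j i (transition M i j x) v) = v"
  using dtrans_inverse[OF assms(2,1) transition_overlap[OF assms(1,3)], of v]
    transition_inverse[OF assms] by simp

lemma openin_iff_local:
  assumes "U \<subseteq> topspace (mtop M)"
  shows "openin (mtop M) U \<longleftrightarrow> (\<forall>i\<in>idx M. open (chart M i ` (cdom M i \<inter> U)))"
proof
  assume "\<forall>i\<in>idx M. open (chart M i ` (cdom M i \<inter> U))"
  then have "openin (mtop M) (\<Union>i\<in>idx M. cdom M i \<inter> U)"
    by (intro openin_Union) (auto simp: chart_open_iff)
  moreover have "(\<Union>i\<in>idx M. cdom M i \<inter> U) = U" using cover assms by blast
  ultimately show "openin (mtop M) U" by simp
qed (auto simp: chart_open_iff openin_cdom openin_Int)

text \<open>The homeomorphism condition is checked chart by chart: there both coordinate changes are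
  smooth, hence continuous, and mutually inverse.\<close>

lemma smooth_chartI:
  assumes V: "V \<subseteq> topspace (mtop M)" and inj: "inj_on \<psi> V"
    and o1: "\<And>i. i \<in> idx M \<Longrightarrow> open (chart M i ` (cdom M i \<inter> V))"
    and o2: "\<And>i. i \<in> idx M \<Longrightarrow> open (\<psi> ` (cdom M i \<inter> V))"
    and s1: "\<And>i. i \<in> idx M \<Longrightarrow> smooth_on (chart M i ` (cdom M i \<inter> V)) (\<psi> \<circ> inv_into (cdom M i) (chart M i))"
    and s2: "\<And>i. i \<in> idx M \<Longrightarrow> smooth_on (\<psi> ` (cdom M i \<inter> V)) (chart M i \<circ> inv_into V \<psi>)"
  shows "smooth_chart M V \<psi>"
proof -
  have oV: "openin (mtop M) V" using openin_iff_local[OF V] o1 by blast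
  have "openin (mtop M) U \<longleftrightarrow> open (\<psi> ` U)" if U: "U \<subseteq> V" for U
  proof -
    have loc: "open (chart M i ` (cdom M i \<inter> U)) \<longleftrightarrow> open (\<psi> ` (cdom M i \<inter> U))" if i: "i \<in> idx M" for i
    proof -
      let ?f = "\<psi> \<circ> inv_into (cdom M i) (chart M i)"
      have im: "?f ` chart M i ` (cdom M i \<inter> W) = \<psi> ` (cdom M i \<inter> W)" for W
        using inv_chart[OF i] by (auto simp: image_iff)
      have "open (?f ` chart M i ` (cdom M i \<inter> U)) \<longleftrightarrow> open (chart M i ` (cdom M i \<inter> U))"
        by (rule open_image_iff_homeo[OF o1[OF i] o2[OF i] smooth_on_continuous[OF s1[OF i]]
              smooth_on_continuous[OF s2[OF i]] im])
          (use U inj inv_chart[OF i] in auto)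
      then show ?thesis by (simp only: im)
    qed
    have "open (\<psi> ` U) \<longleftrightarrow> (\<forall>i\<in>idx M. open (\<psi> ` (cdom M i \<inter> U)))"
    proof
      assume op: "open (\<psi> ` U)"
      have "\<psi> ` (cdom M i \<inter> U) = \<psi> ` U \<inter> \<psi> ` (cdom M i \<inter> V)" for i
        using U inj by (auto simp: inj_on_def)
      then show "\<forall>i\<in>idx M. open (\<psi> ` (cdom M i \<inter> U))" using op o2 by (auto intro: open_Int)
    next
      assume "\<forall>i\<in>idx M. open (\<psi> ` (cdom M i \<inter> U))"
      then have "open (\<Union>i\<in>idx M. \<psi> ` (cdom M i \<inter> U))" by blast
      moreover have "(\<Union>i\<in>idx M. \<psi> ` (cdom M i \<inter> U)) = \<psi> ` U" using cover U V by blast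
      ultimately show "open (\<psi> ` U)" by simp
    qed
    then show ?thesis using openin_iff_local[of U] loc U V by (metis subset_trans)
  qed
  then have "topological_chart (mtop M) V \<psi>" using oV inj by (simp add: topological_chart_iff)
  then show ?thesis using s1 s2 by (simp add: smooth_chart_def)
qed

text \<open>Turns a coordinate change given in a single chart into a member of the maximal atlas;
  every other chart is reached through a transition map.\<close>

lemma local_smooth_chart:
  assumes i: "i \<in> idx M" and U: "open U" "U \<subseteq> coord_dom M i" and f: "smooth_on U f" "open (f ` U)"
    and g: "smooth_on (f ` U) g" "\<And>x. x \<in> U \<Longrightarrow> g (f x) = x"
  shows "smooth_chart M {p \<in> cdom M i. chart M i p \<in> U} (f \<circ> chart M i)" (is "smooth_chart M ?V ?\<psi>")
proof (rule smooth_chartI)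
  show inj: "inj_on ?\<psi> ?V"
    using g(2) chart_inj[OF i] by (auto simp: inj_on_def) metis
  show "?V \<subseteq> topspace (mtop M)" using cdom_topspace[OF i] by auto
  fix k assume k: "k \<in> idx M"
  have im: "chart M i ` (cdom M k \<inter> ?V) = U \<inter> overlap M i k"
    by (auto simp: overlap_def)
  have o: "open (U \<inter> overlap M i k)" using U(1) open_overlap[OF i k] by blast
  have imk: "chart M k ` (cdom M k \<inter> ?V) = {x \<in> overlap M k i. transition M k i x \<in> U}"
    using transition_chart[OF k] by (auto simp: overlap_def)
  have ok: "open {x \<in> overlap M k i. transition M k i x \<in> U}"
    using continuous_open_preimage[OF smooth_on_continuous[OF smooth_transition[OF k i]] open_overlap[OF k i] U(1)]
    by (simp add: vimage_def Int_def)
  show "open (chart M k ` (cdom M k \<inter> ?V))" by (simp add: imk ok)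
  have im2: "?\<psi> ` (cdom M k \<inter> ?V) = f ` (U \<inter> overlap M i k)" by (simp only: im[symmetric] image_comp)
  have oim: "open (f ` W) \<longleftrightarrow> open W" if "W \<subseteq> U" for W
    by (rule open_image_iff_homeo[OF U(1) f(2) smooth_on_continuous[OF f(1)] smooth_on_continuous[OF g(1)] refl g(2) that])
  show o2: "open (?\<psi> ` (cdom M k \<inter> ?V))" unfolding im2 using o oim by blast
  show "smooth_on (chart M k ` (cdom M k \<inter> ?V)) (?\<psi> \<circ> inv_into (cdom M k) (chart M k))"
    unfolding imk
  proof (rule smooth_on_cong[OF ok])
    show "smooth_on {x \<in> overlap M k i. transition M k i x \<in> U} (\<lambda>x. f (transition M k i x))"
      by (rule smooth_on_compose[OF ok U(1) f(1) smooth_on_subset[OF smooth_transition[OF k i]]]) auto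
  qed (simp add: transition_def)
  show "smooth_on (?\<psi> ` (cdom M k \<inter> ?V)) (chart M k \<circ> inv_into ?V ?\<psi>)"
  proof (rule smooth_on_cong[OF o2])
    show "smooth_on (?\<psi> ` (cdom M k \<inter> ?V)) (\<lambda>y. transition M i k (g y))"
      by (rule smooth_on_compose[OF o2 open_overlap[OF i k] smooth_transition[OF i k] smooth_on_subset[OF g(1)]])
        (auto simp: im2 g(2) intro: overlapI)
    fix y assume "y \<in> ?\<psi> ` (cdom M k \<inter> ?V)"
    then obtain p where p: "p \<in> ?V" "p \<in> cdom M k" "y = ?\<psi> p" by blast
    have "inv_into ?V ?\<psi> y = p" unfolding p(3) by (rule inv_into_f_f[OF inj p(1)])
    moreover have "g y = chart M i p" using p(1,3) g(2) by simp
    ultimately show "transition M i k (g y) = (chart M k \<circ> inv_into ?V ?\<psi>) y"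
      using p i by (simp add: transition_chart)
  qed
qed

end

lemma almost_complexD:
  assumes "almost_complex M J" "i \<in> idx M"
  shows "x \<in> coord_dom M i \<Longrightarrow> linear (J i x)" "smooth_on (coord_dom M i) (\<lambda>x. J i x v)"
    "x \<in> coord_dom M i \<Longrightarrow> J i x (J i x v) = - v"
    "j \<in> idx M \<Longrightarrow> x \<in> overlap M i j \<Longrightarrow> J j (transition M i j x) (dtrans M i j x v) = dtrans M i j x (J i x v)"
  using assms unfolding almost_complex_def endo_field_def by blast+

text \<open>From injectivity of \<open>D f\<close> at the point \<open>x\<close>, the inverse
  function theorem shrinks \<open>U\<close> to a set on which \<open>f\<close> is a coordinate
  change; the transformation rule of \<open>J\<close> carries complex linearity to the other
  charts.\<close>

lemma integrable_acsI:
  fixes M :: "('i, 'm, 'e::euclidean_space) atlas"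
  assumes ac: "almost_complex M J"
    and loc: "\<And>i x. i \<in> idx M \<Longrightarrow> x \<in> coord_dom M i \<Longrightarrow> \<exists>U (f::'e \<Rightarrow> 'e) j. open U \<and> x \<in> U \<and> U \<subseteq> coord_dom M i \<and>
      smooth_on U f \<and> inj (D f x) \<and> linear j \<and> (\<forall>v. j (j v) = - v) \<and>
      (\<forall>y\<in>U. \<forall>v. D f y (J i y v) = j (D f y v))"
  shows "integrable_acs M J"
  unfolding integrable_acs_def
proof
  interpret smooth_mfd M using ac by unfold_locales (simp add: almost_complex_def)
  fix p assume "p \<in> topspace (mtop M)"
  then obtain i where i: "i \<in> idx M" "p \<in> cdom M i" using cover by blast
  obtain U0 and f j :: "'e \<Rightarrow> 'e" where U0: "open U0" "chart M i p \<in> U0" "U0 \<subseteq> coord_dom M i" "smooth_on U0 f" "inj (D f (chart M i p))"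
    and j: "linear j" "\<And>v. j (j v) = - v" and comm: "\<And>y v. y \<in> U0 \<Longrightarrow> D f y (J i y v) = j (D f y v)"
    using loc[OF i(1) coord_domI[OF i(2)]] by metis
  obtain U g where U: "open U" "chart M i p \<in> U" "U \<subseteq> U0" "open (f ` U)" "smooth_on (f ` U) g"
    "\<And>x. x \<in> U \<Longrightarrow> g (f x) = x"
    by (rule smooth_local_inverse[OF U0(1,4,2,5)]) (rule that)
  note sf = smooth_on_subset[OF U0(4) U(3)]
  let ?V = "{p \<in> cdom M i. chart M i p \<in> U}"
  let ?\<psi> = "f \<circ> chart M i"
  have "holomorphic_chart M J ?V ?\<psi> j"
    unfolding holomorphic_chart_def
  proof (intro conjI ballI allI)
    show "smooth_chart M ?V ?\<psi>" by (rule local_smooth_chart[OF i(1) U(1) subset_trans[OF U(3) U0(3)] sf U(4,5,6)])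
    fix k x v assume k: "k \<in> idx M" and x: "x \<in> chart M k ` (cdom M k \<inter> ?V)"
    let ?O = "{x \<in> overlap M k i. transition M k i x \<in> U}"
    have O: "open ?O"
      using continuous_open_preimage[OF smooth_on_continuous[OF smooth_transition[OF k i(1)]] open_overlap[OF k i(1)] U(1)]
      by (simp add: vimage_def Int_def)
    have xO: "x \<in> ?O" using x transition_chart[OF k] by (auto simp: overlap_def)
    have D: "D (?\<psi> \<circ> inv_into (cdom M k) (chart M k)) x w = D f (transition M k i x) (dtrans M k i x w)" for w
    proof -
      have "((\<lambda>x. f (transition M k i x)) has_derivative (\<lambda>w. D f (transition M k i x) (dtrans M k i x w))) (at x)"
        using xO k i(1)
        by (intro has_derivative_compose_at[OF transition_has_derivative smooth_on_has_derivative[OF sf]]) auto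
      from D_eqI[OF this] show ?thesis by (simp add: o_def transition_def)
    qed
    have "transition M k i x \<in> U0" "x \<in> overlap M k i" using xO U(3) by auto
    then have "D f (transition M k i x) (dtrans M k i x (J k x v)) = j (D f (transition M k i x) (dtrans M k i x v))"
      using comm[of "transition M k i x" "dtrans M k i x v"] almost_complexD(4)[OF ac k i(1), of x v]
      by simp
    then show "D (?\<psi> \<circ> inv_into (cdom M k) (chart M k)) x (J k x v) = j (D (?\<psi> \<circ> inv_into (cdom M k) (chart M k)) x v)"
      by (simp add: D)
  qed (rule j)+
  moreover have "p \<in> ?V" using i(2) U(2) by simp
  ultimately show "\<exists>V \<psi> j. p \<in> V \<and> holomorphic_chart M J V \<psi> j" by (intro exI conjI)
qed

section \<open>Arbitrary smooth charts and the Nijenhuis identity\<close>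

lemma smooth_chartD:
  assumes sm: "smooth_manifold M" and ch: "smooth_chart M V \<psi>" and i: "i \<in> idx M"
  defines "\<phi> \<equiv> \<psi> \<circ> inv_into (cdom M i) (chart M i)" and "\<kappa> \<equiv> chart M i \<circ> inv_into V \<psi>"
    and "A \<equiv> chart M i ` (cdom M i \<inter> V)" and "B \<equiv> \<psi> ` (cdom M i \<inter> V)"
  shows "open A" "open B" "smooth_on A \<phi>" "smooth_on B \<kappa>" "\<phi> ` A = B" "\<kappa> ` B = A"
    "\<And>x. x \<in> A \<Longrightarrow> \<kappa> (\<phi> x) = x" "\<And>y. y \<in> B \<Longrightarrow> \<phi> (\<kappa> y) = y" "A \<subseteq> coord_dom M i"
    "\<And>p. p \<in> cdom M i \<Longrightarrow> \<phi> (chart M i p) = \<psi> p" "\<And>p. p \<in> V \<Longrightarrow> \<kappa> (\<psi> p) = chart M i p"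
proof -
  interpret smooth_mfd M using sm by unfold_locales
  have V: "openin (mtop M) V" "inj_on \<psi> V" "\<And>U. U \<subseteq> V \<Longrightarrow> openin (mtop M) U \<longleftrightarrow> open (\<psi> ` U)"
    using ch by (auto simp: smooth_chart_def topological_chart_iff)
  show "open A"
    unfolding A_def using chart_open_iff[OF i, of "cdom M i \<inter> V"] openin_Int[OF openin_cdom[OF i] V(1)] by simp
  show "open B"
    unfolding B_def using V(3)[of "cdom M i \<inter> V"] openin_Int[OF openin_cdom[OF i] V(1)] by simp
  show "smooth_on A \<phi>" "smooth_on B \<kappa>" using ch i by (auto simp: smooth_chart_def \<phi>_def \<kappa>_def A_def B_def)
  show \<phi>: "\<phi> (chart M i p) = \<psi> p" if "p \<in> cdom M i" for p using that i by (simp add: \<phi>_def inv_chart)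
  show \<kappa>: "\<kappa> (\<psi> p) = chart M i p" if "p \<in> V" for p using that V(2) by (simp add: \<kappa>_def)
  show "\<phi> ` A = B" unfolding A_def B_def image_image using \<phi> by auto
  show "\<kappa> ` B = A" unfolding A_def B_def image_image using \<kappa> by auto
  show "\<kappa> (\<phi> x) = x" if "x \<in> A" for x using that \<phi> \<kappa> by (auto simp: A_def)
  show "\<phi> (\<kappa> y) = y" if "y \<in> B" for y using that \<phi> \<kappa> by (auto simp: B_def)
  show "A \<subseteq> coord_dom M i" by (auto simp: A_def coord_dom_def)
qed

lemma inverse_D_compose:
  assumes "open A" "smooth_on A \<phi>" "x \<in> A" "open B" "smooth_on B \<kappa>" "\<phi> ` A \<subseteq> B" "\<And>x. x \<in> A \<Longrightarrow> \<kappa> (\<phi> x) = x"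
  shows "D \<kappa> (\<phi> x) (D \<phi> x v) = v"
proof -
  have "D (\<lambda>x. \<kappa> (\<phi> x)) x v = D \<kappa> (\<phi> x) (D \<phi> x v)"
    using assms(6)
    by (intro D_compose smooth_on_differentiable[OF assms(2,3)] smooth_on_differentiable[OF assms(5)] imageI subsetD[OF assms(6)] assms(3))
  moreover have "D (\<lambda>x. \<kappa> (\<phi> x)) x v = v"
    by (subst D_cong_open[OF assms(1,3,7)]) auto
  ultimately show ?thesis by simp
qed

text \<open>The Nijenhuis tensor vanishes on the constant fields \<open>X\<close>, \<open>Y\<close>.
  In a holomorphic chart \<phi>, differentiating \<open>D \<phi> (J v) = j (D \<phi> v)\<close>
  expresses the derivative of \<open>J\<close> by the second derivative \<open>B2\<close> of \<phi>;
  symmetry of \<open>B2\<close> makes the two sides agree after applying the injective map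
  \<open>D \<phi>\<close>.\<close>

lemma integrable_nijenhuis:
  assumes ac: "almost_complex M J" and int: "integrable_acs M J" and i: "i \<in> idx M" and x: "x \<in> coord_dom M i"
  shows "D (\<lambda>y. J i y Y) x (J i x X) - D (\<lambda>y. J i y X) x (J i x Y) =
    J i x (D (\<lambda>y. J i y Y) x X - D (\<lambda>y. J i y X) x Y)"
proof -
  have sm: "smooth_manifold M" using ac by (simp add: almost_complex_def)
  interpret smooth_mfd M using sm by unfold_locales
  obtain p where p: "p \<in> cdom M i" "x = chart M i p" using x by (rule coord_domE)
  obtain V \<psi> j where V: "p \<in> V" and hol: "holomorphic_chart M J V \<psi> j"
    using int p cdom_topspace[OF i] unfolding integrable_acs_def by blast
  then have ch: "smooth_chart M V \<psi>" and j: "linear j" "\<And>v. j (j v) = - v"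
    by (auto simp: holomorphic_chart_def)
  define \<phi> where "\<phi> = \<psi> \<circ> inv_into (cdom M i) (chart M i)"
  define A where "A = chart M i ` (cdom M i \<inter> V)"
  note c = smooth_chartD[OF sm ch i, folded \<phi>_def A_def]
  have comm: "D \<phi> y (J i y v) = j (D \<phi> y v)" if "y \<in> A" for y v
    using hol i that by (auto simp: holomorphic_chart_def \<phi>_def A_def)
  have xA: "x \<in> A" using V p by (auto simp: A_def)
  define B2 where "B2 u v = D (\<lambda>y. D \<phi> y v) x u" for u v
  have sym: "B2 u v = B2 v u" for u v
    unfolding B2_def by (rule symmetric_second_derivative[OF c(1) xA c(3)])
  have linJ: "linear (J i y)" if "y \<in> A" for y using almost_complexD(1)[OF ac i] that c(9) by blast
  have sJ: "smooth_on A (\<lambda>y. J i y v)" for v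
    by (rule smooth_on_subset[OF almost_complexD(2)[OF ac i] c(9)])
  have key: "B2 u (J i x v) + D \<phi> x (D (\<lambda>y. J i y v) x u) = j (B2 u v)" for u v
  proof -
    have "D (\<lambda>y. D \<phi> y (J i y v)) x u = B2 u (J i x v) + D \<phi> x (D (\<lambda>y. J i y v) x u)"
      unfolding B2_def
      by (rule smooth_on_D_linear_apply[OF c(1) xA]) (use smooth_on_linear_D[OF c(3)] smooth_on_D[OF c(3)] sJ in auto)
    moreover have "D (\<lambda>y. D \<phi> y (J i y v)) x u = D (\<lambda>y. j (D \<phi> y v)) x u"
      using D_cong_open[OF c(1) xA, of "\<lambda>y. D \<phi> y (J i y v)" "\<lambda>y. j (D \<phi> y v)"] comm by simp
    moreover have "D (\<lambda>y. j (D \<phi> y v)) x u = j (B2 u v)"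
      unfolding B2_def using j(1) linear_conv_bounded_linear
      by (subst D_eqI[OF bounded_linear.has_derivative[OF _ smooth_on_has_derivative[OF smooth_on_D[OF c(3)] xA]]]) auto
    ultimately show ?thesis by simp
  qed
  note lin = linear_diff[OF smooth_on_linear_D[OF c(3) xA]]
  let ?dJ = "\<lambda>u v. D (\<lambda>y. J i y v) x u"
  have k: "D \<phi> x (?dJ u v) = j (B2 u v) - B2 u (J i x v)" for u v using key[of u v] by (simp add: algebra_simps)
  have "D \<phi> x (?dJ (J i x X) Y - ?dJ (J i x Y) X) = D \<phi> x (J i x (?dJ X Y - ?dJ Y X))"
    unfolding comm[OF xA] lin k
    using sym[of "J i x X" "J i x Y"] sym[of "J i x X" Y] sym[of "J i x Y" X] sym[of X Y]
    by (simp add: linear_diff[OF j(1)] j(2))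
  then have "D (chart M i \<circ> inv_into V \<psi>) (\<phi> x) (D \<phi> x (?dJ (J i x X) Y - ?dJ (J i x Y) X)) =
      D (chart M i \<circ> inv_into V \<psi>) (\<phi> x) (D \<phi> x (J i x (?dJ X Y - ?dJ Y X)))" by simp
  then show ?thesis using inverse_D_compose[OF c(1,3) xA c(2,4)] c(5,7) by simp
qed

section \<open>The cotangent bundle as a smooth manifold\<close>

lemma covec_inner: "linear f \<Longrightarrow> covec f \<bullet> v = f v"
  by (simp add: covec_def inner_sum_left linear_euclidean_sum[of f v] inner_commute[of v] mult.commute)

lemma inner_eqI: "(\<And>v. a \<bullet> v = b \<bullet> v) \<Longrightarrow> a = (b::'e::euclidean_space)"
  using vector_eq_rdot[of a b] by metis

lemma linear_covec:
  assumes "\<And>v. linear (\<lambda>a. f a v)"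
  shows "linear (\<lambda>a. covec (f a))"
  unfolding covec_def using assms
  by (intro linear_compose_sum ballI) (simp add: linear_iff scaleR_left_distrib)

lemma smooth_on_covec:
  "open S \<Longrightarrow> (\<And>v. smooth_on S (\<lambda>x. f x v)) \<Longrightarrow> smooth_on S (\<lambda>x. covec (f x))"
  unfolding covec_def by (intro smooth_on_sum smooth_on_scaleR smooth_on_const) auto

lemma linear_inner_comp: "linear f \<Longrightarrow> linear (\<lambda>v. a \<bullet> f v)"
  by (simp add: linear_iff inner_right_distrib)

text \<open>Covectors are carried along \<phi> by the transpose of the derivative of \<kappa>, which
  is intended to be the inverse of \<phi>. For transition maps of M this is the transition map of
  T*M.\<close>

definition cotangent_lift ::
  "('e::euclidean_space \<Rightarrow> 'e) \<Rightarrow> ('e \<Rightarrow> 'e) \<Rightarrow> 'e \<times> 'e \<Rightarrow> 'e \<times> 'e" where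
  "cotangent_lift \<phi> \<kappa> = (\<lambda>(x, a). (\<phi> x, covec (\<lambda>w. a \<bullet> D \<kappa> (\<phi> x) w)))"

lemma fst_cotangent_lift [simp]: "fst (cotangent_lift \<phi> \<kappa> z) = \<phi> (fst z)"
  by (simp add: cotangent_lift_def split: prod.split)

text \<open>Covers transition maps of the atlas as well as changes to an arbitrary smooth chart, so
  that lifts to the cotangent bundle are studied once.\<close>

locale diffeo =
  fixes A B :: "'e::euclidean_space set" and \<phi> \<kappa> :: "'e \<Rightarrow> 'e"
  assumes A: "open A" and B: "open B" and \<phi>: "smooth_on A \<phi>" and \<kappa>: "smooth_on B \<kappa>"
    and AB: "\<phi> ` A = B" and BA: "\<kappa> ` B = A"
    and \<kappa>\<phi>: "\<And>x. x \<in> A \<Longrightarrow> \<kappa> (\<phi> x) = x" and \<phi>\<kappa>: "\<And>y. y \<in> B \<Longrightarrow> \<phi> (\<kappa> y) = y"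
begin

lemma swap: "diffeo B A \<kappa> \<phi>"
  by unfold_locales (fact A B \<phi> \<kappa> AB BA \<kappa>\<phi> \<phi>\<kappa>)+

lemma \<phi>B: "x \<in> A \<Longrightarrow> \<phi> x \<in> B" using AB by blast

lemma D_inv: "x \<in> A \<Longrightarrow> D \<kappa> (\<phi> x) (D \<phi> x v) = v"
  by (rule inverse_D_compose[OF A \<phi> _ B \<kappa>]) (use AB \<kappa>\<phi> in auto)

lemma D_inv': "x \<in> A \<Longrightarrow> D \<phi> x (D \<kappa> (\<phi> x) v) = v"
  using inverse_D_compose[OF B \<kappa> \<phi>B A \<phi>, of x v] BA \<phi>\<kappa> \<kappa>\<phi> by auto

lemma lin\<phi>: "x \<in> A \<Longrightarrow> linear (D \<phi> x)" by (rule smooth_on_linear_D[OF \<phi>])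
lemma lin\<kappa>: "y \<in> B \<Longrightarrow> linear (D \<kappa> y)" by (rule smooth_on_linear_D[OF \<kappa>])

lemma snd_lift: "x \<in> A \<Longrightarrow> snd (cotangent_lift \<phi> \<kappa> (x, a)) \<bullet> w = a \<bullet> D \<kappa> (\<phi> x) w"
  by (simp add: cotangent_lift_def covec_inner linear_inner_comp lin\<kappa> \<phi>B)

lemma snd_lift_D: "x \<in> A \<Longrightarrow> snd (cotangent_lift \<phi> \<kappa> (x, a)) \<bullet> D \<phi> x w = a \<bullet> w"
  by (simp add: snd_lift D_inv)

lemma lift_inverse:
  assumes "z \<in> A \<times> UNIV" shows "cotangent_lift \<kappa> \<phi> (cotangent_lift \<phi> \<kappa> z) = z"
proof -
  interpret s: diffeo B A \<kappa> \<phi> by (rule swap)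
  obtain x a where z: "z = (x, a)" "x \<in> A" using assms by auto
  let ?y = "cotangent_lift \<phi> \<kappa> (x, a)"
  have y: "?y = (\<phi> x, snd ?y)" by (simp add: prod_eq_iff)
  have "snd (cotangent_lift \<kappa> \<phi> (\<phi> x, snd ?y)) = a"
    by (rule inner_eqI) (use z in \<open>simp add: s.snd_lift \<phi>B snd_lift D_inv \<kappa>\<phi>\<close>)
  then have "snd (cotangent_lift \<kappa> \<phi> ?y) = a" by (subst y)
  then show ?thesis unfolding z(1) using z(2) by (simp add: prod_eq_iff \<kappa>\<phi>)
qed

lemma lift_image: "cotangent_lift \<phi> \<kappa> ` (A \<times> UNIV) = B \<times> UNIV"
proof
  show "cotangent_lift \<phi> \<kappa> ` (A \<times> UNIV) \<subseteq> B \<times> UNIV" using \<phi>B by (auto simp: cotangent_lift_def)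
  interpret s: diffeo B A \<kappa> \<phi> by (rule swap)
  show "B \<times> UNIV \<subseteq> cotangent_lift \<phi> \<kappa> ` (A \<times> UNIV)"
  proof
    fix z :: "'e \<times> 'e" assume z: "z \<in> B \<times> UNIV"
    then have "cotangent_lift \<kappa> \<phi> z \<in> A \<times> UNIV" using s.\<phi>B by (auto simp: cotangent_lift_def)
    then show "z \<in> cotangent_lift \<phi> \<kappa> ` (A \<times> UNIV)" using s.lift_inverse[OF z] by (metis imageI)
  qed
qed

lemma smooth_lift: "smooth_on (A \<times> UNIV) (cotangent_lift \<phi> \<kappa>)"
proof -
  have o: "open (A \<times> (UNIV::'e set))" using A by (simp add: open_Times)
  have f: "smooth_on (A \<times> (UNIV::'e set)) (\<lambda>z. \<phi> (fst z))"
    by (rule smooth_on_compose[OF o A \<phi> smooth_on_fst[OF o smooth_on_id[OF o]]]) auto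
  have "smooth_on (A \<times> (UNIV::'e set)) (\<lambda>z. (\<phi> (fst z), covec (\<lambda>w. snd z \<bullet> D \<kappa> (\<phi> (fst z)) w)))"
    by (intro smooth_on_Pair o f smooth_on_covec smooth_on_inner smooth_on_snd smooth_on_id
        smooth_on_compose[OF o B smooth_on_D[OF \<kappa>] f]) (use \<phi>B in auto)
  then show ?thesis by (simp add: cotangent_lift_def case_prod_unfold)
qed

text \<open>Obtained by differentiating \<^term>\<open>snd (cotangent_lift \<phi> \<kappa> (x, a)) \<bullet> D \<phi> x w = a \<bullet> w\<close>.\<close>

lemma D_lift:
  assumes x: "x \<in> A"
  shows "fst (D (cotangent_lift \<phi> \<kappa>) (x, a) (v, c)) = D \<phi> x v"
    "snd (D (cotangent_lift \<phi> \<kappa>) (x, a) (v, c)) \<bullet> D \<phi> x w =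
       c \<bullet> w - snd (cotangent_lift \<phi> \<kappa> (x, a)) \<bullet> D (\<lambda>y. D \<phi> y w) x v"
proof -
  let ?T = "cotangent_lift \<phi> \<kappa>"
  have o: "open (A \<times> (UNIV::'e set))" using A by (simp add: open_Times)
  have xa: "(x, a) \<in> A \<times> UNIV" using x by simp
  have dT: "(?T has_derivative D ?T (x, a)) (at (x, a))" by (rule smooth_on_has_derivative[OF smooth_lift xa])
  have dfst: "((\<lambda>z. f (fst z)) has_derivative (\<lambda>Z. D f x (fst Z))) (at (x, a))"
    if "smooth_on A f" for f :: "'e \<Rightarrow> 'e"
    by (rule has_derivative_compose_at[OF has_derivative_fst[OF has_derivative_ident] smooth_on_has_derivative[OF that x]]) simp
  have "((\<lambda>z. fst (?T z)) has_derivative (\<lambda>Z. fst (D ?T (x, a) Z))) (at (x, a))"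
    by (rule has_derivative_fst[OF dT])
  then have "((\<lambda>z. \<phi> (fst z)) has_derivative (\<lambda>Z. fst (D ?T (x, a) Z))) (at (x, a))" by simp
  from has_derivative_unique[OF this dfst[OF \<phi>]]
  show "fst (D ?T (x, a) (v, c)) = D \<phi> x v" by (metis fst_conv)
  have "((\<lambda>z. snd (?T z) \<bullet> D \<phi> (fst z) w) has_derivative
      (\<lambda>Z. snd (?T (x, a)) \<bullet> D (\<lambda>y. D \<phi> y w) x (fst Z) + snd (D ?T (x, a) Z) \<bullet> D \<phi> (fst (x, a)) w)) (at (x, a))"
    by (rule has_derivative_inner[OF has_derivative_snd[OF dT] dfst[OF smooth_on_D[OF \<phi>]]])
  then have "((\<lambda>z. snd z \<bullet> w) has_derivative
      (\<lambda>Z. snd (?T (x, a)) \<bullet> D (\<lambda>y. D \<phi> y w) x (fst Z) + snd (D ?T (x, a) Z) \<bullet> D \<phi> (fst (x, a)) w)) (at (x, a))"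
    by (rule has_derivative_transform_within_open[OF _ o xa]) (auto simp: snd_lift_D)
  moreover have "((\<lambda>z. snd z \<bullet> w) has_derivative (\<lambda>Z. snd Z \<bullet> w)) (at (x, a))"
    by (intro has_derivative_inner_left has_derivative_snd has_derivative_ident)
  ultimately have "(\<lambda>Z. snd (?T (x, a)) \<bullet> D (\<lambda>y. D \<phi> y w) x (fst Z) + snd (D ?T (x, a) Z) \<bullet> D \<phi> (fst (x, a)) w) = (\<lambda>Z. snd Z \<bullet> w)"
    by (rule has_derivative_unique)
  from fun_cong[OF this, of "(v, c)"]
  show "snd (D ?T (x, a) (v, c)) \<bullet> D \<phi> x w = c \<bullet> w - snd (?T (x, a)) \<bullet> D (\<lambda>y. D \<phi> y w) x v"
    by (simp add: algebra_simps)
qed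

end

lemma smooth_chart_diffeo:
  assumes "smooth_manifold M" "smooth_chart M V \<psi>" "i \<in> idx M"
  shows "diffeo (chart M i ` (cdom M i \<inter> V)) (\<psi> ` (cdom M i \<inter> V))
    (\<psi> \<circ> inv_into (cdom M i) (chart M i)) (chart M i \<circ> inv_into V \<psi>)"
  by (rule diffeo.intro[OF smooth_chartD(1-8)[OF assms]])

section \<open>Topology, atlas and bundle charts of the cotangent bundle\<close>

context smooth_mfd begin

abbreviation N where "N \<equiv> cotangent_bundle M"

lemma transition_diffeo:
  assumes "i \<in> idx M" "j \<in> idx M"
  shows "diffeo (overlap M i j) (overlap M j i) (transition M i j) (transition M j i)"
proof
  have *: "transition M i j ` overlap M i j = overlap M j i" if "i \<in> idx M" "j \<in> idx M" for i j
  proof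
    show "transition M i j ` overlap M i j \<subseteq> overlap M j i" using transition_overlap that by blast
    show "overlap M j i \<subseteq> transition M i j ` overlap M i j"
      using transition_overlap[OF that(2)] transition_inverse[OF that(2,1)] by (metis imageI subsetI)
  qed
  show "transition M i j ` overlap M i j = overlap M j i" "transition M j i ` overlap M j i = overlap M i j"
    using assms * by auto
qed (use assms transition_inverse in \<open>auto intro: open_overlap smooth_transition\<close>)

lemma cotangent_spaceD:
  assumes "\<xi> \<in> cotangent_space M p" "i \<in> idx M" "j \<in> idx M" "p \<in> cdom M i" "p \<in> cdom M j"
  shows "\<xi> i \<bullet> v = \<xi> j \<bullet> dtrans M i j (chart M i p) v"
  using assms unfolding cotangent_space_def by blast

lemma cotangent_space_eqI:
  assumes "\<xi> \<in> cotangent_space M p" "\<eta> \<in> cotangent_space M p" "i \<in> idx M" "p \<in> cdom M i" "\<xi> i = \<eta> i"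
  shows "\<xi> = \<eta>"
proof
  fix k
  show "\<xi> k = \<eta> k"
  proof (cases "k \<in> idx M \<and> p \<in> cdom M k")
    case True
    then show ?thesis
      using cotangent_spaceD[OF assms(1) _ assms(3) _ assms(4)] cotangent_spaceD[OF assms(2) _ assms(3) _ assms(4)]
        assms(5) by (metis inner_eqI)
  next
    case False
    then have "\<xi> k = 0" "\<eta> k = 0" using assms(1,2) unfolding cotangent_space_def by blast+
    then show ?thesis by simp
  qed
qed

text \<open>The component at \<open>i\<close> determines a covector: the other components are forced
  by the transformation rule, and the cocycle identity makes them compatible.\<close>

lemma cotangent_space_ex:
  assumes i: "i \<in> idx M" "p \<in> cdom M i"
  shows "\<exists>\<xi>\<in>cotangent_space M p. \<xi> i = a"
proof -
  define \<xi> where "\<xi> k = (if k \<in> idx M \<and> p \<in> cdom M k then covec (\<lambda>w. a \<bullet> dtrans M k i (chart M k p) w) else 0)" for k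
  have \<xi>: "\<xi> k \<bullet> w = a \<bullet> dtrans M k i (chart M k p) w" if "k \<in> idx M" "p \<in> cdom M k" for k w
    using that i by (simp add: \<xi>_def covec_inner linear_inner_comp linear_dtrans overlapI)
  have "\<xi> i = a" by (rule inner_eqI) (use i in \<open>simp add: \<xi> dtrans_self coord_domI\<close>)
  moreover have "\<xi> \<in> cotangent_space M p"
    unfolding cotangent_space_def
    by (auto simp: \<xi> dtrans_cocycle i) (auto simp: \<xi>_def)
  ultimately show ?thesis by blast
qed

lemma chart_N: "chart N i (p, \<xi>) = (chart M i p, \<xi> i)"
  and idx_N: "idx N = idx M" and cdom_N: "cdom N i = cotangent_points M (cdom M i)"
  by (simp_all add: cotangent_bundle_def)

lemma cotangent_points_Int: "cotangent_points M V \<inter> cotangent_points M W = cotangent_points M (V \<inter> W)"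
  by (auto simp: cotangent_points_def)

lemma image_chart_N:
  assumes i: "i \<in> idx M" and V: "V \<subseteq> cdom M i"
  shows "chart N i ` cotangent_points M V = chart M i ` V \<times> UNIV"
proof
  show "chart N i ` cotangent_points M V \<subseteq> chart M i ` V \<times> UNIV"
    by (auto simp: cotangent_points_def chart_N)
  show "chart M i ` V \<times> UNIV \<subseteq> chart N i ` cotangent_points M V"
  proof
    fix z assume "z \<in> chart M i ` V \<times> (UNIV :: 'e set)"
    then obtain p a where p: "p \<in> V" "z = (chart M i p, a)" by auto
    then obtain \<xi> where "\<xi> \<in> cotangent_space M p" "\<xi> i = a"
      using cotangent_space_ex[OF i, of p a] V by auto
    then have "(p, \<xi>) \<in> cotangent_points M V" "z = chart N i (p, \<xi>)"
      using p by (auto simp: cotangent_points_def chart_N)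
    then show "z \<in> chart N i ` cotangent_points M V" by blast
  qed
qed

lemma inj_chart_N: "i \<in> idx M \<Longrightarrow> inj_on (chart N i) (cotangent_points M (cdom M i))"
  using chart_inj[of i] cotangent_space_eqI[of _ _ _ i]
  by (auto simp: inj_on_def cotangent_points_def chart_N)

text \<open>\<open>topology\<close> returns the intended open sets once the predicate is shown to be
  a topology; for intersections this rests on injectivity of the bundle charts.\<close>

lemma openin_N:
  "openin (mtop N) W \<longleftrightarrow> W \<subseteq> cotangent_points M (topspace (mtop M)) \<and>
     (\<forall>i\<in>idx M. open (chart N i ` (W \<inter> cotangent_points M (cdom M i))))"
proof -
  let ?P = "\<lambda>W. W \<subseteq> cotangent_points M (topspace (mtop M)) \<and>
     (\<forall>i\<in>idx M. open (chart N i ` (W \<inter> cotangent_points M (cdom M i))))"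
  have "istopology ?P"
    unfolding istopology_def
  proof (intro conjI allI impI ballI)
    fix S T i assume "?P S" "?P T" and i: "i \<in> idx M"
    then have "open (chart N i ` (S \<inter> cotangent_points M (cdom M i)) \<inter> chart N i ` (T \<inter> cotangent_points M (cdom M i)))"
      by blast
    also have "chart N i ` (S \<inter> cotangent_points M (cdom M i)) \<inter> chart N i ` (T \<inter> cotangent_points M (cdom M i))
        = chart N i ` ((S \<inter> cotangent_points M (cdom M i)) \<inter> (T \<inter> cotangent_points M (cdom M i)))"
      by (rule inj_on_image_Int[OF inj_chart_N[OF i], symmetric]) auto
    also have "(S \<inter> cotangent_points M (cdom M i)) \<inter> (T \<inter> cotangent_points M (cdom M i)) = S \<inter> T \<inter> cotangent_points M (cdom M i)"
      by blast
    finally show "open (chart N i ` (S \<inter> T \<inter> cotangent_points M (cdom M i)))" .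
  next
    fix K i assume K: "\<forall>S\<in>K. ?P S" and i: "i \<in> idx M"
    have "chart N i ` (\<Union>K \<inter> cotangent_points M (cdom M i)) = (\<Union>S\<in>K. chart N i ` (S \<inter> cotangent_points M (cdom M i)))"
      by blast
    then show "open (chart N i ` (\<Union>K \<inter> cotangent_points M (cdom M i)))" using K i by auto
  qed blast+
  moreover have "mtop N = topology ?P"
    unfolding cotangent_bundle_def by (simp add: case_prod_unfold)
  ultimately show ?thesis by (simp add: topology_inverse')
qed

lemma openin_cotangent_points:
  assumes "openin (mtop M) V" shows "openin (mtop N) (cotangent_points M V)"
  unfolding openin_N
proof (intro conjI ballI)
  have V: "V \<subseteq> topspace (mtop M)" using assms by (rule openin_subset)
  then show "cotangent_points M V \<subseteq> cotangent_points M (topspace (mtop M))" by (auto simp: cotangent_points_def)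
  fix i assume i: "i \<in> idx M"
  have "open (chart M i ` (V \<inter> cdom M i))" using assms i by (simp add: chart_open_iff openin_Int openin_cdom)
  then show "open (chart N i ` (cotangent_points M V \<inter> cotangent_points M (cdom M i)))"
    using i by (simp add: cotangent_points_Int image_chart_N open_Times)
qed

lemma topspace_N: "topspace (mtop N) = cotangent_points M (topspace (mtop M))"
proof
  show "topspace (mtop N) \<subseteq> cotangent_points M (topspace (mtop M))" using openin_N openin_topspace by blast
  show "cotangent_points M (topspace (mtop M)) \<subseteq> topspace (mtop N)"
    using openin_subset[OF openin_cotangent_points[OF openin_topspace]] .
qed

lemma coord_dom_N: "i \<in> idx M \<Longrightarrow> coord_dom N i = coord_dom M i \<times> UNIV"
  by (simp add: coord_dom_def cdom_N image_chart_N)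

lemma overlap_N: "i \<in> idx M \<Longrightarrow> overlap N i j = overlap M i j \<times> UNIV"
  by (simp add: overlap_def cdom_N image_chart_N cotangent_points_Int)

lemma lift_chart_N:
  assumes "i \<in> idx M" "j \<in> idx M" "q \<in> cdom N i" "q \<in> cdom N j"
  shows "cotangent_lift (transition M i j) (transition M j i) (chart N i q) = chart N j q"
proof -
  interpret d: diffeo "overlap M i j" "overlap M j i" "transition M i j" "transition M j i"
    by (rule transition_diffeo[OF assms(1,2)])
  obtain p \<xi> where q: "q = (p, \<xi>)" "p \<in> cdom M i" "p \<in> cdom M j" "\<xi> \<in> cotangent_space M p"
    using assms(3,4) by (auto simp: cdom_N cotangent_points_def)
  have "snd (cotangent_lift (transition M i j) (transition M j i) (chart M i p, \<xi> i)) = \<xi> j"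
    by (rule inner_eqI)
      (use q assms in \<open>simp add: d.snd_lift overlapI transition_chart cotangent_spaceD[of \<xi> p j i] dtrans_def\<close>)
  then show ?thesis
    unfolding q(1) using q(2,3) assms(1) by (simp add: chart_N prod_eq_iff transition_chart)
qed

lemma transition_N:
  assumes "i \<in> idx M" "j \<in> idx M" "z \<in> overlap N i j"
  shows "transition N i j z = cotangent_lift (transition M i j) (transition M j i) z"
proof -
  obtain q where q: "q \<in> cdom N i" "q \<in> cdom N j" "z = chart N i q" using assms(3) by (auto simp: overlap_def)
  then show ?thesis using assms inj_chart_N[of i] lift_chart_N[OF assms(1,2) q(1,2)]
    by (simp add: transition_def cdom_N)
qed

text \<open>The topology tests openness in all charts at once. One chart is enough because the
  lifted transition maps are homeomorphisms between the overlaps.\<close>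

lemma openin_N_cdom:
  assumes i: "i \<in> idx M" and U: "U \<subseteq> cdom N i"
  shows "openin (mtop N) U \<longleftrightarrow> open (chart N i ` U)"
proof
  assume "openin (mtop N) U"
  then show "open (chart N i ` U)" using i U unfolding openin_N cdom_N by (metis inf.absorb1)
next
  assume op: "open (chart N i ` U)"
  show "openin (mtop N) U"
    unfolding openin_N
  proof (intro conjI ballI)
    show "U \<subseteq> cotangent_points M (topspace (mtop M))"
      using U cdom_topspace[OF i] by (auto simp: cdom_N cotangent_points_def)
    fix k assume k: "k \<in> idx M"
    interpret d: diffeo "overlap M i k" "overlap M k i" "transition M i k" "transition M k i"
      by (rule transition_diffeo[OF i k])
    interpret s: diffeo "overlap M k i" "overlap M i k" "transition M k i" "transition M i k"
      by (rule d.swap)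
    let ?L = "cotangent_lift (transition M i k) (transition M k i)"
    have eq: "chart N k ` (U \<inter> cdom N k) = ?L ` chart N i ` (U \<inter> cdom N k)"
      unfolding image_image using lift_chart_N[OF i k] U by (intro image_cong) auto
    have "chart N i ` (U \<inter> cdom N k) \<subseteq> overlap N i k"
      unfolding overlap_def using U by (intro image_mono) blast
    then have sub: "chart N i ` (U \<inter> cdom N k) \<subseteq> overlap M i k \<times> UNIV"
      by (simp only: overlap_N[OF i])
    have "chart N i ` U \<inter> overlap N i k = chart N i ` (U \<inter> (cdom N i \<inter> cdom N k))"
      unfolding overlap_def
      by (rule inj_on_image_Int[OF inj_chart_N[OF i], symmetric]) (use U in \<open>auto simp: cdom_N\<close>)
    also have "U \<inter> (cdom N i \<inter> cdom N k) = U \<inter> cdom N k" using U by blast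
    finally have "chart N i ` (U \<inter> cdom N k) = chart N i ` U \<inter> overlap M i k \<times> UNIV"
      by (simp only: overlap_N[OF i])
    moreover have "open (overlap M i k \<times> (UNIV::'e set))" using d.A by (simp add: open_Times)
    ultimately have "open (chart N i ` (U \<inter> cdom N k))" using op by auto
    moreover have "open (?L ` chart N i ` (U \<inter> cdom N k)) \<longleftrightarrow> open (chart N i ` (U \<inter> cdom N k))"
      by (rule open_image_iff_homeo[OF _ _ smooth_on_continuous[OF d.smooth_lift] smooth_on_continuous[OF s.smooth_lift]
            d.lift_image d.lift_inverse sub])
        (use d.A d.B in \<open>auto simp: open_Times\<close>)
    ultimately show "open (chart N k ` (U \<inter> cotangent_points M (cdom M k)))" by (simp only: eq cdom_N[symmetric])
  qed
qed

lemma topological_chart_N: "i \<in> idx M \<Longrightarrow> topological_chart (mtop N) (cdom N i) (chart N i)"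
  unfolding topological_chart_iff
  using openin_N_cdom[of i] inj_chart_N[of i] openin_cotangent_points[OF openin_cdom[of i]]
  unfolding cdom_N by blast

lemma image_preimage_N:
  "i \<in> idx M \<Longrightarrow> chart N i ` {s \<in> cdom N i. chart N i s \<in> W} = (coord_dom M i \<times> UNIV) \<inter> W"
  by (subst coord_dom_N[symmetric]) (auto simp: coord_dom_def)

text \<open>Distinct base points are separated in \<open>M\<close>; covectors over the same point
  lie in one bundle chart and are separated there.\<close>

lemma Hausdorff_N: "Hausdorff_space (mtop N)"
  unfolding Hausdorff_space_def
proof (intro allI impI, elim conjE)
  fix q r assume qr: "q \<in> topspace (mtop N)" "r \<in> topspace (mtop N)" "q \<noteq> r"
  then have tp: "fst q \<in> topspace (mtop M)" "fst r \<in> topspace (mtop M)"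
    by (auto simp: topspace_N cotangent_points_def)
  show "\<exists>U V. openin (mtop N) U \<and> openin (mtop N) V \<and> q \<in> U \<and> r \<in> V \<and> disjnt U V"
  proof (cases "fst q = fst r")
    case False
    have "Hausdorff_space (mtop M)" using sm by (simp add: smooth_manifold_def)
    then obtain U V where UV: "openin (mtop M) U" "openin (mtop M) V" "fst q \<in> U" "fst r \<in> V" "disjnt U V"
      using tp False unfolding Hausdorff_space_def by metis
    then show ?thesis
      using qr openin_cotangent_points[OF UV(1)] openin_cotangent_points[OF UV(2)]
      by (intro exI[of _ "cotangent_points M U"] exI[of _ "cotangent_points M V"])
        (auto simp: topspace_N cotangent_points_def disjnt_def)
  next
    case True
    obtain i where i: "i \<in> idx M" "fst q \<in> cdom M i" using cover tp by blast
    have mem: "q \<in> cdom N i" "r \<in> cdom N i"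
      using i qr True by (auto simp: cdom_N topspace_N cotangent_points_def)
    have "chart N i q \<noteq> chart N i r" using inj_chart_N[OF i(1)] mem qr(3) by (auto simp: inj_on_def cdom_N)
    then obtain U V where UV: "open U" "open V" "chart N i q \<in> U" "chart N i r \<in> V" "U \<inter> V = {}"
      using hausdorff by metis
    have "openin (mtop N) {s \<in> cdom N i. chart N i s \<in> W}" if "open W" for W
    proof -
      note image_preimage_N[OF i(1), of W]
      moreover have "open (coord_dom M i \<times> (UNIV::'e set))" using i by (simp add: open_Times open_coord_dom)
      ultimately have "open (chart N i ` {s \<in> cdom N i. chart N i s \<in> W})" using that by auto
      then show ?thesis using openin_N_cdom[OF i(1), of "{s \<in> cdom N i. chart N i s \<in> W}"] by auto
    qed
    then show ?thesis using UV mem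
      by (intro exI[of _ "{s \<in> cdom N i. chart N i s \<in> U}"] exI[of _ "{s \<in> cdom N i. chart N i s \<in> V}"])
        (auto simp: disjnt_def)
  qed
qed

text \<open>The atlas may be uncountable, so the Lindelof property first extracts countably many
  charts covering \<open>M\<close>; their bundle charts pull back a countable basis.\<close>

lemma second_countable_N: "second_countable (mtop N)"
proof -
  have "second_countable (mtop M)" using sm by (simp add: smooth_manifold_def)
  then have "Lindelof_space (mtop M)" by (rule second_countable_imp_Lindelof_space)
  moreover have "\<forall>C\<in>cdom M ` idx M. openin (mtop M) C" using openin_cdom by auto
  moreover have "\<Union>(cdom M ` idx M) = topspace (mtop M)" using sm by (simp add: smooth_manifold_def)
  ultimately obtain \<V> where \<V>: "countable \<V>" "\<V> \<subseteq> cdom M ` idx M" "\<Union>\<V> = topspace (mtop M)"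
    unfolding Lindelof_space_def by meson
  then obtain I where I: "countable I" "I \<subseteq> idx M" "\<V> = cdom M ` I"
    by (metis countable_subset_image)
  obtain \<B> :: "('e \<times> 'e) set set" where \<B>: "countable \<B>" "topological_basis \<B>"
    using ex_countable_basis by blast
  define W where "W i b = {s \<in> cdom N i. chart N i s \<in> b}" for i b
  have oW: "openin (mtop N) (W i b)" if "i \<in> idx M" "open b" for i b
  proof -
    have "chart N i ` W i b = (coord_dom M i \<times> UNIV) \<inter> b"
      unfolding W_def by (rule image_preimage_N[OF that(1)])
    moreover have "open (coord_dom M i \<times> (UNIV::'e set))" using that by (simp add: open_Times open_coord_dom)
    ultimately have "open (chart N i ` W i b)" using that by auto
    then show ?thesis using openin_N_cdom[OF that(1), of "W i b"] by (auto simp: W_def)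
  qed
  show ?thesis
    unfolding second_countable_def
  proof (intro exI[of _ "(\<lambda>(i, b). W i b) ` (I \<times> \<B>)"] conjI ballI allI impI)
    show "countable ((\<lambda>(i, b). W i b) ` (I \<times> \<B>))" using I(1) \<B>(1) by blast
    show "openin (mtop N) V" if "V \<in> (\<lambda>(i, b). W i b) ` (I \<times> \<B>)" for V
      using that oW I(2) topological_basis_open[OF \<B>(2)] by auto
    fix U q assume "openin (mtop N) U \<and> q \<in> U"
    then have U: "openin (mtop N) U" "q \<in> U" by auto
    then have q: "q \<in> cotangent_points M (topspace (mtop M))" using openin_subset topspace_N by blast
    then have "fst q \<in> \<Union>\<V>" unfolding \<V>(3) by (auto simp: cotangent_points_def)
    then obtain i where i: "i \<in> I" "fst q \<in> cdom M i" unfolding I(3) by blast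
    have qi: "q \<in> cdom N i" using q i by (auto simp: cdom_N cotangent_points_def)
    have "open (chart N i ` (U \<inter> cdom N i))" using U(1) i I(2) by (auto simp: openin_N cdom_N)
    then obtain b where b: "b \<in> \<B>" "chart N i q \<in> b" "b \<subseteq> chart N i ` (U \<inter> cdom N i)"
      using topological_basisE[OF \<B>(2)] U(2) qi by (metis IntI imageI)
    have "W i b \<subseteq> U"
    proof
      fix s assume s: "s \<in> W i b"
      then obtain t where t: "t \<in> U \<inter> cdom N i" "chart N i s = chart N i t" using b(3) by (auto simp: W_def)
      then have "s = t" using inj_chart_N[of i] i I(2) s by (auto simp: inj_on_def W_def cdom_N)
      then show "s \<in> U" using t by simp
    qed
    then show "\<exists>V\<in>(\<lambda>(i, b). W i b) ` (I \<times> \<B>). q \<in> V \<and> V \<subseteq> U"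
      using i b qi by (intro bexI[of _ "W i b"]) (auto simp: W_def)
  qed
qed

lemma smooth_transition_N:
  assumes "i \<in> idx M" "j \<in> idx M" shows "smooth_on (overlap N i j) (transition N i j)"
proof -
  interpret d: diffeo "overlap M i j" "overlap M j i" "transition M i j" "transition M j i"
    by (rule transition_diffeo[OF assms])
  show ?thesis
    unfolding overlap_N[OF assms(1)]
    by (rule smooth_on_cong[OF _ _ d.smooth_lift])
      (use d.A transition_N[OF assms] overlap_N[OF assms(1)] in \<open>auto simp: open_Times\<close>)
qed

lemma smooth_manifold_N: "smooth_manifold N"
  unfolding smooth_manifold_def idx_N
proof (intro conjI ballI)
  show "(\<Union>i\<in>idx M. cdom N i) = topspace (mtop N)"
    using cover cdom_topspace unfolding topspace_N cdom_N by (auto simp: cotangent_points_def)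
qed (auto intro: Hausdorff_N second_countable_N topological_chart_N smooth_transition_N)

text \<open>The fibre part of a tangent vector transforms with a second derivative of the transition
  map. In \<open>hv_iso_trans\<close> the Christoffel maps absorb this term.\<close>

lemma D_transition_N:
  assumes i: "i \<in> idx M" "j \<in> idx M" and x: "x \<in> overlap M i j"
  shows "fst (dtrans N i j (x, a) (v, c)) = dtrans M i j x v"
    "snd (dtrans N i j (x, a) (v, c)) \<bullet> dtrans M i j x w =
       c \<bullet> w - snd (transition N i j (x, a)) \<bullet> D (\<lambda>y. dtrans M i j y w) x v"
    "snd (transition N i j (x, a)) \<bullet> dtrans M i j x w = a \<bullet> w"
    "fst (transition N i j (x, a)) = transition M i j x"
proof -
  interpret d: diffeo "overlap M i j" "overlap M j i" "transition M i j" "transition M j i"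
    by (rule transition_diffeo[OF i])
  let ?T = "cotangent_lift (transition M i j) (transition M j i)"
  have o: "open (overlap N i j)" using d.A by (simp add: overlap_N[OF i(1)] open_Times)
  have xa: "(x, a) \<in> overlap N i j" using x by (simp add: overlap_N[OF i(1)])
  have eq: "dtrans N i j (x, a) = D ?T (x, a)"
    unfolding dtrans_def by (rule D_cong_open[OF o xa]) (rule transition_N[OF i])
  note t = transition_N[OF i xa]
  show "fst (dtrans N i j (x, a) (v, c)) = dtrans M i j x v"
    "snd (dtrans N i j (x, a) (v, c)) \<bullet> dtrans M i j x w =
       c \<bullet> w - snd (transition N i j (x, a)) \<bullet> D (\<lambda>y. dtrans M i j y w) x v"
    unfolding eq t dtrans_def[of M] by (rule d.D_lift[OF x])+
  show "snd (transition N i j (x, a)) \<bullet> dtrans M i j x w = a \<bullet> w"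
    "fst (transition N i j (x, a)) = transition M i j x"
    unfolding t dtrans_def[of M] by (simp_all add: d.snd_lift_D[OF x])
qed

text \<open>The index picked by \<open>SOME\<close> can be replaced by \<open>i\<close>: the
  derivatives of the two coordinate maps differ by \<open>dtrans\<close>, which the components of a
  covector compensate. Hence the bundle chart is a cotangent lift in every chart of the
  atlas.\<close>

lemma bundle_chart_eq:
  assumes ch: "smooth_chart M V \<psi>" and i: "i \<in> idx M" "p \<in> cdom M i" and p: "p \<in> V" "\<xi> \<in> cotangent_space M p"
  shows "bundle_chart M V \<psi> (p, \<xi>) =
    cotangent_lift (\<psi> \<circ> inv_into (cdom M i) (chart M i)) (chart M i \<circ> inv_into V \<psi>) (chart N i (p, \<xi>))"
proof -
  define k where "k = (SOME k. k \<in> idx M \<and> p \<in> cdom M k)"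
  have k: "k \<in> idx M" "p \<in> cdom M k" using someI[of "\<lambda>k. k \<in> idx M \<and> p \<in> cdom M k" i] i by (auto simp: k_def)
  have inj: "inj_on \<psi> V" using ch by (auto simp: smooth_chart_def topological_chart_iff)
  note ci = smooth_chartD[OF sm ch i(1)] and ck = smooth_chartD[OF sm ch k(1)]
  have "\<xi> k \<bullet> D (chart M k \<circ> inv_into V \<psi>) (\<psi> p) v = \<xi> i \<bullet> D (chart M i \<circ> inv_into V \<psi>) (\<psi> p) v" for v
  proof -
    let ?O = "\<psi> ` (cdom M i \<inter> V) \<inter> \<psi> ` (cdom M k \<inter> V)"
    have O: "open ?O" "\<psi> p \<in> ?O" using ci(2) ck(2) i k p by auto
    have "((\<lambda>y. transition M i k ((chart M i \<circ> inv_into V \<psi>) y)) has_derivative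
        (\<lambda>v. dtrans M i k (chart M i p) (D (chart M i \<circ> inv_into V \<psi>) (\<psi> p) v))) (at (\<psi> p))"
      by (rule has_derivative_compose_at[OF smooth_on_has_derivative[OF ci(4)] transition_has_derivative])
        (use i k p in \<open>auto simp: inj intro: overlapI\<close>)
    then have "((chart M k \<circ> inv_into V \<psi>) has_derivative
        (\<lambda>v. dtrans M i k (chart M i p) (D (chart M i \<circ> inv_into V \<psi>) (\<psi> p) v))) (at (\<psi> p))"
    proof (rule has_derivative_transform_within_open[OF _ O])
      fix y assume "y \<in> ?O"
      then obtain q where q: "q \<in> cdom M i" "q \<in> V" "y = \<psi> q" by auto
      then show "transition M i k ((chart M i \<circ> inv_into V \<psi>) y) = (chart M k \<circ> inv_into V \<psi>) y"
        using i inj by (simp add: transition_chart)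
    qed
    from D_eqI[OF this] show ?thesis
      using cotangent_spaceD[OF p(2) i(1) k(1) i(2) k(2)] by simp
  qed
  then show ?thesis
    using i p by (simp add: bundle_chart_def Let_def k_def[symmetric] cotangent_lift_def chart_N inv_chart)
qed

text \<open>Once the base points agree, both covectors are seen in one chart, where the bundle chart
  is an invertible lift.\<close>

lemma inj_bundle_chart:
  assumes ch: "smooth_chart M V \<psi>"
  shows "inj_on (bundle_chart M V \<psi>) (cotangent_points M V)"
proof (rule inj_onI)
  fix q r assume q: "q \<in> cotangent_points M V" and r: "r \<in> cotangent_points M V"
    and eq: "bundle_chart M V \<psi> q = bundle_chart M V \<psi> r"
  have fstb: "fst (bundle_chart M V \<psi> s) = \<psi> (fst s)" for s
    by (simp add: bundle_chart_def Let_def split: prod.split)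
  have V: "inj_on \<psi> V" "V \<subseteq> topspace (mtop M)"
    using ch openin_subset by (auto simp: smooth_chart_def topological_chart_iff)
  have pq: "fst q \<in> V" "fst r \<in> V" using q r by (auto simp: cotangent_points_def)
  then have "fst q = fst r" using eq fstb V(1) by (metis inj_onD)
  then obtain p \<xi> \<eta> where e: "q = (p, \<xi>)" "r = (p, \<eta>)" by (metis prod.collapse)
  then have p: "p \<in> V" "\<xi> \<in> cotangent_space M p" "\<eta> \<in> cotangent_space M p"
    using q r by (auto simp: cotangent_points_def)
  obtain i where i: "i \<in> idx M" "p \<in> cdom M i" using cover V(2) p(1) by blast
  interpret d: diffeo "chart M i ` (cdom M i \<inter> V)" "\<psi> ` (cdom M i \<inter> V)"
    "\<psi> \<circ> inv_into (cdom M i) (chart M i)" "chart M i \<circ> inv_into V \<psi>"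
    by (rule smooth_chart_diffeo[OF sm ch i(1)])
  have "chart N i q \<in> chart M i ` (cdom M i \<inter> V) \<times> UNIV" "chart N i r \<in> chart M i ` (cdom M i \<inter> V) \<times> UNIV"
    using e p i by (auto simp: chart_N)
  note inv = d.lift_inverse[OF this(1)] d.lift_inverse[OF this(2)]
  have "chart N i q = chart N i r"
    using inv eq unfolding e bundle_chart_eq[OF ch i p(1,2)] bundle_chart_eq[OF ch i p(1,3)] by metis
  then show "q = r" using e cotangent_space_eqI[OF p(2,3) i] by (simp add: chart_N)
qed

text \<open>Both coordinate changes are cotangent lifts, of a diffeomorphism and of its inverse. The
  second statement is the form in which the bundle chart is differentiated later.\<close>

lemma smooth_bundle_chart:
  assumes ch: "smooth_chart M V \<psi>"
  shows "smooth_chart N (cotangent_points M V) (bundle_chart M V \<psi>)"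
    and "i \<in> idx M \<Longrightarrow> z \<in> chart M i ` (cdom M i \<inter> V) \<times> UNIV \<Longrightarrow>
      (bundle_chart M V \<psi> \<circ> inv_into (cdom N i) (chart N i)) z =
        cotangent_lift (\<psi> \<circ> inv_into (cdom M i) (chart M i)) (chart M i \<circ> inv_into V \<psi>) z"
proof -
  interpret N: smooth_mfd N by unfold_locales (rule smooth_manifold_N)
  have V: "inj_on \<psi> V" "V \<subseteq> topspace (mtop M)"
    using ch openin_subset by (auto simp: smooth_chart_def topological_chart_iff)
  have dom: "cdom N i \<inter> cotangent_points M V = cotangent_points M (cdom M i \<inter> V)" for i
    by (simp add: cdom_N cotangent_points_Int)
  have im: "chart N i ` (cdom N i \<inter> cotangent_points M V) = chart M i ` (cdom M i \<inter> V) \<times> UNIV"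
    if "i \<in> idx M" for i unfolding dom using image_chart_N[OF that] by simp
  show eq: "(bundle_chart M V \<psi> \<circ> inv_into (cdom N i) (chart N i)) z =
        cotangent_lift (\<psi> \<circ> inv_into (cdom M i) (chart M i)) (chart M i \<circ> inv_into V \<psi>) z"
    if i: "i \<in> idx M" and z: "z \<in> chart M i ` (cdom M i \<inter> V) \<times> UNIV" for i z
  proof -
    obtain p \<xi> where q: "z = chart N i (p, \<xi>)" "p \<in> cdom M i" "p \<in> V" "\<xi> \<in> cotangent_space M p"
    proof -
      obtain q where q: "z = chart N i q" "q \<in> cotangent_points M (cdom M i \<inter> V)"
        using z unfolding im[OF i, symmetric] dom by blast
      then show thesis using that[of "fst q" "snd q"] by (auto simp: cotangent_points_def)
    qed
    have "inv_into (cdom N i) (chart N i) z = (p, \<xi>)"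
      unfolding q(1) by (rule N.inv_chart) (use i q in \<open>auto simp: idx_N cdom_N cotangent_points_def\<close>)
    then show ?thesis using bundle_chart_eq[OF ch i q(2,3,4)] q(1) by simp
  qed
  have imB: "bundle_chart M V \<psi> ` (cdom N i \<inter> cotangent_points M V) = \<psi> ` (cdom M i \<inter> V) \<times> UNIV"
    if i: "i \<in> idx M" for i
  proof -
    interpret d: diffeo "chart M i ` (cdom M i \<inter> V)" "\<psi> ` (cdom M i \<inter> V)"
      "\<psi> \<circ> inv_into (cdom M i) (chart M i)" "chart M i \<circ> inv_into V \<psi>"
      by (rule smooth_chart_diffeo[OF sm ch i])
    have "bundle_chart M V \<psi> ` (cdom N i \<inter> cotangent_points M V) =
      cotangent_lift (\<psi> \<circ> inv_into (cdom M i) (chart M i)) (chart M i \<circ> inv_into V \<psi>) `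
        chart N i ` (cdom N i \<inter> cotangent_points M V)"
      unfolding image_image
    proof (rule image_cong[OF refl])
      fix q assume "q \<in> cdom N i \<inter> cotangent_points M V"
      then obtain p \<xi> where q: "q = (p, \<xi>)" "p \<in> cdom M i" "p \<in> V" "\<xi> \<in> cotangent_space M p"
        unfolding dom by (auto simp: cotangent_points_def)
      show "bundle_chart M V \<psi> q = cotangent_lift (\<psi> \<circ> inv_into (cdom M i) (chart M i)) (chart M i \<circ> inv_into V \<psi>) (chart N i q)"
        unfolding q(1) by (rule bundle_chart_eq[OF ch i q(2-4)])
    qed
    then show ?thesis by (simp only: im[OF i] d.lift_image)
  qed
  show "smooth_chart N (cotangent_points M V) (bundle_chart M V \<psi>)"
  proof (rule N.smooth_chartI)
    show "cotangent_points M V \<subseteq> topspace (mtop N)" using V(2) by (auto simp: topspace_N cotangent_points_def)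
    show "inj_on (bundle_chart M V \<psi>) (cotangent_points M V)" by (rule inj_bundle_chart[OF ch])
    fix i assume "i \<in> idx N"
    then have i: "i \<in> idx M" by (simp add: idx_N)
    interpret d: diffeo "chart M i ` (cdom M i \<inter> V)" "\<psi> ` (cdom M i \<inter> V)"
      "\<psi> \<circ> inv_into (cdom M i) (chart M i)" "chart M i \<circ> inv_into V \<psi>"
      by (rule smooth_chart_diffeo[OF sm ch i])
    interpret s: diffeo "\<psi> ` (cdom M i \<inter> V)" "chart M i ` (cdom M i \<inter> V)"
      "chart M i \<circ> inv_into V \<psi>" "\<psi> \<circ> inv_into (cdom M i) (chart M i)" by (rule d.swap)
    show o1: "open (chart N i ` (cdom N i \<inter> cotangent_points M V))" using d.A by (simp add: im[OF i] open_Times)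
    show o2: "open (bundle_chart M V \<psi> ` (cdom N i \<inter> cotangent_points M V))" using d.B by (simp add: imB[OF i] open_Times)
    show "smooth_on (chart N i ` (cdom N i \<inter> cotangent_points M V)) (bundle_chart M V \<psi> \<circ> inv_into (cdom N i) (chart N i))"
      using o1 unfolding im[OF i] by (rule smooth_on_cong[OF _ _ d.smooth_lift]) (use eq[OF i] in auto)
    show "smooth_on (bundle_chart M V \<psi> ` (cdom N i \<inter> cotangent_points M V)) (chart N i \<circ> inv_into (cotangent_points M V) (bundle_chart M V \<psi>))"
    proof (rule smooth_on_cong[OF o2])
      show "smooth_on (bundle_chart M V \<psi> ` (cdom N i \<inter> cotangent_points M V))
        (cotangent_lift (chart M i \<circ> inv_into V \<psi>) (\<psi> \<circ> inv_into (cdom M i) (chart M i)))"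
        unfolding imB[OF i] by (rule s.smooth_lift)
      fix y assume "y \<in> bundle_chart M V \<psi> ` (cdom N i \<inter> cotangent_points M V)"
      then obtain p \<xi> where q: "y = bundle_chart M V \<psi> (p, \<xi>)" "p \<in> cdom M i" "p \<in> V" "\<xi> \<in> cotangent_space M p"
      proof -
        obtain q where "y = bundle_chart M V \<psi> q" "q \<in> cotangent_points M (cdom M i \<inter> V)"
          using \<open>y \<in> _\<close> unfolding dom by blast
        then show thesis using that[of "fst q" "snd q"] by (auto simp: cotangent_points_def)
      qed
      have "inv_into (cotangent_points M V) (bundle_chart M V \<psi>) y = (p, \<xi>)"
        unfolding q(1) by (rule inv_into_f_f[OF inj_bundle_chart[OF ch]]) (use q in \<open>auto simp: cotangent_points_def\<close>)
      moreover have "cotangent_lift (chart M i \<circ> inv_into V \<psi>) (\<psi> \<circ> inv_into (cdom M i) (chart M i)) y = chart N i (p, \<xi>)"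
        unfolding q(1) bundle_chart_eq[OF ch i q(2,3,4)]
        by (rule d.lift_inverse) (use q in \<open>auto simp: chart_N\<close>)
      ultimately show "cotangent_lift (chart M i \<circ> inv_into V \<psi>) (\<psi> \<circ> inv_into (cdom M i) (chart M i)) y =
          (chart N i \<circ> inv_into (cotangent_points M V) (bundle_chart M V \<psi>)) y" by simp
    qed
  qed
qed

end

section \<open>Horizontal and vertical splitting\<close>

definition hv_inv :: "('i, 'e::euclidean_space, 'e) bilin \<Rightarrow> 'i \<Rightarrow> 'e \<times> 'e \<Rightarrow> 'e \<times> 'e \<Rightarrow> 'e \<times> 'e" where
  "hv_inv \<Gamma> i z = (\<lambda>(v, c). (v, c - covec (\<lambda>w. snd z \<bullet> \<Gamma> i (fst z) v w)))"

lemma hv_iso_inv [simp]: "hv_iso \<Gamma> i z (hv_inv \<Gamma> i z Z) = Z"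
  and hv_inv_iso [simp]: "hv_inv \<Gamma> i z (hv_iso \<Gamma> i z Z) = Z"
  by (simp_all add: hv_iso_def hv_inv_def horizontal_lift_def split: prod.split)

lemma inv_hv_iso: "inv (hv_iso \<Gamma> i z) = hv_inv \<Gamma> i z"
  by (rule inv_equality) simp_all

lemma hv_endo_eq: "hv_endo \<Gamma> P i z Z = hv_iso \<Gamma> i z (P i (fst z) (hv_inv \<Gamma> i z Z))"
  by (simp add: hv_endo_def inv_hv_iso)

lemma hv_bilin_eq: "hv_bilin \<Gamma> Q i z Z W = Q i (fst z) (hv_inv \<Gamma> i z Z) (hv_inv \<Gamma> i z W)"
  by (simp add: hv_bilin_def inv_hv_iso)

lemma endo_comp_hv_endo: "endo_comp (hv_endo \<Gamma> P) (hv_endo \<Gamma> Q) = hv_endo \<Gamma> (\<lambda>i x Y. P i x (Q i x Y))"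
  by (simp add: endo_comp_def hv_endo_eq fun_eq_iff)

lemma fst_hv_inv [simp]: "fst (hv_inv \<Gamma> i z Z) = fst Z"
  and fst_hv_iso [simp]: "fst (hv_iso \<Gamma> i z Z) = fst Z"
  by (simp_all add: hv_inv_def hv_iso_def horizontal_lift_def split: prod.split)

section \<open>Chart independence of the splitting\<close>

locale mfd_connection = smooth_mfd M
  for M :: "('i, 'm, 'e::euclidean_space) atlas" +
  fixes \<Gamma> :: "('i, 'e, 'e) bilin"
  assumes conn: "connection M \<Gamma>"
begin

lemma bil\<Gamma>: "i \<in> idx M \<Longrightarrow> x \<in> coord_dom M i \<Longrightarrow> bilinear (\<Gamma> i x)"
  and smooth\<Gamma>: "i \<in> idx M \<Longrightarrow> smooth_on (coord_dom M i) (\<lambda>x. \<Gamma> i x v w)"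
  and \<Gamma>_trans: "i \<in> idx M \<Longrightarrow> j \<in> idx M \<Longrightarrow> x \<in> overlap M i j \<Longrightarrow>
    dtrans M i j x (\<Gamma> i x v w) = D (\<lambda>y. dtrans M i j y w) x v +
      \<Gamma> j (transition M i j x) (dtrans M i j x v) (dtrans M i j x w)"
  using conn unfolding connection_def by blast+

lemma lin\<Gamma>1: "i \<in> idx M \<Longrightarrow> x \<in> coord_dom M i \<Longrightarrow> linear (\<lambda>v. \<Gamma> i x v w)"
  and lin\<Gamma>2: "i \<in> idx M \<Longrightarrow> x \<in> coord_dom M i \<Longrightarrow> linear (\<Gamma> i x v)"
  using bil\<Gamma> by (auto simp: bilinear_def)

lemma hv_iso_snd_inner:
  "i \<in> idx M \<Longrightarrow> x \<in> coord_dom M i \<Longrightarrow> snd (hv_iso \<Gamma> i (x, a) (v, b)) \<bullet> w = a \<bullet> \<Gamma> i x v w + b \<bullet> w"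
  by (simp add: hv_iso_def horizontal_lift_def inner_add_left covec_inner linear_inner_comp lin\<Gamma>2)

lemma hv_inv_snd_inner:
  "i \<in> idx M \<Longrightarrow> x \<in> coord_dom M i \<Longrightarrow> snd (hv_inv \<Gamma> i (x, a) (v, c)) \<bullet> w = c \<bullet> w - a \<bullet> \<Gamma> i x v w"
  by (simp add: hv_inv_def inner_diff_left covec_inner linear_inner_comp lin\<Gamma>2)

lemma linear_covec\<Gamma>:
  "i \<in> idx M \<Longrightarrow> x \<in> coord_dom M i \<Longrightarrow> linear (\<lambda>v. covec (\<lambda>w. a \<bullet> \<Gamma> i x v w))"
  by (intro linear_covec linear_inner_comp lin\<Gamma>1)

lemma linear_hv_iso: "i \<in> idx M \<Longrightarrow> fst z \<in> coord_dom M i \<Longrightarrow> linear (hv_iso \<Gamma> i z)"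
  using linear_covec\<Gamma>[of i "fst z" "snd z"]
  by (auto simp: linear_iff hv_iso_def horizontal_lift_def scaleR_right_distrib)

lemma linear_hv_inv: "i \<in> idx M \<Longrightarrow> fst z \<in> coord_dom M i \<Longrightarrow> linear (hv_inv \<Gamma> i z)"
  using linear_covec\<Gamma>[of i "fst z" "snd z"]
  by (auto simp: linear_iff hv_inv_def scaleR_right_diff_distrib)

lemma open_N: "i \<in> idx M \<Longrightarrow> open (coord_dom M i \<times> (UNIV::'e set))"
  by (simp add: open_Times open_coord_dom)

lemma smooth_fst_comp:
  assumes "i \<in> idx M" "smooth_on (coord_dom M i) f"
  shows "smooth_on (coord_dom M i \<times> (UNIV::'e set)) (\<lambda>z. f (fst z))"
  by (rule smooth_on_compose[OF open_N open_coord_dom assms(2) smooth_on_fst[OF open_N smooth_on_id[OF open_N]]])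
    (use assms in auto)

lemma smooth_covec\<Gamma>:
  "i \<in> idx M \<Longrightarrow> smooth_on (coord_dom M i \<times> UNIV) (\<lambda>z. covec (\<lambda>w. snd z \<bullet> \<Gamma> i (fst z) v w))"
  by (intro smooth_on_covec smooth_on_inner open_N smooth_on_snd smooth_on_id smooth_fst_comp smooth\<Gamma>)

lemma smooth_hv_iso: "i \<in> idx M \<Longrightarrow> smooth_on (coord_dom M i \<times> UNIV) (\<lambda>z. hv_iso \<Gamma> i z Z)"
  unfolding hv_iso_def horizontal_lift_def case_prod_unfold
  by (simp, intro smooth_on_Pair smooth_on_add open_N smooth_covec\<Gamma> smooth_on_const)

lemma smooth_hv_inv: "i \<in> idx M \<Longrightarrow> smooth_on (coord_dom M i \<times> UNIV) (\<lambda>z. hv_inv \<Gamma> i z Z)"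
  unfolding hv_inv_def case_prod_unfold
  by (intro smooth_on_Pair smooth_on_diff open_N smooth_covec\<Gamma> smooth_on_const)

text \<open>\<open>cotrans\<close> and \<open>tcotrans\<close> are the transition maps of T*M and of
  the sum of TM and T*M, over the coordinate \<open>x\<close> of the base point.\<close>

definition cotrans :: "'i \<Rightarrow> 'i \<Rightarrow> 'e \<Rightarrow> 'e \<Rightarrow> 'e" where
  "cotrans i j x b = covec (\<lambda>w. b \<bullet> dtrans M j i (transition M i j x) w)"

definition tcotrans :: "'i \<Rightarrow> 'i \<Rightarrow> 'e \<Rightarrow> 'e \<times> 'e \<Rightarrow> 'e \<times> 'e" where
  "tcotrans i j x = (\<lambda>(v, b). (dtrans M i j x v, cotrans i j x b))"

lemma cotrans_inner:
  assumes "i \<in> idx M" "j \<in> idx M" "x \<in> overlap M i j"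
  shows "cotrans i j x b \<bullet> dtrans M i j x w = b \<bullet> w"
  using assms
  by (simp add: cotrans_def covec_inner linear_inner_comp linear_dtrans transition_overlap dtrans_inverse)

lemma covector_eqI:
  assumes "i \<in> idx M" "j \<in> idx M" "x \<in> overlap M i j" "\<And>w. a \<bullet> dtrans M i j x w = b \<bullet> dtrans M i j x w"
  shows "a = b"
  by (rule inner_eqI) (metis assms(4) dtrans_inverse'[OF assms(1-3)])

text \<open>The second derivative of the transition map in \<open>D_transition_N\<close> cancels the
  inhomogeneous term in the transformation rule of the Christoffel maps, so the splitting does not
  depend on the chart.\<close>

lemma hv_iso_trans:
  assumes i: "i \<in> idx M" "j \<in> idx M" and z: "z \<in> overlap N i j"
  shows "dtrans N i j z (hv_iso \<Gamma> i z Y) = hv_iso \<Gamma> j (transition N i j z) (tcotrans i j (fst z) Y)"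
proof -
  obtain x a v b where e: "z = (x, a)" "Y = (v, b)" by (metis prod.collapse)
  have x: "x \<in> overlap M i j" using z e by (simp add: overlap_N[OF i(1)])
  then have xi: "x \<in> coord_dom M i" and xj: "transition M i j x \<in> coord_dom M j"
    using overlap_subset transition_coord_dom[OF i(1)] by auto
  let ?b = "snd (transition N i j (x, a))"
  let ?t = "transition N i j (x, a)"
  have t: "?t = (transition M i j x, ?b)" using D_transition_N(4)[OF i x, of a] by (simp add: prod_eq_iff)
  have h: "hv_iso \<Gamma> i (x, a) (v, b) = (v, snd (hv_iso \<Gamma> i (x, a) (v, b)))" by (simp add: prod_eq_iff)
  have "snd (dtrans N i j (x, a) (hv_iso \<Gamma> i (x, a) (v, b))) =
      snd (hv_iso \<Gamma> j (transition M i j x, ?b) (dtrans M i j x v, cotrans i j x b))"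
  proof (rule covector_eqI[OF i x])
    fix w
    have "snd (dtrans N i j (x, a) (hv_iso \<Gamma> i (x, a) (v, b))) \<bullet> dtrans M i j x w =
        a \<bullet> \<Gamma> i x v w + b \<bullet> w - ?b \<bullet> D (\<lambda>y. dtrans M i j y w) x v"
      by (subst h) (simp only: D_transition_N(2)[OF i x] hv_iso_snd_inner[OF i(1) xi])
    also have "a \<bullet> \<Gamma> i x v w = ?b \<bullet> dtrans M i j x (\<Gamma> i x v w)" by (simp only: D_transition_N(3)[OF i x])
    also have "\<dots> + b \<bullet> w - ?b \<bullet> D (\<lambda>y. dtrans M i j y w) x v =
        snd (hv_iso \<Gamma> j (transition M i j x, ?b) (dtrans M i j x v, cotrans i j x b)) \<bullet> dtrans M i j x w"
      by (simp only: \<Gamma>_trans[OF i x] hv_iso_snd_inner[OF i(2) xj] cotrans_inner[OF i x])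
        (simp add: inner_add_right)
    finally show "snd (dtrans N i j (x, a) (hv_iso \<Gamma> i (x, a) (v, b))) \<bullet> dtrans M i j x w =
      snd (hv_iso \<Gamma> j (transition M i j x, ?b) (dtrans M i j x v, cotrans i j x b)) \<bullet> dtrans M i j x w" .
  qed
  moreover have "fst (dtrans N i j (x, a) (hv_iso \<Gamma> i (x, a) (v, b))) = dtrans M i j x v"
    by (subst h) (simp only: D_transition_N(1)[OF i x])
  ultimately show ?thesis
    unfolding e by (subst t) (simp add: prod_eq_iff tcotrans_def)
qed

lemma hv_inv_trans:
  assumes i: "i \<in> idx M" "j \<in> idx M" and z: "z \<in> overlap N i j"
  shows "hv_inv \<Gamma> j (transition N i j z) (dtrans N i j z Z) = tcotrans i j (fst z) (hv_inv \<Gamma> i z Z)"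
  using hv_iso_trans[OF assms, of "hv_inv \<Gamma> i z Z"] by simp

lemma fst_transition_N:
  "i \<in> idx M \<Longrightarrow> j \<in> idx M \<Longrightarrow> z \<in> overlap N i j \<Longrightarrow> fst (transition N i j z) = transition M i j (fst z)"
  using D_transition_N(4)[of i j "fst z" "snd z"] by (simp add: overlap_N mem_Times_iff)

text \<open>Smooth endomorphism fields of the sum of TM and T*M. They are not covered by
  \<open>endo_field\<close>, since the base is modelled on \<open>'e\<close> and the fibre is
  \<open>'e \<times> 'e\<close>.\<close>

definition tcot_endo :: "('i \<Rightarrow> 'e \<Rightarrow> 'e \<times> 'e \<Rightarrow> 'e \<times> 'e) \<Rightarrow> bool" where
  "tcot_endo P \<longleftrightarrow> (\<forall>i\<in>idx M. (\<forall>x\<in>coord_dom M i. linear (P i x)) \<and>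
     (\<forall>Y. smooth_on (coord_dom M i) (\<lambda>x. P i x Y)) \<and>
     (\<forall>j\<in>idx M. \<forall>x\<in>overlap M i j. \<forall>Y. P j (transition M i j x) (tcotrans i j x Y) = tcotrans i j x (P i x Y)))"

lemma tcot_endoD:
  assumes "tcot_endo P" "i \<in> idx M"
  shows "x \<in> coord_dom M i \<Longrightarrow> linear (P i x)" "smooth_on (coord_dom M i) (\<lambda>x. P i x Y)"
    "j \<in> idx M \<Longrightarrow> x \<in> overlap M i j \<Longrightarrow> P j (transition M i j x) (tcotrans i j x Y) = tcotrans i j x (P i x Y)"
  using assms unfolding tcot_endo_def by blast+

lemma endo_field_hv_endo:
  assumes P: "tcot_endo P"
  shows "endo_field N (hv_endo \<Gamma> P)"
  unfolding endo_field_def idx_N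
proof (intro ballI conjI allI)
  fix i assume i: "i \<in> idx M"
  show "linear (hv_endo \<Gamma> P i z)" if "z \<in> coord_dom N i" for z
  proof -
    have z: "fst z \<in> coord_dom M i" using that by (auto simp: coord_dom_N[OF i])
    then have "linear (P i (fst z))" by (rule tcot_endoD(1)[OF P i])
    from linear_compose[OF linear_compose[OF linear_hv_inv[OF i z] this] linear_hv_iso[OF i z]]
    show ?thesis by (simp add: hv_endo_eq[abs_def] o_def)
  qed
  show "smooth_on (coord_dom N i) (\<lambda>z. hv_endo \<Gamma> P i z Z)" for Z
    unfolding hv_endo_eq coord_dom_N[OF i]
  proof (rule smooth_on_linear_apply[where A="hv_iso \<Gamma> i", OF open_N[OF i]])
    show "smooth_on (coord_dom M i \<times> UNIV) (\<lambda>z. P i (fst z) (hv_inv \<Gamma> i z Z))"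
      by (rule smooth_on_linear_apply[where A="\<lambda>z. P i (fst z)", OF open_N[OF i]])
        (use i tcot_endoD(1)[OF P i] in \<open>auto intro: smooth_hv_inv smooth_fst_comp tcot_endoD(2)[OF P i]\<close>)
  qed (use i linear_hv_iso smooth_hv_iso in auto)
  fix j z Z assume j: "j \<in> idx M" and z: "z \<in> overlap N i j"
  then have "fst z \<in> overlap M i j" by (auto simp: overlap_N[OF i])
  then have "P j (transition M i j (fst z)) (tcotrans i j (fst z) Y) = tcotrans i j (fst z) (P i (fst z) Y)" for Y
    using P i j unfolding tcot_endo_def by blast
  then show "hv_endo \<Gamma> P j (transition N i j z) (dtrans N i j z Z) = dtrans N i j z (hv_endo \<Gamma> P i z Z)"
    by (simp add: hv_endo_eq hv_iso_trans[OF i j z] hv_inv_trans[OF i j z] fst_transition_N[OF i j z])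
qed

lemma tcot_endo_comp:
  assumes P: "tcot_endo P" and Q: "tcot_endo Q"
  shows "tcot_endo (\<lambda>i x Y. P i x (Q i x Y))"
  unfolding tcot_endo_def
proof (intro ballI conjI allI)
  fix i assume i: "i \<in> idx M"
  show "linear (\<lambda>Y. P i x (Q i x Y))" if "x \<in> coord_dom M i" for x
    using linear_compose[OF tcot_endoD(1)[OF Q i that] tcot_endoD(1)[OF P i that]] by (simp add: o_def)
  show "smooth_on (coord_dom M i) (\<lambda>x. P i x (Q i x Y))" for Y
    by (rule smooth_on_linear_apply[where A="P i", OF open_coord_dom[OF i] tcot_endoD(1)[OF P i]])
      (auto intro: tcot_endoD(2)[OF P i] tcot_endoD(2)[OF Q i])
  show "P j (transition M i j x) (Q j (transition M i j x) (tcotrans i j x Y)) = tcotrans i j x (P i x (Q i x Y))"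
    if "j \<in> idx M" "x \<in> overlap M i j" for j x Y
    by (simp only: tcot_endoD(3)[OF P i that] tcot_endoD(3)[OF Q i that])
qed

lemma almost_complex_hv_endo:
  assumes "tcot_endo P" "\<And>i x Y. i \<in> idx M \<Longrightarrow> x \<in> coord_dom M i \<Longrightarrow> P i x (P i x Y) = - Y"
  shows "almost_complex N (hv_endo \<Gamma> P)"
  unfolding almost_complex_def
proof (intro conjI ballI allI smooth_manifold_N endo_field_hv_endo assms(1))
  fix i z Z assume "i \<in> idx N" "z \<in> coord_dom N i"
  then have i: "i \<in> idx M" "fst z \<in> coord_dom M i" by (auto simp: idx_N coord_dom_N)
  then show "hv_endo \<Gamma> P i z (hv_endo \<Gamma> P i z Z) = - Z"
    by (simp add: hv_endo_eq assms(2) linear_neg[OF linear_hv_iso])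
qed

lemma bilin_field_hv_bilin:
  assumes bil: "\<And>i x. i \<in> idx M \<Longrightarrow> x \<in> coord_dom M i \<Longrightarrow> bilinear (Q i x)"
    and smooth: "\<And>i Y Y'. i \<in> idx M \<Longrightarrow> smooth_on (coord_dom M i) (\<lambda>x. Q i x Y Y')"
    and nat: "\<And>i j x Y Y'. i \<in> idx M \<Longrightarrow> j \<in> idx M \<Longrightarrow> x \<in> overlap M i j \<Longrightarrow>
      Q j (transition M i j x) (tcotrans i j x Y) (tcotrans i j x Y') = Q i x Y Y'"
  shows "bilin_field N (hv_bilin \<Gamma> Q)"
  unfolding bilin_field_def idx_N
proof (intro ballI conjI allI)
  fix i assume i: "i \<in> idx M"
  show "bilinear (hv_bilin \<Gamma> Q i z)" if "z \<in> coord_dom N i" for z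
  proof -
    have z: "fst z \<in> coord_dom M i" using that by (auto simp: coord_dom_N[OF i])
    have "linear (Q i (fst z) Y)" "linear (\<lambda>Y. Q i (fst z) Y Y')" for Y Y'
      using bil[OF i z] unfolding bilinear_def by blast+
    from linear_compose[OF linear_hv_inv[OF i z] this(1)] linear_compose[OF linear_hv_inv[OF i z] this(2)]
    show ?thesis by (simp add: bilinear_def hv_bilin_eq[abs_def] o_def)
  qed
  show "smooth_on (coord_dom N i) (\<lambda>z. hv_bilin \<Gamma> Q i z Z W)" for Z W
    unfolding hv_bilin_eq coord_dom_N[OF i]
    by (rule smooth_on_bilinear_apply[where A="\<lambda>z. Q i (fst z)", OF open_N[OF i]])
      (use i bil in \<open>auto intro: smooth_hv_inv smooth_fst_comp smooth\<close>)
  fix j z Z W assume j: "j \<in> idx M" and z: "z \<in> overlap N i j"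
  then have "fst z \<in> overlap M i j" by (auto simp: overlap_N[OF i])
  then show "hv_bilin \<Gamma> Q j (transition N i j z) (dtrans N i j z Z) (dtrans N i j z W) = hv_bilin \<Gamma> Q i z Z W"
    by (simp add: hv_bilin_eq hv_inv_trans[OF i j z] fst_transition_N[OF i j z] nat[OF i j])
qed

end

section \<open>Pairings and the structures they induce on the cotangent bundle\<close>

lemma flat_map_inner: "bilinear b \<Longrightarrow> flat_map b v \<bullet> w = b v w"
  by (simp add: flat_map_def covec_inner bilinear_def)

lemma linear_flat_map: "bilinear b \<Longrightarrow> linear (flat_map b)"
  unfolding flat_map_def by (rule linear_covec) (simp add: bilinear_def)

lemma inj_flat_map:
  assumes "bilinear b" "\<And>v. (\<forall>w. b v w = 0) \<Longrightarrow> v = 0"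
  shows "inj (flat_map b)"
  using assms linear_injective_0[OF linear_flat_map[OF assms(1)]] flat_map_inner[OF assms(1)]
  by (metis inner_zero_left)

lemma dual_endo_inner: "linear j \<Longrightarrow> dual_endo j a \<bullet> v = a \<bullet> j v"
  by (simp add: dual_endo_def covec_inner linear_inner_comp)

lemma linear_dual_endo: "linear (dual_endo j)"
  unfolding dual_endo_def by (rule linear_covec) (simp add: linear_iff inner_add_left)

text \<open>Stated without a symmetry condition, so that the alternating form \<rho> and the
  symmetric forms g and \<sigma> are all instances.\<close>

locale pairing =
  fixes \<rho> :: "'e::euclidean_space \<Rightarrow> 'e \<Rightarrow> real"
  assumes bil: "bilinear \<rho>" and nd: "\<And>v. (\<forall>w. \<rho> v w = 0) \<Longrightarrow> v = 0"
begin

abbreviation "R \<equiv> flat_map \<rho>"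
abbreviation "R' \<equiv> inv (flat_map \<rho>)"

lemma R_inner: "R v \<bullet> w = \<rho> v w" by (rule flat_map_inner[OF bil])
lemma linR: "linear R" by (rule linear_flat_map[OF bil])
lemma injR: "inj R" by (rule inj_flat_map[OF bil nd])
lemma RR' [simp]: "R (R' a) = a" by (rule linear_inj_bij(3)[OF linR injR])
lemma R'R [simp]: "R' (R v) = v" by (rule linear_inj_bij(4)[OF linR injR])
lemma linR': "linear R'" by (rule linear_inj_bij(2)[OF linR injR])
lemma rho_R': "\<rho> (R' a) w = a \<bullet> w" using R_inner[of "R' a"] by simp

lemmas lin_simps = linear_neg[OF linR] linear_neg[OF linR'] linear_add[OF linR] linear_add[OF linR']
  linear_cmul[OF linR] linear_cmul[OF linR']

end

definition J_nabla_hv :: "('i, 'e::euclidean_space) endo \<Rightarrow> 'i \<Rightarrow> 'e \<Rightarrow> 'e \<times> 'e \<Rightarrow> 'e \<times> 'e" where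
  "J_nabla_hv J = (\<lambda>i x (v, a). (J i x v, dual_endo (J i x) a))"

definition J_bilin_hv :: "('i, 'e::euclidean_space, real) bilin \<Rightarrow> 'i \<Rightarrow> 'e \<Rightarrow> 'e \<times> 'e \<Rightarrow> 'e \<times> 'e" where
  "J_bilin_hv \<rho> = (\<lambda>i x (v, a). (- inv (flat_map (\<rho> i x)) a, flat_map (\<rho> i x) v))"

lemma J_nabla_eq: "J_nabla \<Gamma> J = hv_endo \<Gamma> (J_nabla_hv J)"
  by (simp add: J_nabla_def J_nabla_hv_def)

lemma J_bilin_eq: "J_bilin \<Gamma> \<rho> = hv_endo \<Gamma> (J_bilin_hv \<rho>)"
  by (simp add: J_bilin_def J_bilin_hv_def)

lemma bilin_fieldD:
  assumes "bilin_field M b" "i \<in> idx M"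
  shows "x \<in> coord_dom M i \<Longrightarrow> bilinear (b i x)" "smooth_on (coord_dom M i) (\<lambda>x. b i x v w)"
    "j \<in> idx M \<Longrightarrow> x \<in> overlap M i j \<Longrightarrow>
      b j (transition M i j x) (dtrans M i j x v) (dtrans M i j x w) = b i x v w"
  using assms unfolding bilin_field_def by blast+

lemma endo_fieldD:
  assumes "endo_field M A" "i \<in> idx M"
  shows "x \<in> coord_dom M i \<Longrightarrow> linear (A i x)" "smooth_on (coord_dom M i) (\<lambda>x. A i x v)"
    "j \<in> idx M \<Longrightarrow> x \<in> overlap M i j \<Longrightarrow> A j (transition M i j x) (dtrans M i j x v) = dtrans M i j x (A i x v)"
  using assms unfolding endo_field_def by blast+

lemma pairing_field:
  assumes "bilin_field M b" "nondegenerate M b" "i \<in> idx M" "x \<in> coord_dom M i"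
  shows "pairing (b i x)"
proof
  show "bilinear (b i x)" by (rule bilin_fieldD(1)[OF assms(1,3,4)])
  show "v = 0" if "\<forall>w. b i x v w = 0" for v using assms(2-4) that unfolding nondegenerate_def by blast
qed

context mfd_connection begin

lemma flat_map_trans:
  assumes b: "bilin_field M b" and i: "i \<in> idx M" "j \<in> idx M" and x: "x \<in> overlap M i j"
  shows "flat_map (b j (transition M i j x)) (dtrans M i j x v) = cotrans i j x (flat_map (b i x) v)"
proof (rule covector_eqI[OF i x])
  have "x \<in> coord_dom M i" "transition M i j x \<in> coord_dom M j"
    using x overlap_subset transition_coord_dom[OF i(1)] by auto
  then show "flat_map (b j (transition M i j x)) (dtrans M i j x v) \<bullet> dtrans M i j x w =
    cotrans i j x (flat_map (b i x) v) \<bullet> dtrans M i j x w" for w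
    using bilin_fieldD[OF b i(1)] bilin_fieldD[OF b i(2)] i x
    by (simp add: flat_map_inner cotrans_inner)
qed

lemma inv_flat_map_trans:
  assumes b: "bilin_field M b" "nondegenerate M b" and i: "i \<in> idx M" "j \<in> idx M" and x: "x \<in> overlap M i j"
  shows "inv (flat_map (b j (transition M i j x))) (cotrans i j x a) = dtrans M i j x (inv (flat_map (b i x)) a)"
proof -
  have "x \<in> coord_dom M i" "transition M i j x \<in> coord_dom M j"
    using x overlap_subset transition_coord_dom[OF i(1)] by auto
  then interpret pi: pairing "b i x" + pj: pairing "b j (transition M i j x)"
    using pairing_field[OF b] i by auto
  show ?thesis using flat_map_trans[OF b(1) i x, of "pi.R' a"] pj.R'R by (metis pi.RR')
qed

lemma smooth_flat_map: "bilin_field M b \<Longrightarrow> i \<in> idx M \<Longrightarrow> smooth_on (coord_dom M i) (\<lambda>x. flat_map (b i x) v)"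
  unfolding flat_map_def by (intro smooth_on_covec open_coord_dom bilin_fieldD(2))

lemma smooth_inv_flat_map:
  assumes "bilin_field M b" "nondegenerate M b" "i \<in> idx M"
  shows "smooth_on (coord_dom M i) (\<lambda>x. inv (flat_map (b i x)) a)"
  by (rule smooth_on_linear_inv)
    (use assms pairing.linR[OF pairing_field] pairing.injR[OF pairing_field] smooth_flat_map open_coord_dom in auto)

lemma tcot_endo_J_bilin:
  assumes b: "bilin_field M b" "nondegenerate M b"
  shows "tcot_endo (J_bilin_hv b)"
  unfolding tcot_endo_def
proof (intro ballI conjI allI)
  fix i assume i: "i \<in> idx M"
  show "linear (J_bilin_hv b i x)" if "x \<in> coord_dom M i" for x
  proof -
    interpret pairing "b i x" by (rule pairing_field[OF b i that])
    show ?thesis by (auto simp: linear_iff J_bilin_hv_def lin_simps)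
  qed
  show "smooth_on (coord_dom M i) (\<lambda>x. J_bilin_hv b i x Y)" for Y
    unfolding J_bilin_hv_def case_prod_unfold
    by (intro smooth_on_Pair smooth_on_minus smooth_flat_map smooth_inv_flat_map open_coord_dom i b)
  show "J_bilin_hv b j (transition M i j x) (tcotrans i j x Y) = tcotrans i j x (J_bilin_hv b i x Y)"
    if j: "j \<in> idx M" and x: "x \<in> overlap M i j" for j x Y
    by (simp add: J_bilin_hv_def tcotrans_def flat_map_trans[OF b(1) i j x] inv_flat_map_trans[OF b i j x]
        linear_neg[OF linear_dtrans[OF i j x]] split: prod.split)
qed

lemma tcot_endo_J_nabla:
  assumes J: "endo_field M J"
  shows "tcot_endo (J_nabla_hv J)"
  unfolding tcot_endo_def
proof (intro ballI conjI allI)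
  fix i assume i: "i \<in> idx M"
  show "linear (J_nabla_hv J i x)" if "x \<in> coord_dom M i" for x
    using endo_fieldD(1)[OF J i that] linear_dual_endo[of "J i x"] by (auto simp: linear_iff J_nabla_hv_def)
  show "smooth_on (coord_dom M i) (\<lambda>x. J_nabla_hv J i x Y)" for Y
    unfolding J_nabla_hv_def case_prod_unfold dual_endo_def
    by (intro smooth_on_Pair smooth_on_covec smooth_on_inner smooth_on_const open_coord_dom i endo_fieldD(2)[OF J])
  show "J_nabla_hv J j (transition M i j x) (tcotrans i j x Y) = tcotrans i j x (J_nabla_hv J i x Y)"
    if j: "j \<in> idx M" and x: "x \<in> overlap M i j" for j x Y
  proof -
    have c: "x \<in> coord_dom M i" "transition M i j x \<in> coord_dom M j"
      using x overlap_subset transition_coord_dom[OF i] by auto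
    have "dual_endo (J j (transition M i j x)) (cotrans i j x a) = cotrans i j x (dual_endo (J i x) a)" for a
      by (rule covector_eqI[OF i j x])
        (simp only: dual_endo_inner[OF endo_fieldD(1)[OF J j c(2)]] dual_endo_inner[OF endo_fieldD(1)[OF J i c(1)]]
          cotrans_inner[OF i j x] endo_fieldD(3)[OF J i j x])
    then show ?thesis
      by (simp add: J_nabla_hv_def tcotrans_def endo_fieldD(3)[OF J i j x] split: prod.split)
  qed
qed

lemma J_nabla_hv_square:
  assumes "almost_complex M J" "i \<in> idx M" "x \<in> coord_dom M i"
  shows "J_nabla_hv J i x (J_nabla_hv J i x Y) = - Y"
proof -
  note J = almost_complexD(1,3)[OF assms]
  have "dual_endo (J i x) (dual_endo (J i x) a) = - a" for a
    by (rule inner_eqI) (simp add: dual_endo_inner J)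
  then show ?thesis by (simp add: J_nabla_hv_def J split: prod.split)
qed

lemma J_bilin_hv_square:
  assumes "bilin_field M b" "nondegenerate M b" "i \<in> idx M" "x \<in> coord_dom M i"
  shows "J_bilin_hv b i x (J_bilin_hv b i x Y) = - Y"
proof -
  interpret pairing "b i x" by (rule pairing_field[OF assms])
  show ?thesis by (simp add: J_bilin_hv_def lin_simps split: prod.split)
qed

lemma almost_complex_J_nabla: "almost_complex M J \<Longrightarrow> almost_complex N (J_nabla \<Gamma> J)"
  unfolding J_nabla_eq
  by (rule almost_complex_hv_endo[OF tcot_endo_J_nabla J_nabla_hv_square]) (auto simp: almost_complex_def)

lemma almost_complex_J_bilin:
  "bilin_field M b \<Longrightarrow> nondegenerate M b \<Longrightarrow> almost_complex N (J_bilin \<Gamma> b)"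
  unfolding J_bilin_eq by (rule almost_complex_hv_endo[OF tcot_endo_J_bilin J_bilin_hv_square])

lemma bilin_field_diag_metric:
  assumes g: "bilin_field M g" "nondegenerate M g"
  shows "bilin_field N (diag_metric \<Gamma> g)"
  unfolding diag_metric_def
proof (rule bilin_field_hv_bilin)
  fix i assume i: "i \<in> idx M"
  show "bilinear (\<lambda>(v, a) (w, b). g i x v w + inverse_metric (g i x) a b)" if "x \<in> coord_dom M i" for x
  proof -
    interpret pairing "g i x" by (rule pairing_field[OF g i that])
    show ?thesis
      unfolding bilinear_def linear_iff inverse_metric_def case_prod_unfold
      by (simp add: lin_simps bilinear_ladd[OF bil] bilinear_radd[OF bil] bilinear_lmul[OF bil] bilinear_rmul[OF bil]
          distrib_left)
  qed
  show "smooth_on (coord_dom M i) (\<lambda>x. (\<lambda>(v, a) (w, b). g i x v w + inverse_metric (g i x) a b) Y Y')" for Y Y'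
    unfolding inverse_metric_def case_prod_unfold
    by (intro smooth_on_add open_coord_dom i bilin_fieldD(2)[OF g(1)] smooth_on_bilinear_apply[where A="g i"]
        bilin_fieldD(1)[OF g(1)] smooth_inv_flat_map[OF g])
  fix j x Y Y' assume j: "j \<in> idx M" and x: "x \<in> overlap M i j"
  show "(\<lambda>(v, a) (w, b). g j (transition M i j x) v w + inverse_metric (g j (transition M i j x)) a b) (tcotrans i j x Y) (tcotrans i j x Y')
    = (\<lambda>(v, a) (w, b). g i x v w + inverse_metric (g i x) a b) Y Y'"
    by (simp add: tcotrans_def inverse_metric_def inv_flat_map_trans[OF g i j x] bilin_fieldD(3)[OF g(1) i j x]
        split: prod.split)
qed

end

section \<open>Parallel frames and integrability of \<open>J\<^sup>\<rho>\<close>\<close>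

lemma has_derivative_covec:
  assumes "\<And>k. ((\<lambda>z. f z k) has_derivative f' k) F"
  shows "((\<lambda>z. covec (f z)) has_derivative (\<lambda>Z. covec (\<lambda>k. f' k Z))) F"
  unfolding covec_def by (intro has_derivative_sum has_derivative_scaleR_left assms)

text \<open>For a torsion-free \<nabla> this is d^\<nabla> b = 0 for the one-form v \<mapsto> b(v,
  .) with values in T*M.\<close>

definition codazzi :: "('i, 'm, 'e::euclidean_space) atlas \<Rightarrow> ('i, 'e, 'e) bilin \<Rightarrow> ('i, 'e, real) bilin \<Rightarrow> bool" where
  "codazzi M \<Gamma> b \<longleftrightarrow> (\<forall>i\<in>idx M. \<forall>x\<in>coord_dom M i. \<forall>u v w.
     cov_bilin \<Gamma> b i x u v w = cov_bilin \<Gamma> b i x v u w)"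

text \<open>For a closed \<open>\<theta>\<close> with \<open>\<theta> \<circ> J = \<eta>\<close>, the vanishing of the Nijenhuis tensor of \<open>J\<close> makes
  \<open>d\<eta>\<close> invariant under \<open>J\<close>.\<close>

lemma nijenhuis_pairing:
  fixes J :: "'n::euclidean_space \<Rightarrow> 'n \<Rightarrow> 'n" and \<theta> \<eta> :: "'n \<Rightarrow> 'n \<Rightarrow> real"
  assumes S: "open S" "z \<in> S"
    and lin: "\<And>y. y \<in> S \<Longrightarrow> linear (\<theta> y)" "\<And>y. y \<in> S \<Longrightarrow> linear (\<eta> y)"
    and sm: "\<And>Y. smooth_on S (\<lambda>y. J y Y)" "\<And>Y. smooth_on S (\<lambda>y. \<theta> y Y)" "\<And>Y. smooth_on S (\<lambda>y. \<eta> y Y)"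
    and \<eta>J: "\<And>y Y. y \<in> S \<Longrightarrow> \<eta> y (J y Y) = - \<theta> y Y" and \<theta>J: "\<And>y Y. y \<in> S \<Longrightarrow> \<theta> y (J y Y) = \<eta> y Y"
    and closed: "\<And>X Y. D (\<lambda>y. \<theta> y Y) z X = D (\<lambda>y. \<theta> y X) z Y"
    and nij: "D (\<lambda>y. J y Y) z (J z X) - D (\<lambda>y. J y X) z (J z Y) =
      J z (D (\<lambda>y. J y Y) z X - D (\<lambda>y. J y X) z Y)"
  shows "D (\<lambda>y. \<eta> y Y) z X - D (\<lambda>y. \<eta> y X) z Y =
    D (\<lambda>y. \<eta> y (J z Y)) z (J z X) - D (\<lambda>y. \<eta> y (J z X)) z (J z Y)"
proof -
  let ?dJ = "\<lambda>X Y. D (\<lambda>y. J y Y) z X"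
  have neg: "D (\<lambda>y. - \<theta> y Y) z X = - D (\<lambda>y. \<theta> y Y) z X" for X Y
    using D_eqI[OF has_derivative_minus[OF smooth_on_has_derivative[OF sm(2) S(2)]]] by simp
  \<comment> \<open>Differentiating \<open>\<eta> (J Y) = - \<theta> Y\<close> and
    \<open>\<theta> (J Y) = \<eta> Y\<close> for constant \<open>Y\<close> computes both pairings
    with the derivative of \<open>J\<close>; \<open>nij\<close> then compares them.\<close>
  have e: "\<eta> z (?dJ X Y) = - D (\<lambda>y. \<theta> y Y) z X - D (\<lambda>y. \<eta> y (J z Y)) z X" for X Y
    using smooth_on_D_linear_apply[OF S lin(2) sm(3) sm(1), of Y X]
      D_cong_open[OF S, of "\<lambda>y. \<eta> y (J y Y)" "\<lambda>y. - \<theta> y Y"] \<eta>J neg[of Y X] by simp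
  have t: "\<theta> z (?dJ X Y) = D (\<lambda>y. \<eta> y Y) z X - D (\<lambda>y. \<theta> y (J z Y)) z X" for X Y
    using smooth_on_D_linear_apply[OF S lin(1) sm(2) sm(1), of Y X]
      D_cong_open[OF S, of "\<lambda>y. \<theta> y (J y Y)" "\<lambda>y. \<eta> y Y"] \<theta>J by simp
  have "\<eta> z (?dJ (J z X) Y - ?dJ (J z Y) X) = - \<theta> z (?dJ X Y - ?dJ Y X)"
    unfolding nij \<eta>J[OF S(2)] by simp
  then show ?thesis
    by (simp add: linear_diff[OF lin(1)[OF S(2)]] linear_diff[OF lin(2)[OF S(2)]] e t closed[of "J z X" Y] closed[of X "J z Y"])
qed

locale flat_connection = mfd_connection +
  assumes flat: "flat M \<Gamma>" and tf: "torsion_free M \<Gamma>"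
begin

lemma torsion_free': "i \<in> idx M \<Longrightarrow> x \<in> coord_dom M i \<Longrightarrow> \<Gamma> i x v w = \<Gamma> i x w v"
  using tf unfolding torsion_free_def by blast

lemma D_bilin:
  assumes b: "bilin_field M b" and i: "i \<in> idx M" "x \<in> coord_dom M i"
  shows "((\<lambda>y. b i y v w) has_derivative D (\<lambda>y. b i y v w) x) (at x)"
  by (rule smooth_on_has_derivative[OF bilin_fieldD(2)[OF b i(1)] i(2)])

text \<open>One flat system for pairs (w, s) with \<nabla>w = 0 and ds = b(., w): its integrability
  condition is flatness of \<Gamma> in the first component and the Codazzi condition in the second.
  The solutions starting at (e, 0), for basis vectors e, form the columns of \<open>E\<close> and
  the components of \<beta>.\<close>

lemma parallel_frame:
  assumes b: "bilin_field M b" and cod: "codazzi M \<Gamma> b" and i: "i \<in> idx M" and x0: "x0 \<in> coord_dom M i"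
  obtains r E \<beta> where "r > 0" "ball x0 r \<subseteq> coord_dom M i" "\<And>x. linear (E x)" "\<And>k. E x0 k = k"
    "\<And>k. smooth_on (ball x0 r) (\<lambda>x. E x k)" "smooth_on (ball x0 r) \<beta>"
    "\<And>x k. x \<in> ball x0 r \<Longrightarrow> ((\<lambda>x. E x k) has_derivative (\<lambda>v. - \<Gamma> i x v (E x k))) (at x)"
    "\<And>x k v. x \<in> ball x0 r \<Longrightarrow> D \<beta> x v \<bullet> k = b i x v (E x k)"
proof -
  let ?S = "coord_dom M i"
  define A where "A x v w = (- \<Gamma> i x v (fst w), b i x v (fst w))" for x v and w :: "'c \<times> real"
  note bl = bilin_fieldD(1)[OF b i]
  have bil: "bilinear (A x)" if "x \<in> ?S" for x
    using bil\<Gamma>[OF i that] bl[OF that] by (auto simp: A_def bilinear_def linear_iff)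
  have smA: "smooth_on ?S (\<lambda>x. A x v w)" for v w
    unfolding A_def by (intro smooth_on_Pair smooth_on_minus open_coord_dom i smooth\<Gamma> bilin_fieldD(2)[OF b])
  have DA: "D (\<lambda>y. A y v w) x u = (- D (\<lambda>y. \<Gamma> i y v (fst w)) x u, D (\<lambda>y. b i y v (fst w)) x u)" if "x \<in> ?S" for x u v w
    unfolding A_def
    using D_eqI[OF has_derivative_Pair[OF has_derivative_minus[OF smooth_on_has_derivative[OF smooth\<Gamma>[OF i] that]]
          D_bilin[OF b i that]]] by metis
  obtain r F where r: "r > 0" "ball x0 r \<subseteq> ?S" "\<And>c. F c x0 = c" "\<And>c. smooth_on (ball x0 r) (F c)"
    "\<And>c x. x \<in> ball x0 r \<Longrightarrow> (F c has_derivative (\<lambda>v. A x v (F c x))) (at x)"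
  proof (rule flat_system_solution[OF open_coord_dom[OF i] x0 bil smA])
    fix x u v and w :: "'c \<times> real"
    assume x: "x \<in> ?S"
    have "D (\<lambda>y. \<Gamma> i y v (fst w)) x u + \<Gamma> i x u (\<Gamma> i x v (fst w)) =
        D (\<lambda>y. \<Gamma> i y u (fst w)) x v + \<Gamma> i x v (\<Gamma> i x u (fst w))"
      using flat i x unfolding flat_def curvature_def by simp
    moreover have "D (\<lambda>y. b i y v (fst w)) x u - b i x v (\<Gamma> i x u (fst w)) =
        D (\<lambda>y. b i y u (fst w)) x v - b i x u (\<Gamma> i x v (fst w))"
    proof -
      have "cov_bilin \<Gamma> b i x u v (fst w) = cov_bilin \<Gamma> b i x v u (fst w)"
        using cod i x unfolding codazzi_def by blast
      then show ?thesis using torsion_free'[OF i x, of u v] by (simp add: cov_bilin_def)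
    qed
    ultimately show "D (\<lambda>y. A y v w) x u + A x v (A x u w) = D (\<lambda>y. A y u w) x v + A x u (A x v w)"
      unfolding DA[OF x] unfolding A_def
      by (simp add: bilinear_rneg[OF bil\<Gamma>[OF i x]] bilinear_rneg[OF bl[OF x]] algebra_simps)
  qed (assumption, rule that)
  define E where "E x k = (\<Sum>e\<in>Basis. (k \<bullet> e) *\<^sub>R fst (F (e, 0) x))" for x k
  define \<beta> where "\<beta> x = (\<Sum>e\<in>Basis. snd (F (e, 0) x) *\<^sub>R e)" for x
  show thesis
  proof (rule that[OF r(1,2)])
    show "linear (E x)" for x
      unfolding E_def by (intro linear_compose_sum ballI) (simp add: linear_iff inner_add_left scaleR_left_distrib)
    show "E x0 k = k" for k by (simp add: E_def r(3) euclidean_representation)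
    show "smooth_on (ball x0 r) (\<lambda>x. E x k)" for k
      unfolding E_def by (intro smooth_on_sum smooth_on_scaleR smooth_on_const smooth_on_fst open_ball r(4))
    show "smooth_on (ball x0 r) \<beta>"
      unfolding \<beta>_def by (intro smooth_on_sum smooth_on_scaleR smooth_on_const smooth_on_snd open_ball r(4))
    fix x k assume x: "x \<in> ball x0 r"
    then have xS: "x \<in> ?S" using r(2) by blast
    have "((\<lambda>x. E x k) has_derivative (\<lambda>v. \<Sum>e\<in>Basis. (k \<bullet> e) *\<^sub>R fst (A x v (F (e, 0) x)))) (at x)"
      unfolding E_def by (intro has_derivative_sum has_derivative_scaleR_right has_derivative_fst r(5) x)
    also have "(\<lambda>v. \<Sum>e\<in>Basis. (k \<bullet> e) *\<^sub>R fst (A x v (F (e, 0) x))) = (\<lambda>v. - \<Gamma> i x v (E x k))"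
      by (simp add: A_def E_def linear_sum[OF lin\<Gamma>2[OF i xS]] linear_cmul[OF lin\<Gamma>2[OF i xS]] sum_negf fun_eq_iff)
    finally show "((\<lambda>x. E x k) has_derivative (\<lambda>v. - \<Gamma> i x v (E x k))) (at x)" .
    have "(\<beta> has_derivative (\<lambda>v. \<Sum>e\<in>Basis. snd (A x v (F (e, 0) x)) *\<^sub>R e)) (at x)"
      unfolding \<beta>_def by (intro has_derivative_sum has_derivative_scaleR_left has_derivative_snd r(5) x)
    from D_eqI[OF this] show "D \<beta> x v \<bullet> k = b i x v (E x k)" for v
      using bl[OF xS]
      by (simp add: A_def E_def linear_sum[of "b i x v"] linear_cmul[of "b i x v"] bilinear_def inner_sum_left)
        (simp add: inner_commute mult.commute)
  qed
qed

text \<open>With \<open>b = 0\<close>, \<open>parallel_frame\<close> yields a frame where no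
  primitive \<beta> is wanted.\<close>

lemma codazzi_zero: "bilin_field M (\<lambda>_ _ _ _. 0)" "codazzi M \<Gamma> (\<lambda>_ _ _ _. 0)"
  by (auto simp: bilin_field_def codazzi_def cov_bilin_def bilinear_def linear_iff smooth_on_const)

text \<open>\<open>\<Theta>\<close> collects the pairings of a covector with the frame: its
  component along \<open>k\<close> is the value on \<open>E x k\<close>. Since the frame is
  parallel, \<Theta> is constant in horizontal directions.\<close>

lemma fibre_coordinates:
  assumes i: "i \<in> idx M" and r: "ball x0 r \<subseteq> coord_dom M i" and lin: "\<And>x. linear (E x)"
    and sE: "\<And>k. smooth_on (ball x0 r) (\<lambda>x. E x k)"
    and dE: "\<forall>x\<in>ball x0 r. \<forall>k. ((\<lambda>x. E x k) has_derivative (\<lambda>v. - \<Gamma> i x v (E x k))) (at x)"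
  defines "\<Theta> \<equiv> \<lambda>z. dual_endo (E (fst z)) (snd z)"
  shows "smooth_on (ball x0 r \<times> UNIV) \<Theta>"
    "fst z \<in> ball x0 r \<Longrightarrow> D \<Theta> z (hv_iso \<Gamma> i z Y) = dual_endo (E (fst z)) (snd Y)"
proof -
  have o: "open (ball x0 r \<times> (UNIV :: 'c set))" by (simp add: open_Times)
  show "smooth_on (ball x0 r \<times> UNIV) \<Theta>"
    unfolding \<Theta>_def dual_endo_def
  proof (intro smooth_on_covec o smooth_on_inner smooth_on_snd smooth_on_id)
    show "smooth_on (ball x0 r \<times> (UNIV :: 'c set)) (\<lambda>z. E (fst z) k)" for k
      by (rule smooth_on_compose[OF o open_ball sE smooth_on_fst[OF o smooth_on_id[OF o]]]) auto
  qed
  assume x: "fst z \<in> ball x0 r"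
  let ?x = "fst z"
  have xS: "?x \<in> coord_dom M i" using x r by blast
  have "((\<lambda>z. E (fst z) k) has_derivative (\<lambda>Z. - \<Gamma> i ?x (fst Z) (E ?x k))) (at z)" for k
    by (rule has_derivative_compose_at[OF has_derivative_fst[OF has_derivative_ident] dE[rule_format, OF x] refl])
  then have "(\<Theta> has_derivative (\<lambda>Z. covec (\<lambda>k. snd z \<bullet> - \<Gamma> i ?x (fst Z) (E ?x k) + snd Z \<bullet> E ?x k))) (at z)"
    unfolding \<Theta>_def dual_endo_def
    by (intro has_derivative_covec has_derivative_inner has_derivative_snd has_derivative_ident)
  from D_eqI[OF this] have D: "D \<Theta> z Z = covec (\<lambda>k. snd Z \<bullet> E ?x k - snd z \<bullet> \<Gamma> i ?x (fst Z) (E ?x k))" for Z by simp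
  show "D \<Theta> z (hv_iso \<Gamma> i z Y) = dual_endo (E (fst z)) (snd Y)"
    using hv_iso_snd_inner[OF i xS, of "snd z" "fst Y" "snd Y"] unfolding D dual_endo_def by simp
qed

text \<open>In the coordinates (\<beta>, \<Theta>) the structure becomes the constant map (p, q)
  \<mapsto> (-q, p), because the derivative applies the same transpose of the frame to
  \<open>R v\<close> and to the vertical part.\<close>

lemma integrable_J_bilin:
  assumes b: "bilin_field M b" "nondegenerate M b" and cod: "codazzi M \<Gamma> b"
  shows "integrable_acs N (J_bilin \<Gamma> b)"
proof (rule integrable_acsI[OF almost_complex_J_bilin[OF b]])
  interpret N: smooth_mfd N by unfold_locales (rule smooth_manifold_N)
  fix i z assume "i \<in> idx N" "z \<in> coord_dom N i"
  then have i: "i \<in> idx M" and x0: "fst z \<in> coord_dom M i" by (auto simp: idx_N coord_dom_N)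
  obtain r E \<beta> where r: "r > 0" "ball (fst z) r \<subseteq> coord_dom M i" "\<And>x. linear (E x)" "\<And>k. E (fst z) k = k"
    "\<And>k. smooth_on (ball (fst z) r) (\<lambda>x. E x k)" "smooth_on (ball (fst z) r) \<beta>"
    "\<And>x k. x \<in> ball (fst z) r \<Longrightarrow> ((\<lambda>x. E x k) has_derivative (\<lambda>v. - \<Gamma> i x v (E x k))) (at x)"
    "\<And>x k v. x \<in> ball (fst z) r \<Longrightarrow> D \<beta> x v \<bullet> k = b i x v (E x k)"
    by (rule parallel_frame[OF b(1) cod i x0]) (rule that)
  let ?U = "ball (fst z) r \<times> (UNIV :: 'c set)"
  define \<Theta> where "\<Theta> = (\<lambda>z. dual_endo (E (fst z)) (snd z))"
  have "\<forall>x\<in>ball (fst z) r. \<forall>k. ((\<lambda>x. E x k) has_derivative (\<lambda>v. - \<Gamma> i x v (E x k))) (at x)"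
    using r(7) by blast
  note fc = fibre_coordinates[OF i r(2,3,5) this, folded \<Theta>_def]
  define f where "f = (\<lambda>z. (\<beta> (fst z), \<Theta> z))"
  have o: "open ?U" by (simp add: open_Times)
  have sub: "?U \<subseteq> coord_dom N i" using r(2) by (auto simp: coord_dom_N[OF i])
  have sf: "smooth_on ?U f"
    unfolding f_def
    by (intro smooth_on_Pair o fc(1) smooth_on_compose[OF o open_ball r(6) smooth_on_fst[OF o smooth_on_id[OF o]]]) auto
  have Df: "D f y (hv_iso \<Gamma> i y Y) = (dual_endo (E (fst y)) (flat_map (b i (fst y)) (fst Y)), dual_endo (E (fst y)) (snd Y))"
    if y: "y \<in> ?U" for y Y
  proof -
    have y1: "fst y \<in> ball (fst z) r" using y by auto
    have "(f has_derivative (\<lambda>Z. (D \<beta> (fst y) (fst Z), D \<Theta> y Z))) (at y)"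
      unfolding f_def
      by (intro has_derivative_Pair smooth_on_has_derivative[OF fc(1) y]
          has_derivative_compose_at[OF has_derivative_fst[OF has_derivative_ident] smooth_on_has_derivative[OF r(6) y1] refl])
    from D_eqI[OF this] have "D f y (hv_iso \<Gamma> i y Y) = (D \<beta> (fst y) (fst Y), dual_endo (E (fst y)) (snd Y))"
      by (simp add: fc(2)[OF y1])
    moreover have "D \<beta> (fst y) (fst Y) = dual_endo (E (fst y)) (flat_map (b i (fst y)) (fst Y))"
      by (rule inner_eqI) (use y1 r(2) in \<open>auto simp: r(8) dual_endo_inner[OF r(3)] flat_map_inner[OF bilin_fieldD(1)[OF b(1) i]]\<close>)
    ultimately show ?thesis by simp
  qed
  have "inj (D f z)"
  proof -
    interpret pairing "b i (fst z)" by (rule pairing_field[OF b i x0])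
    have zU: "z \<in> ?U" using r(1) by (simp add: mem_Times_iff)
    \<comment> \<open>At the centre the frame is the identity, so there \<open>D f\<close> is the
      splitting followed by \<open>R\<close> on the horizontal part; this is the point at which
      \<open>integrable_acsI\<close> asks for injectivity.\<close>
    have id: "dual_endo (E (fst z)) a = a" for a by (rule inner_eqI) (simp add: dual_endo_inner[OF r(3)] r(4))
    have "Z = W" if eq: "D f z Z = D f z W" for Z W
    proof -
      have "hv_inv \<Gamma> i z Z = hv_inv \<Gamma> i z W"
        using eq Df[OF zU, of "hv_inv \<Gamma> i z Z"] Df[OF zU, of "hv_inv \<Gamma> i z W"] injR
        by (simp add: id prod_eq_iff inj_eq)
      then show ?thesis by (metis hv_iso_inv)
    qed
    then show ?thesis by (rule injI)
  qed
  moreover have "D f y (J_bilin \<Gamma> b i y W) = (\<lambda>(p, q). (- q, p)) (D f y W)" if y: "y \<in> ?U" for y W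
  proof -
    have yS: "fst y \<in> coord_dom M i" using y r(2) by auto
    interpret pairing "b i (fst y)" by (rule pairing_field[OF b i yS])
    obtain v a where e: "hv_inv \<Gamma> i y W = (v, a)" by (metis prod.collapse)
    have W: "W = hv_iso \<Gamma> i y (v, a)" using e by (metis hv_iso_inv)
    have "J_bilin \<Gamma> b i y W = hv_iso \<Gamma> i y (- R' a, R v)"
      by (simp add: J_bilin_eq hv_endo_eq e J_bilin_hv_def)
    then show ?thesis
      by (simp add: Df[OF y] W lin_simps linear_neg[OF linear_dual_endo])
  qed
  moreover have "z \<in> ?U" using r(1) by (simp add: mem_Times_iff)
  moreover have "linear (\<lambda>(p::'c, q::'c). (- q, p))" by (auto simp: linear_iff)
  ultimately show "\<exists>U (f::'c \<times> 'c \<Rightarrow> 'c \<times> 'c) j. open U \<and> z \<in> U \<and> U \<subseteq> coord_dom N i \<and> smooth_on U f \<and> inj (D f z) \<and>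
      linear j \<and> (\<forall>v. j (j v) = - v) \<and> (\<forall>y\<in>U. \<forall>v. D f y (J_bilin \<Gamma> b i y v) = j (D f y v))"
    by (intro exI[of _ ?U] exI[of _ f] exI[of _ "\<lambda>(p, q). (- q, p)"]) (use o sub sf in auto)
qed

text \<open>The identity of \<open>nijenhuis_pairing\<close> is evaluated at horizontal lifts of
  \<open>u\<close> and \<open>v\<close>. \<open>J_bilin\<close> makes them vertical, where \<eta>,
  which sees only base directions, is zero; what is left is closedness of b(., E k) at
  \<open>x0\<close>, that is, the Codazzi condition.\<close>

lemma codazzi_of_integrable:
  assumes b: "bilin_field M b" "nondegenerate M b" and int: "integrable_acs N (J_bilin \<Gamma> b)"
  shows "codazzi M \<Gamma> b"
  unfolding codazzi_def
proof (intro ballI allI)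
  fix i x0 u v k assume i: "i \<in> idx M" and x0: "x0 \<in> coord_dom M i"
  obtain r E \<beta> where r: "r > 0" "ball x0 r \<subseteq> coord_dom M i" "\<And>x. linear (E x)" "\<And>k. E x0 k = k"
    "\<And>k. smooth_on (ball x0 r) (\<lambda>x. E x k)" "smooth_on (ball x0 r) (\<beta> :: 'c \<Rightarrow> 'c)"
    "\<And>x k. x \<in> ball x0 r \<Longrightarrow> ((\<lambda>x. E x k) has_derivative (\<lambda>v. - \<Gamma> i x v (E x k))) (at x)"
    by (rule parallel_frame[OF codazzi_zero i x0]) (rule that)
  let ?S = "ball x0 r \<times> (UNIV :: 'c set)"
  let ?z = "(x0, 0 :: 'c)"
  define \<Theta> where "\<Theta> = (\<lambda>z. dual_endo (E (fst z)) (snd z))"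
  have "\<forall>x\<in>ball x0 r. \<forall>k. ((\<lambda>x. E x k) has_derivative (\<lambda>v. - \<Gamma> i x v (E x k))) (at x)"
    using r(7) by blast
  note fc = fibre_coordinates[OF i r(2,3,5) this, folded \<Theta>_def]
  have o: "open ?S" by (simp add: open_Times)
  have zS: "?z \<in> ?S" using r(1) by simp
  have sub: "?S \<subseteq> coord_dom N i" using r(2) by (auto simp: coord_dom_N[OF i])
  note bl = bilin_fieldD(1)[OF b(1) i]
  define \<theta> where "\<theta> z Z = D \<Theta> z Z \<bullet> k" for z Z
  define h where "h w x = b i x w (E x k)" for w x
  define \<eta> where "\<eta> z Z = h (fst Z) (fst z)" for z Z :: "'c \<times> 'c"
  define Jb where "Jb = J_bilin \<Gamma> b i"
  define X where "X = hv_iso \<Gamma> i ?z (u, 0)"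
  define Y where "Y = hv_iso \<Gamma> i ?z (v, 0)"
  have smh: "smooth_on (ball x0 r) (h w)" for w
    unfolding h_def
    by (rule smooth_on_linear_apply[where A="\<lambda>x. b i x w"])
      (use bl r(2) r(5) smooth_on_subset[OF bilin_fieldD(2)[OF b(1) i] r(2)] in \<open>auto simp: bilinear_def\<close>)
  have act: "\<eta> z (Jb z Z) = - \<theta> z Z \<and> \<theta> z (Jb z Z) = \<eta> z Z" if z: "z \<in> ?S" for z Z
  proof -
    have x: "fst z \<in> ball x0 r" "fst z \<in> coord_dom M i" using z r(2) by auto
    interpret pairing "b i (fst z)" by (rule pairing_field[OF b i x(2)])
    obtain w a where e: "hv_inv \<Gamma> i z Z = (w, a)" by (metis prod.collapse)
    have Z: "Z = hv_iso \<Gamma> i z (w, a)" using e by (metis hv_iso_inv)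
    have J: "Jb z Z = hv_iso \<Gamma> i z (- R' a, R w)"
      by (simp add: Jb_def J_bilin_eq hv_endo_eq e J_bilin_hv_def)
    have t: "\<theta> z (hv_iso \<Gamma> i z (v', a')) = a' \<bullet> E (fst z) k" for v' a'
      by (simp add: \<theta>_def fc(2)[OF x(1)] dual_endo_inner[OF r(3)])
    have "\<theta> z Z = a \<bullet> E (fst z) k" "fst Z = w" using t[of w a] Z by auto
    then show ?thesis unfolding J
      by (simp add: t \<eta>_def h_def R_inner bilinear_lneg[OF bil] rho_R')
  qed
  have "D (\<lambda>y. \<eta> y Y) ?z X - D (\<lambda>y. \<eta> y X) ?z Y =
    D (\<lambda>y. \<eta> y (Jb ?z Y)) ?z (Jb ?z X) - D (\<lambda>y. \<eta> y (Jb ?z X)) ?z (Jb ?z Y)"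
  proof (rule nijenhuis_pairing[where S="?S" and \<theta>=\<theta>])
    note ac = almost_complex_J_bilin[OF b]
    have iN: "i \<in> idx N" using i by (simp add: idx_N)
    show "smooth_on ?S (\<lambda>y. Jb y W)" for W
      unfolding Jb_def by (rule smooth_on_subset[OF almost_complexD(2)[OF ac iN] sub])
    show "smooth_on ?S (\<lambda>y. \<theta> y W)" for W
      unfolding \<theta>_def by (intro smooth_on_inner smooth_on_D fc(1) smooth_on_const o)
    show "smooth_on ?S (\<lambda>y. \<eta> y W)" for W
      unfolding \<eta>_def by (rule smooth_on_compose[OF o open_ball smh smooth_on_fst[OF o smooth_on_id[OF o]]]) auto
    show "linear (\<theta> y)" if "y \<in> ?S" for y
      using smooth_on_linear_D[OF fc(1) that] unfolding \<theta>_def by (simp add: linear_iff inner_add_left)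
    show "linear (\<eta> y)" if "y \<in> ?S" for y
      using bl[of "fst y"] that r(2) unfolding \<eta>_def h_def by (auto simp: linear_iff bilinear_def)
    show "D (\<lambda>y. \<theta> y W') ?z W = D (\<lambda>y. \<theta> y W) ?z W'" for W W'
    proof -
      have "D (\<lambda>y. D \<Theta> y W' \<bullet> k) ?z W = D (\<lambda>y. D \<Theta> y W') ?z W \<bullet> k" for W W'
        using D_eqI[OF has_derivative_inner_left[OF smooth_on_has_derivative[OF smooth_on_D[OF fc(1)] zS]]] by metis
      then show ?thesis unfolding \<theta>_def using symmetric_second_derivative[OF o zS fc(1)] by metis
    qed
    show "D (\<lambda>y. Jb y Y) ?z (Jb ?z X) - D (\<lambda>y. Jb y X) ?z (Jb ?z Y) = Jb ?z (D (\<lambda>y. Jb y Y) ?z X - D (\<lambda>y. Jb y X) ?z Y)"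
      unfolding Jb_def by (rule integrable_nijenhuis[OF ac int iN]) (use sub zS in blast)
  qed (use act o zS in auto)
  moreover have D\<eta>: "D (\<lambda>y. \<eta> y W) ?z Z = D (h (fst W)) x0 (fst Z)" for W Z
  proof -
    have "((\<lambda>y. h (fst W) (fst y)) has_derivative (\<lambda>Z. D (h (fst W)) x0 (fst Z))) (at ?z)"
      by (rule has_derivative_compose_at[OF has_derivative_fst[OF has_derivative_ident]
            smooth_on_has_derivative[OF smh, of x0]]) (use r(1) in auto)
    from D_eqI[OF this] show ?thesis by (simp add: \<eta>_def)
  qed
  moreover have "fst (Jb ?z X) = 0" "fst (Jb ?z Y) = 0"
  proof -
    interpret pairing "b i x0" by (rule pairing_field[OF b i x0])
    show "fst (Jb ?z X) = 0" "fst (Jb ?z Y) = 0"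
      by (simp_all add: Jb_def J_bilin_eq hv_endo_eq J_bilin_hv_def X_def Y_def linear_0[OF linR'])
  qed
  \<comment> \<open>On the right of the identity the vertical vectors \<open>Jb ?z X\<close> and
    \<open>Jb ?z Y\<close> are the constant arguments of \<eta>, which leads to
    \<open>h 0\<close>.\<close>
  moreover have "D (h 0) x0 w = 0" for w
  proof -
    have "D (h 0) x0 = D (\<lambda>x. 0) x0"
      by (rule D_cong_open[OF open_ball[of x0 r]]) (use r(1,2) bl in \<open>auto simp: h_def bilinear_lzero subset_iff\<close>)
    then show ?thesis by simp
  qed
  moreover have "fst X = u" "fst Y = v" by (simp_all add: X_def Y_def)
  ultimately have "D (h v) x0 u = D (h u) x0 v" by simp
  moreover have "D (h w) x0 w' = D (\<lambda>x. b i x w k) x0 w' - b i x0 w (\<Gamma> i x0 w' k)" for w w'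
  proof -
    have x0r: "x0 \<in> ball x0 r" using r(1) by simp
    have "D (h w) x0 w' = D (\<lambda>y. b i y w (E x0 k)) x0 w' + b i x0 w (D (\<lambda>x. E x k) x0 w')"
      unfolding h_def
      by (rule smooth_on_D_linear_apply[where A="\<lambda>x. b i x w" and f="\<lambda>x. E x k", OF open_ball x0r])
        (use bl r(2) r(5) smooth_on_subset[OF bilin_fieldD(2)[OF b(1) i] r(2)] in \<open>auto simp: bilinear_def\<close>)
    also have "D (\<lambda>x. E x k) x0 w' = - \<Gamma> i x0 w' k" using D_eqI[OF r(7)[OF x0r]] r(4) by simp
    finally show ?thesis using bl[OF x0] by (simp add: r(4) bilinear_rneg)
  qed
  ultimately show "cov_bilin \<Gamma> b i x0 u v k = cov_bilin \<Gamma> b i x0 v u k"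
    using torsion_free'[OF i x0, of u v] by (simp add: cov_bilin_def)
qed

end

text \<open>Component functions are meaningful only on the coordinate domains, so two descriptions
  of a field agree only there; this is how \<open>K3\<close> will be replaced by a structure of type
  \<open>J_bilin\<close>.\<close>

lemma integrable_acs_cong:
  assumes "integrable_acs M J" "\<And>i x v. i \<in> idx M \<Longrightarrow> x \<in> coord_dom M i \<Longrightarrow> J i x v = K i x v"
  shows "integrable_acs M K"
proof -
  have "holomorphic_chart M K V \<psi> j" if "holomorphic_chart M J V \<psi> j" for V \<psi> j
  proof -
    have "K i x v = J i x v" if "i \<in> idx M" "x \<in> chart M i ` (cdom M i \<inter> V)" for i x v
    proof -
      have "x \<in> coord_dom M i" using that(2) by (auto simp: coord_dom_def)
      then show ?thesis using assms(2)[OF that(1)] by simp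
    qed
    then show ?thesis using that by (simp add: holomorphic_chart_def)
  qed
  note hol = this
  show ?thesis
    unfolding integrable_acs_def
  proof
    fix p assume "p \<in> topspace (mtop M)"
    then obtain V \<psi> j where "p \<in> V" "holomorphic_chart M J V \<psi> j"
      using assms(1) unfolding integrable_acs_def by meson
    then show "\<exists>V \<psi> j. p \<in> V \<and> holomorphic_chart M K V \<psi> j"
      using hol[of V \<psi> j] by (intro exI conjI)
  qed
qed

section \<open>The standard complex structure of the cotangent bundle\<close>

text \<open>The real part of i (a(v) - i a(jv)) is a(jv).\<close>

lemma times_i_eq: "times_i j a = dual_endo j a"
  by (simp add: times_i_def dual_endo_def complex_form_def)

context mfd_connection begin

lemma standard_J_nabla:
  assumes ac: "almost_complex M J" and tf: "torsion_free M \<Gamma>"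
    and dJ: "\<And>i x u v. i \<in> idx M \<Longrightarrow> x \<in> coord_dom M i \<Longrightarrow> cov_endo \<Gamma> J i x u v = cov_endo \<Gamma> J i x v u"
  shows "standard_cotangent_complex_structure M J (J_nabla \<Gamma> J)"
  unfolding standard_cotangent_complex_structure_def
proof (intro conjI allI impI almost_complex_J_nabla[OF ac])
  fix V \<psi> j assume hol: "holomorphic_chart M J V \<psi> j"
  then have ch: "smooth_chart M V \<psi>" and j: "linear j" "\<And>v. j (j v) = - v" by (auto simp: holomorphic_chart_def)
  show "holomorphic_chart N (J_nabla \<Gamma> J) (cotangent_points M V) (bundle_chart M V \<psi>) (\<lambda>(v, a). (j v, times_i j a))"
    unfolding holomorphic_chart_def
  proof (intro conjI ballI allI)
    show "smooth_chart N (cotangent_points M V) (bundle_chart M V \<psi>)" by (rule smooth_bundle_chart(1)[OF ch])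
    show "linear (\<lambda>(v, a). (j v, times_i j a))"
      using j(1) linear_dual_endo[of j] by (auto simp: linear_iff times_i_eq)
    show "(case case Y of (v, a) \<Rightarrow> (j v, times_i j a) of (v, a) \<Rightarrow> (j v, times_i j a)) = - Y" for Y
    proof -
      have "dual_endo j (dual_endo j a) = - a" for a
        by (rule inner_eqI) (simp add: dual_endo_inner[OF j(1)] j(2))
      then show ?thesis by (simp add: times_i_eq j(2) split: prod.split)
    qed
    fix i z Z assume "i \<in> idx N" and z: "z \<in> chart N i ` (cdom N i \<inter> cotangent_points M V)"
    then have i: "i \<in> idx M" by (simp add: idx_N)
    let ?A = "chart M i ` (cdom M i \<inter> V)"
    define \<phi> where "\<phi> = \<psi> \<circ> inv_into (cdom M i) (chart M i)"
    define \<kappa> where "\<kappa> = chart M i \<circ> inv_into V \<psi>"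
    interpret d: diffeo ?A "\<psi> ` (cdom M i \<inter> V)" \<phi> \<kappa>
      unfolding \<phi>_def \<kappa>_def by (rule smooth_chart_diffeo[OF sm ch i])
    have comm: "D \<phi> y (J i y v) = j (D \<phi> y v)" if "y \<in> ?A" for y v
      using hol i that by (auto simp: holomorphic_chart_def \<phi>_def)
    have "z \<in> ?A \<times> UNIV"
      using z image_chart_N[OF i, of "cdom M i \<inter> V"] by (simp add: cdom_N cotangent_points_Int)
    then obtain x a where e: "z = (x, a)" "x \<in> ?A" by auto
    have xS: "x \<in> coord_dom M i" using e(2) by (auto simp: coord_dom_def)
    note J = almost_complexD[OF ac i]
    have o: "open (?A \<times> (UNIV :: 'e set))" using d.A by (simp add: open_Times)
    let ?L = "cotangent_lift \<phi> \<kappa>"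
    let ?\<Psi> = "bundle_chart M V \<psi> \<circ> inv_into (cdom N i) (chart N i)"
    have D\<Psi>: "D ?\<Psi> z = D ?L z"
      by (rule D_cong_open[OF o \<open>z \<in> ?A \<times> UNIV\<close>]) (unfold \<phi>_def \<kappa>_def, rule smooth_bundle_chart(2)[OF ch i])
    define c where "c = snd (?L (x, a))"
    define D2 where "D2 u v = D (\<lambda>y. D \<phi> y v) x u" for u v
    have D2sym: "D2 u v = D2 v u" for u v
      unfolding D2_def by (rule symmetric_second_derivative[OF d.A e(2) d.\<phi>])
    \<comment> \<open>The Christoffel map of \<nabla> in the chart \<psi>, with its arguments pulled
      back by \<open>D \<phi>\<close>.\<close>
    define T where "T u v = D \<phi> x (\<Gamma> i x u v) - D2 u v" for u v
    have tf': "\<Gamma> i x u v = \<Gamma> i x v u" for u v using tf i xS unfolding torsion_free_def by blast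
    have Tsym: "T u v = T v u" for u v unfolding T_def using D2sym[of u v] tf'[of u v] by simp
    have D2J: "D2 u (J i x v) + D \<phi> x (D (\<lambda>y. J i y v) x u) = j (D2 u v)" for u v
    proof -
      have sJ: "smooth_on ?A (\<lambda>y. J i y v)"
        by (rule smooth_on_subset[OF J(2)]) (auto simp: coord_dom_def)
      have "D (\<lambda>y. D \<phi> y (J i y v)) x u = D2 u (J i x v) + D \<phi> x (D (\<lambda>y. J i y v) x u)"
        unfolding D2_def
        by (rule smooth_on_D_linear_apply[OF d.A e(2)]) (use d.lin\<phi> smooth_on_D[OF d.\<phi>] sJ in auto)
      moreover have "D (\<lambda>y. D \<phi> y (J i y v)) x u = D (\<lambda>y. j (D \<phi> y v)) x u"
        using D_cong_open[OF d.A e(2), of "\<lambda>y. D \<phi> y (J i y v)" "\<lambda>y. j (D \<phi> y v)"] comm by simp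
      moreover have "D (\<lambda>y. j (D \<phi> y v)) x u = j (D2 u v)"
        unfolding D2_def using j(1) linear_conv_bounded_linear
        by (subst D_eqI[OF bounded_linear.has_derivative[OF _ smooth_on_has_derivative[OF smooth_on_D[OF d.\<phi>] e(2)]]]) auto
      ultimately show ?thesis by simp
    qed
    note lin = linear_add[OF d.lin\<phi>[OF e(2)]] linear_diff[OF d.lin\<phi>[OF e(2)]]
    have cov: "D \<phi> x (cov_endo \<Gamma> J i x u v) = T u (J i x v) - j (T u v)" for u v
    proof -
      have "D \<phi> x (cov_endo \<Gamma> J i x u v) =
          D \<phi> x (D (\<lambda>y. J i y v) x u) + D \<phi> x (\<Gamma> i x u (J i x v)) - j (D \<phi> x (\<Gamma> i x u v))"
        unfolding cov_endo_def by (simp add: lin comm[OF e(2)])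
      also have "\<dots> = j (D2 u v) - D2 u (J i x v) + D \<phi> x (\<Gamma> i x u (J i x v)) - j (D \<phi> x (\<Gamma> i x u v))"
        using D2J[of u v] by (simp add: algebra_simps)
      finally show ?thesis unfolding T_def by (simp add: linear_diff[OF j(1)])
    qed
    \<comment> \<open>Through \<open>cov\<close>, the symmetry of \<open>cov_endo\<close> becomes
      this identity, since \<open>T\<close> is symmetric and the terms \<open>j (T u v)\<close> drop
      out.\<close>
    have TJ: "T (J i x u) v = T u (J i x v)" for u v
      using cov[of u v] cov[of v u] dJ[OF i xS, of u v] Tsym[of u v] Tsym[of v "J i x u"] by simp
    \<comment> \<open>The Christoffel term of the splitting and the second derivative of the lift
      combine to \<open>T\<close>. Complex linearity then comes down to moving \<open>J\<close> from
      one argument of \<open>T\<close> to the other.\<close>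
    have DL: "fst (D ?L (x, a) (hv_iso \<Gamma> i (x, a) (v, b))) = D \<phi> x v"
      "snd (D ?L (x, a) (hv_iso \<Gamma> i (x, a) (v, b))) \<bullet> D \<phi> x w = b \<bullet> w + c \<bullet> T v w" for v b w
    proof -
      have h: "hv_iso \<Gamma> i (x, a) (v, b) = (v, snd (hv_iso \<Gamma> i (x, a) (v, b)))" by (simp add: prod_eq_iff)
      show "fst (D ?L (x, a) (hv_iso \<Gamma> i (x, a) (v, b))) = D \<phi> x v"
        by (subst h) (rule d.D_lift(1)[OF e(2)])
      have "snd (D ?L (x, a) (hv_iso \<Gamma> i (x, a) (v, b))) \<bullet> D \<phi> x w =
          a \<bullet> \<Gamma> i x v w + b \<bullet> w - c \<bullet> D2 v w"
        by (subst h) (simp only: d.D_lift(2)[OF e(2)] hv_iso_snd_inner[OF i xS] c_def D2_def)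
      also have "a \<bullet> \<Gamma> i x v w = c \<bullet> D \<phi> x (\<Gamma> i x v w)" unfolding c_def by (rule d.snd_lift_D[OF e(2), symmetric])
      finally show "snd (D ?L (x, a) (hv_iso \<Gamma> i (x, a) (v, b))) \<bullet> D \<phi> x w = b \<bullet> w + c \<bullet> T v w"
        by (simp add: T_def inner_diff_right)
    qed
    obtain v b where vb: "hv_inv \<Gamma> i (x, a) Z = (v, b)" by (metis prod.collapse)
    have Z: "Z = hv_iso \<Gamma> i (x, a) (v, b)" using vb by (metis hv_iso_inv)
    have JZ: "J_nabla \<Gamma> J i (x, a) Z = hv_iso \<Gamma> i (x, a) (J i x v, dual_endo (J i x) b)"
      by (simp add: J_nabla_eq hv_endo_eq vb J_nabla_hv_def)
    have "snd (D ?L (x, a) (J_nabla \<Gamma> J i (x, a) Z)) = dual_endo j (snd (D ?L (x, a) Z))"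
    proof (rule inner_eqI)
      fix w'
      obtain w where w: "w' = D \<phi> x w" using d.D_inv'[OF e(2)] by metis
      have "snd (D ?L (x, a) (J_nabla \<Gamma> J i (x, a) Z)) \<bullet> w' = b \<bullet> J i x w + c \<bullet> T (J i x v) w"
        unfolding JZ w DL(2) by (simp add: dual_endo_inner[OF J(1)[OF xS]])
      also have "\<dots> = snd (D ?L (x, a) Z) \<bullet> D \<phi> x (J i x w)" unfolding Z DL(2) TJ ..
      also have "\<dots> = dual_endo j (snd (D ?L (x, a) Z)) \<bullet> w'" by (simp add: dual_endo_inner[OF j(1)] comm[OF e(2)] w)
      finally show "snd (D ?L (x, a) (J_nabla \<Gamma> J i (x, a) Z)) \<bullet> w' = dual_endo j (snd (D ?L (x, a) Z)) \<bullet> w'" .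
    qed
    moreover have "fst (D ?L (x, a) (J_nabla \<Gamma> J i (x, a) Z)) = j (fst (D ?L (x, a) Z))"
      by (simp only: JZ DL(1)) (simp only: Z DL(1) comm[OF e(2)])
    ultimately show "D ?\<Psi> z (J_nabla \<Gamma> J i z Z) = (case D ?\<Psi> z Z of (v, a) \<Rightarrow> (j v, times_i j a))"
      unfolding D\<Psi> by (simp add: e(1) times_i_eq case_prod_unfold prod_eq_iff)
  qed
qed

lemma integrable_of_standard:
  assumes "integrable_acs M J" "standard_cotangent_complex_structure M J K"
  shows "integrable_acs N K"
  unfolding integrable_acs_def
proof
  fix q assume "q \<in> topspace (mtop N)"
  then have q: "q \<in> cotangent_points M (topspace (mtop M))" by (simp add: topspace_N)
  then have "fst q \<in> topspace (mtop M)" by (auto simp: cotangent_points_def)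
  then obtain V \<psi> j where V: "fst q \<in> V" "holomorphic_chart M J V \<psi> j"
    using assms(1) unfolding integrable_acs_def by blast
  have "q \<in> cotangent_points M V" using q V(1) by (auto simp: cotangent_points_def)
  moreover have "holomorphic_chart N K (cotangent_points M V) (bundle_chart M V \<psi>) (\<lambda>(v, a). (j v, times_i j a))"
    using assms(2) V(2) unfolding standard_cotangent_complex_structure_def by blast
  ultimately show "\<exists>V \<psi> j. q \<in> V \<and> holomorphic_chart N K V \<psi> j" by blast
qed

end

section \<open>Covariant derivatives of compositions\<close>

context smooth_mfd begin

lemma bilin_field_cong:
  assumes eq: "\<And>i x v w. i \<in> idx M \<Longrightarrow> x \<in> coord_dom M i \<Longrightarrow> b i x v w = c i x v w"
    and b: "bilin_field M b"
  shows "bilin_field M c"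
  unfolding bilin_field_def
proof (intro ballI conjI allI)
  fix i assume i: "i \<in> idx M"
  show "bilinear (c i x)" if "x \<in> coord_dom M i" for x
    using bilin_fieldD(1)[OF b i that] eq[OF i that] by (simp add: bilinear_def)
  show "smooth_on (coord_dom M i) (\<lambda>x. c i x v w)" for v w
    by (rule smooth_on_cong[OF open_coord_dom[OF i] eq[OF i] bilin_fieldD(2)[OF b i]])
  show "c j (transition M i j x) (dtrans M i j x v) (dtrans M i j x w) = c i x v w"
    if j: "j \<in> idx M" and x: "x \<in> overlap M i j" for j x v w
  proof -
    have "x \<in> coord_dom M i" using x overlap_subset by blast
    then show ?thesis using bilin_fieldD(3)[OF b i j x] eq[OF i] eq[OF j] transition_coord_dom[OF i x] by simp
  qed
qed

lemma bilin_field_comp2: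
  assumes b: "bilin_field M b" and A: "endo_field M A" and B: "endo_field M B"
  shows "bilin_field M (\<lambda>i x v w. b i x (A i x v) (B i x w))"
  unfolding bilin_field_def
proof (intro ballI conjI allI)
  fix i assume i: "i \<in> idx M"
  show "bilinear (\<lambda>v w. b i x (A i x v) (B i x w))" if "x \<in> coord_dom M i" for x
  proof -
    have "linear (\<lambda>v. b i x v w)" "linear (b i x v)" for v w
      using bilin_fieldD(1)[OF b i that] unfolding bilinear_def by blast+
    from linear_compose[OF endo_fieldD(1)[OF A i that] this(1)] linear_compose[OF endo_fieldD(1)[OF B i that] this(2)]
    show ?thesis by (simp add: bilinear_def o_def)
  qed
  show "smooth_on (coord_dom M i) (\<lambda>x. b i x (A i x v) (B i x w))" for v w
    by (rule smooth_on_bilinear_apply[where A="b i", OF open_coord_dom[OF i] bilin_fieldD(1)[OF b i]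
          bilin_fieldD(2)[OF b i] endo_fieldD(2)[OF A i] endo_fieldD(2)[OF B i]])
  show "b j (transition M i j x) (A j (transition M i j x) (dtrans M i j x v)) (B j (transition M i j x) (dtrans M i j x w))
      = b i x (A i x v) (B i x w)" if j: "j \<in> idx M" and x: "x \<in> overlap M i j" for j x v w
    by (simp only: endo_fieldD(3)[OF A i j x] endo_fieldD(3)[OF B i j x] bilin_fieldD(3)[OF b i j x])
qed

lemma bilin_field_comb:
  assumes b: "bilin_field M b" and c: "bilin_field M c"
  shows "bilin_field M (\<lambda>i x v w. b i x v w *\<^sub>R r + c i x v w *\<^sub>R s)"
  unfolding bilin_field_def
proof (intro ballI conjI allI)
  fix i assume i: "i \<in> idx M"
  show "bilinear (\<lambda>v w. b i x v w *\<^sub>R r + c i x v w *\<^sub>R s)" if "x \<in> coord_dom M i" for x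
  proof -
    have "linear (\<lambda>v. b i x v w)" "linear (b i x v)" "linear (\<lambda>v. c i x v w)" "linear (c i x v)" for v w
      using bilin_fieldD(1)[OF b i that] bilin_fieldD(1)[OF c i that] unfolding bilinear_def by blast+
    then show ?thesis unfolding bilinear_def by (simp add: linear_iff distrib_left distrib_right)
  qed
  show "smooth_on (coord_dom M i) (\<lambda>x. b i x v w *\<^sub>R r + c i x v w *\<^sub>R s)" for v w
    by (intro smooth_on_add smooth_on_scaleR smooth_on_const open_coord_dom i bilin_fieldD(2)[OF b] bilin_fieldD(2)[OF c])
  show "b j (transition M i j x) (dtrans M i j x v) (dtrans M i j x w) *\<^sub>R r +
      c j (transition M i j x) (dtrans M i j x v) (dtrans M i j x w) *\<^sub>R s = b i x v w *\<^sub>R r + c i x v w *\<^sub>R s"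
    if j: "j \<in> idx M" and x: "x \<in> overlap M i j" for j x v w
    by (simp only: bilin_fieldD(3)[OF b i j x] bilin_fieldD(3)[OF c i j x])
qed

lemma endo_field_id: "endo_field M (\<lambda>i x v. v)"
  by (simp add: endo_field_def smooth_on_const linear_iff)

lemma D_bilin_cong:
  assumes "\<And>i x v w. i \<in> idx M \<Longrightarrow> x \<in> coord_dom M i \<Longrightarrow> b i x v w = c i x v w" "i \<in> idx M" "x \<in> coord_dom M i"
  shows "D (\<lambda>y. b i y v w) x = D (\<lambda>y. c i y v w) x"
  using assms by (intro D_cong_open[OF open_coord_dom]) auto

lemma closed_form_cong:
  assumes eq: "\<And>i x v w. i \<in> idx M \<Longrightarrow> x \<in> coord_dom M i \<Longrightarrow> b i x v w = c i x v w"
    and b: "closed_form M b"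
  shows "closed_form M c"
  unfolding closed_form_def
proof (intro ballI allI)
  fix i x u v w assume i: "i \<in> idx M" "x \<in> coord_dom M i"
  have "D (\<lambda>y. b i y v w) x = D (\<lambda>y. c i y v w) x" for v w
    by (rule D_bilin_cong[of b c]) (use eq i in auto)
  then show "D (\<lambda>y. c i y v w) x u + D (\<lambda>y. c i y w u) x v + D (\<lambda>y. c i y u v) x w = 0"
    using b i unfolding closed_form_def by metis
qed

end

context mfd_connection begin

lemma cov_bilin_cong:
  assumes "\<And>i x v w. i \<in> idx M \<Longrightarrow> x \<in> coord_dom M i \<Longrightarrow> b i x v w = c i x v w" "i \<in> idx M" "x \<in> coord_dom M i"
  shows "cov_bilin \<Gamma> b i x u v w = cov_bilin \<Gamma> c i x u v w"
  using assms(1)[OF assms(2,3)] D_bilin_cong[of b c i x v w] assms by (simp add: cov_bilin_def)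

lemma cov_endo_id: "cov_endo \<Gamma> (\<lambda>i x v. v) i x u v = 0"
  by (simp add: cov_endo_def)

text \<open>The Leibniz rule; with the identity for \<open>A\<close> or \<open>B\<close> it covers
  composition in one slot.\<close>

lemma cov_bilin_comp2:
  assumes b: "bilin_field M b" and A: "endo_field M A" and B: "endo_field M B"
    and i: "i \<in> idx M" and x: "x \<in> coord_dom M i"
  shows "cov_bilin \<Gamma> (\<lambda>i x v w. b i x (A i x v) (B i x w)) i x u v w =
    cov_bilin \<Gamma> b i x u (A i x v) (B i x w) + b i x (cov_endo \<Gamma> A i x u v) (B i x w) +
    b i x (A i x v) (cov_endo \<Gamma> B i x u w)"
proof -
  note bl = bilin_fieldD(1)[OF b i x]
  have "D (\<lambda>y. b i y (A i y v) (B i y w)) x u = D (\<lambda>y. b i y (A i x v) (B i x w)) x u +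
      b i x (D (\<lambda>y. A i y v) x u) (B i x w) + b i x (A i x v) (D (\<lambda>y. B i y w) x u)"
    by (rule smooth_on_D_bilinear_apply[OF open_coord_dom[OF i] x bilin_fieldD(1)[OF b i] bilin_fieldD(2)[OF b i]
          endo_fieldD(2)[OF A i] endo_fieldD(2)[OF B i]])
  then show ?thesis
    by (simp add: cov_bilin_def cov_endo_def bilinear_ladd[OF bl] bilinear_radd[OF bl] bilinear_lsub[OF bl] bilinear_rsub[OF bl])
qed

text \<open>The coefficients may be vectors, so that the complex form \<open>hodge20\<close> can be
  treated as a combination of two real forms.\<close>

lemma cov_bilin_comb:
  assumes b: "bilin_field M b" and c: "bilin_field M c" and i: "i \<in> idx M" and x: "x \<in> coord_dom M i"
  shows "cov_bilin \<Gamma> (\<lambda>i x v w. b i x v w *\<^sub>R r + c i x v w *\<^sub>R s) i x u v w =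
    cov_bilin \<Gamma> b i x u v w *\<^sub>R r + cov_bilin \<Gamma> c i x u v w *\<^sub>R (s::'z::real_normed_vector)"
proof -
  have "((\<lambda>y. b i y v w *\<^sub>R r + c i y v w *\<^sub>R s) has_derivative
      (\<lambda>u. D (\<lambda>y. b i y v w) x u *\<^sub>R r + D (\<lambda>y. c i y v w) x u *\<^sub>R s)) (at x)"
    by (intro has_derivative_add has_derivative_scaleR_left smooth_on_has_derivative[OF bilin_fieldD(2)[OF b i] x]
        smooth_on_has_derivative[OF bilin_fieldD(2)[OF c i] x])
  from D_eqI[OF this] show ?thesis by (simp add: cov_bilin_def algebra_simps)
qed

lemma cov_bilin_alternating:
  assumes b: "bilin_field M b" and alt: "alternating M b" and i: "i \<in> idx M" and x: "x \<in> coord_dom M i"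
  shows "cov_bilin \<Gamma> b i x u v w = - cov_bilin \<Gamma> b i x u w v"
proof -
  have a: "b i y v w = - b i y w v" if "y \<in> coord_dom M i" for y v w
    using alt i that unfolding alternating_def by blast
  have "D (\<lambda>y. b i y v w) x = D (\<lambda>y. - b i y w v) x"
    by (rule D_cong_open[OF open_coord_dom[OF i] x a])
  also have "\<dots> = (\<lambda>u. - D (\<lambda>y. b i y w v) x u)"
    by (rule D_eqI[OF has_derivative_minus[OF smooth_on_has_derivative[OF bilin_fieldD(2)[OF b i] x]]])
  finally show ?thesis using a[OF x, of "\<Gamma> i x u v" w] a[OF x, of v "\<Gamma> i x u w"] by (simp add: cov_bilin_def)
qed

lemma parallel_of_codazzi:
  assumes b: "bilin_field M b" and alt: "alternating M b" and cod: "codazzi M \<Gamma> b"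
  shows "parallel M \<Gamma> b"
  unfolding parallel_def
proof (intro ballI allI)
  fix i x u v w assume i: "i \<in> idx M" and x: "x \<in> coord_dom M i"
  note a = cov_bilin_alternating[OF b alt i x]
  have s: "cov_bilin \<Gamma> b i x u v w = cov_bilin \<Gamma> b i x v u w" for u v w
    using cod i x unfolding codazzi_def by blast
  \<comment> \<open>Applying the two exchanges alternately runs through all six orders of the
    arguments and returns to the start with the opposite sign.\<close>
  show "cov_bilin \<Gamma> b i x u v w = 0"
    using s[of u v w] a[of v u w] s[of v w u] a[of w v u] s[of w u v] a[of u w v] by linarith
qed

end

text \<open>For a torsion-free connection the cyclic sum of covariant derivatives is the exterior
  derivative: the Christoffel terms cancel in pairs.\<close>

lemma (in flat_connection) closed_form_of_cov:
  assumes b: "bilin_field M b" and alt: "alternating M b"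
    and cyc: "\<And>i x u v w. i \<in> idx M \<Longrightarrow> x \<in> coord_dom M i \<Longrightarrow>
      cov_bilin \<Gamma> b i x u v w + cov_bilin \<Gamma> b i x v w u + cov_bilin \<Gamma> b i x w u v = 0"
  shows "closed_form M b"
  unfolding closed_form_def
proof (intro ballI allI)
  fix i x u v w assume i: "i \<in> idx M" and x: "x \<in> coord_dom M i"
  have a: "b i x v w = - b i x w v" for v w
    using alt i x unfolding alternating_def by blast
  show "D (\<lambda>y. b i y v w) x u + D (\<lambda>y. b i y w u) x v + D (\<lambda>y. b i y u v) x w = 0"
    using cyc[OF i x, of u v w] torsion_free'[OF i x, of u v] torsion_free'[OF i x, of v w] torsion_free'[OF i x, of w u]
      a[of v "\<Gamma> i x u w"] a[of w "\<Gamma> i x v u"] a[of u "\<Gamma> i x w v"]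
    by (simp add: cov_bilin_def)
qed

section \<open>Linear algebra of the fibres\<close>

locale complex_pairing = pairing +
  fixes j :: "'a \<Rightarrow> 'a"
  assumes linj: "linear j" and jj [simp]: "j (j v) = - v" and alt: "\<rho> v w = - \<rho> w v"
begin

abbreviation "J1 \<equiv> \<lambda>(v, a). (j v, dual_endo j a)"
abbreviation "J2 \<equiv> \<lambda>(v, a). (- R' a, R v)"

lemma dual_inner: "dual_endo j a \<bullet> w = a \<bullet> j w" by (rule dual_endo_inner[OF linj])

lemma j_simps: "j (- v) = - j v" "dual_endo j (- a) = - dual_endo j a"
  by (simp_all add: linear_neg[OF linj] linear_neg[OF linear_dual_endo])

lemma rho_neg: "\<rho> (- v) w = - \<rho> v w" "\<rho> v (- w) = - \<rho> v w"
  by (simp_all add: bilinear_lneg[OF bil] bilinear_rneg[OF bil])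

lemma dual_dual: "dual_endo j (dual_endo j a) = - a"
  by (rule inner_eqI) (simp add: dual_inner)

end

locale hermitian_pairing = complex_pairing +
  assumes inv: "\<rho> (j v) (j w) = \<rho> v w"
begin

lemma skew: "\<rho> (j v) w = - \<rho> v (j w)"
  using inv[of "j v" w] by (simp add: rho_neg)

lemma R_j: "R (j v) = - dual_endo j (R v)"
  by (rule inner_eqI) (simp add: R_inner dual_inner skew)

lemma R'_dual: "R' (dual_endo j a) = - j (R' a)"
  by (rule injD[OF injR]) (simp add: lin_simps R_j)

lemma J1_J2: "J1 (J2 Y) = - J2 (J1 Y)"
  by (simp add: R_j R'_dual j_simps split: prod.split)

lemma flat_g: "flat_map (\<lambda>v. \<rho> (j v)) v = R (j v)"
  by (simp add: flat_map_def)

lemma inv_flat_g: "inv (flat_map (\<lambda>v. \<rho> (j v))) a = - j (R' a)"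
proof -
  have "inv (flat_map (\<lambda>v. \<rho> (j v))) = (\<lambda>a. - j (R' a))"
    by (rule inv_equality) (simp_all add: flat_g j_simps)
  then show ?thesis by simp
qed

lemma inverse_g: "inverse_metric (\<lambda>v. \<rho> (j v)) a b = - (a \<bullet> j (R' b))"
  by (simp add: inverse_metric_def inv_flat_g rho_neg j_simps rho_R')

lemma g_sym: "\<rho> (j v) w = \<rho> (j w) v"
  using skew[of v w] alt[of v "j w"] by simp

lemma g_nd: "(\<And>w. \<rho> (j v) w = 0) \<Longrightarrow> v = 0"
  using nd[of "j v"] jj[of v] linear_0[OF linj] by auto

text \<open>The metric g_N on one tangent space of T*M, read in the splitting.\<close>

definition "Q = (\<lambda>(v, a) (w, b). \<rho> (j v) w + inverse_metric (\<lambda>v. \<rho> (j v)) a b)"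

lemma Q_eq: "Q (v, a) (w, b) = \<rho> (j v) w - a \<bullet> j (R' b)"
  by (simp add: Q_def inverse_g)

lemma inner_jR'_sym: "a \<bullet> j (R' b) = b \<bullet> j (R' a)"
  using g_sym[of "R' b" "R' a"] alt[of "R' a" "j (R' b)"] alt[of "R' b" "j (R' a)"] by (simp add: rho_R')

lemma Q_sym: "Q Y Y' = Q Y' Y"
proof (cases Y; cases Y')
  fix v a w b assume "Y = (v, a)" "Y' = (w, b)"
  then show ?thesis using g_sym[of v w] inner_jR'_sym[of a b] by (simp add: Q_eq)
qed

lemma Q_nd:
  assumes "\<And>Y'. Q Y Y' = 0" shows "Y = 0"
proof -
  obtain v a where Y: "Y = (v, a)" by (cases Y)
  have "\<rho> (j v) w = 0" for w using assms[of "(w, 0)"] by (simp add: Y Q_eq linear_0[OF linR'] linear_0[OF linj])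
  then have v: "v = 0" by (rule g_nd)
  \<comment> \<open>The test covector \<open>R (j w)\<close> is chosen so that
    \<open>- j (R' (R (j w))) = w\<close>.\<close>
  have "a \<bullet> w = 0 \<bullet> w" for w
    using assms[of "(0, R (j w))"] by (simp add: Y Q_eq v bilinear_rzero[OF bil])
  then have "a = 0" by (rule inner_eqI)
  then show ?thesis by (simp add: Y v zero_prod_def)
qed

lemma Q_J1: "Q (J1 Y) (J1 Y') = Q Y Y'"
  by (simp add: Q_eq R'_dual dual_inner skew rho_neg j_simps split: prod.split)

lemma Q_J2: "Q (J2 Y) (J2 Y') = Q Y Y'"
proof (cases Y; cases Y')
  fix v a w b assume Y: "Y = (v, a)" "Y' = (w, b)"
  have "\<rho> (j (R' a)) (R' b) = - (a \<bullet> j (R' b))" by (simp add: skew rho_R')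
  then show ?thesis using skew[of v w] by (simp add: Y Q_eq j_simps rho_neg R_inner)
qed

text \<open>This and the next two lemmas give the three Kaehler forms in the splitting. Those of
  \<open>J2\<close> and of the product do not contain \<rho>: they are the canonical two-form of the
  cotangent bundle, with and without a twist by \<open>j\<close>, up to sign.\<close>

lemma Q_J1_form: "Q (J1 (v, a)) (w, b) = - \<rho> v w + a \<bullet> R' b"
  by (simp add: Q_eq dual_inner rho_neg)

lemma Q_J2_form: "Q (J2 (v, a)) (w, b) = a \<bullet> j w - b \<bullet> j v"
  using alt[of v "j (R' b)"] skew[of "R' b" v] by (simp add: Q_eq j_simps rho_neg R_inner skew rho_R')

lemma Q_J3_form: "Q (J1 (J2 (v, a))) (w, b) = a \<bullet> w - b \<bullet> v"
  using alt[of v "R' b"] by (simp add: Q_eq j_simps rho_neg dual_inner R_inner rho_R')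

lemma flat_sigma: "flat_map (\<lambda>v w. \<rho> v (j w)) v = dual_endo j (R v)"
  unfolding flat_map_def[of "\<lambda>v w. \<rho> v (j w)"] dual_endo_def R_inner ..

lemma inv_flat_sigma: "inv (flat_map (\<lambda>v w. \<rho> v (j w))) a = j (R' a)"
proof -
  have f: "flat_map (\<lambda>v w. \<rho> v (j w)) v = dual_endo j (R v)" for v
    by (rule flat_sigma)
  have "inv (flat_map (\<lambda>v w. \<rho> v (j w))) = (\<lambda>a. j (R' a))"
    by (rule inv_equality) (simp_all add: f R'_dual R_j dual_dual j_simps)
  then show ?thesis by simp
qed

end

section \<open>Closed forms on the cotangent bundle\<close>

text \<open>On constant fields, the exterior derivative of an exterior derivative collects each
  second derivative of \<mu> twice, with opposite signs.\<close>

lemma exact_form_closed: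
  fixes \<mu> :: "'n::euclidean_space \<Rightarrow> 'n \<Rightarrow> real"
  assumes S: "open S" "z \<in> S" and sm: "\<And>W. smooth_on S (\<lambda>y. \<mu> y W)"
    and \<Omega>: "\<And>y Z W. y \<in> S \<Longrightarrow> \<Omega> y Z W = D (\<lambda>y. \<mu> y W) y Z - D (\<lambda>y. \<mu> y Z) y W"
  shows "D (\<lambda>y. \<Omega> y V W) z U + D (\<lambda>y. \<Omega> y W U) z V + D (\<lambda>y. \<Omega> y U V) z W = 0"
proof -
  have "D (\<lambda>y. \<Omega> y Z W) z U = D (\<lambda>y. D (\<lambda>y. \<mu> y W) y Z) z U - D (\<lambda>y. D (\<lambda>y. \<mu> y Z) y W) z U" for Z W U
  proof -
    have "D (\<lambda>y. \<Omega> y Z W) z = D (\<lambda>y. D (\<lambda>y. \<mu> y W) y Z - D (\<lambda>y. \<mu> y Z) y W) z"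
      by (rule D_cong_open[OF S \<Omega>])
    then show ?thesis
      using D_eqI[OF has_derivative_diff[OF smooth_on_has_derivative[OF smooth_on_D[OF sm] S(2)]
            smooth_on_has_derivative[OF smooth_on_D[OF sm] S(2)]]] by metis
  qed
  then show ?thesis
    using symmetric_second_derivative[OF S sm, of U V W] symmetric_second_derivative[OF S sm, of V W U]
      symmetric_second_derivative[OF S sm, of W U V] symmetric_second_derivative[OF S sm] by simp
qed

text \<open>The pullback under \<Theta> of a constant two-form. Each second derivative of \<Theta>
  occurs in both slots, and skewness of \<open>L\<close> cancels the two.\<close>

lemma constant_form_closed:
  fixes \<Theta> :: "'n::euclidean_space \<Rightarrow> 'e::euclidean_space"
  assumes S: "open S" "z \<in> S" and sm: "smooth_on S \<Theta>" and L: "linear L" "\<And>p q. p \<bullet> L q = - (q \<bullet> L p)"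
  defines "\<Omega> \<equiv> \<lambda>y Z W. D \<Theta> y Z \<bullet> L (D \<Theta> y W)"
  shows "D (\<lambda>y. \<Omega> y V W) z U + D (\<lambda>y. \<Omega> y W U) z V + D (\<lambda>y. \<Omega> y U V) z W = 0"
    and "smooth_on S (\<lambda>y. \<Omega> y V W)"
proof -
  have bL: "bounded_linear L" using L(1) by (simp add: linear_conv_bounded_linear)
  define A where "A u v = D (\<lambda>y. D \<Theta> y v) z u" for u v
  have sym: "A u v = A v u" for u v unfolding A_def by (rule symmetric_second_derivative[OF S sm])
  have "D (\<lambda>y. \<Omega> y V W) z U = D \<Theta> z V \<bullet> L (A U W) + A U V \<bullet> L (D \<Theta> z W)" for U V W
    unfolding \<Omega>_def A_def
    by (subst D_eqI[OF has_derivative_inner[OF smooth_on_has_derivative[OF smooth_on_D[OF sm] S(2)]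
            bounded_linear.has_derivative[OF bL smooth_on_has_derivative[OF smooth_on_D[OF sm] S(2)]]]]) simp
  then show "D (\<lambda>y. \<Omega> y V W) z U + D (\<lambda>y. \<Omega> y W U) z V + D (\<lambda>y. \<Omega> y U V) z W = 0"
    using L(2)[of "D \<Theta> z V" "A U W"] L(2)[of "D \<Theta> z W" "A V U"] L(2)[of "D \<Theta> z U" "A W V"]
      sym[of U V] sym[of V W] sym[of W U] by simp
  show "smooth_on S (\<lambda>y. \<Omega> y V W)"
    unfolding \<Omega>_def by (intro smooth_on_inner smooth_on_D sm S(1) smooth_on_bounded_linear[OF bL])
qed

context mfd_connection begin

text \<open>For \<open>A\<close> the identity this is the canonical two-form up to sign, for
  \<open>A = J\<close> its twist; the primitive \<open>l\<close> is the Liouville form composed with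
  \<open>A\<close>. The condition \<open>dA\<close> matches the Christoffel terms of the splitting
  with the derivatives of \<open>A\<close>.\<close>

lemma closed_canonical:
  assumes A: "endo_field M A" and tf: "torsion_free M \<Gamma>"
    and dA: "\<And>i x u v. i \<in> idx M \<Longrightarrow> x \<in> coord_dom M i \<Longrightarrow> cov_endo \<Gamma> A i x u v = cov_endo \<Gamma> A i x v u"
  shows "closed_form N (\<lambda>i z Z W. snd (hv_inv \<Gamma> i z Z) \<bullet> A i (fst z) (fst W) - snd (hv_inv \<Gamma> i z W) \<bullet> A i (fst z) (fst Z))"
  unfolding closed_form_def
proof (intro ballI allI)
  fix i and z U V W :: "'e \<times> 'e" assume "i \<in> idx N" and z: "z \<in> coord_dom N i"
  then have i: "i \<in> idx M" by (simp add: idx_N)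
  let ?S = "coord_dom M i \<times> (UNIV :: 'e set)"
  define l where "l y W = snd y \<bullet> A i (fst y) (fst W)" for y W :: "'e \<times> 'e"
  have dl: "((\<lambda>y. l y W) has_derivative (\<lambda>Z. snd y \<bullet> D (\<lambda>x. A i x (fst W)) (fst y) (fst Z) + snd Z \<bullet> A i (fst y) (fst W))) (at y)"
    if "y \<in> ?S" for y W
    unfolding l_def
    by (intro has_derivative_inner has_derivative_snd has_derivative_ident
        has_derivative_compose_at[OF has_derivative_fst[OF has_derivative_ident]
          smooth_on_has_derivative[OF endo_fieldD(2)[OF A i]] refl]) (use that in auto)
  show "D (\<lambda>y. snd (hv_inv \<Gamma> i y V) \<bullet> A i (fst y) (fst W) - snd (hv_inv \<Gamma> i y W) \<bullet> A i (fst y) (fst V)) z U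
    + D (\<lambda>y. snd (hv_inv \<Gamma> i y W) \<bullet> A i (fst y) (fst U) - snd (hv_inv \<Gamma> i y U) \<bullet> A i (fst y) (fst W)) z V
    + D (\<lambda>y. snd (hv_inv \<Gamma> i y U) \<bullet> A i (fst y) (fst V) - snd (hv_inv \<Gamma> i y V) \<bullet> A i (fst y) (fst U)) z W = 0"
  proof (rule exact_form_closed[OF open_N[OF i], where \<mu>=l])
    show "z \<in> ?S" using z by (simp add: coord_dom_N[OF i])
    show "smooth_on ?S (\<lambda>y. l y W)" for W
      unfolding l_def by (intro smooth_on_inner open_N i smooth_on_snd smooth_on_id smooth_fst_comp endo_fieldD(2)[OF A])
    fix y Z W :: "'e \<times> 'e" assume y: "y \<in> ?S"
    then have x: "fst y \<in> coord_dom M i" by auto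
    obtain x a v c w d where e: "y = (x, a)" "Z = (v, c)" "W = (w, d)" by (metis prod.collapse)
    have xS: "x \<in> coord_dom M i" using x e by simp
    have "\<Gamma> i x v w = \<Gamma> i x w v" using tf i xS unfolding torsion_free_def by blast
    then have "D (\<lambda>y. A i y w) x v + \<Gamma> i x v (A i x w) = D (\<lambda>y. A i y v) x w + \<Gamma> i x w (A i x v)"
      using dA[OF i xS, of v w] by (simp add: cov_endo_def)
    then have "\<Gamma> i x v (A i x w) = D (\<lambda>y. A i y v) x w + \<Gamma> i x w (A i x v) - D (\<lambda>y. A i y w) x v"
      by (simp add: algebra_simps)
    then show "snd (hv_inv \<Gamma> i y Z) \<bullet> A i (fst y) (fst W) - snd (hv_inv \<Gamma> i y W) \<bullet> A i (fst y) (fst Z) =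
        D (\<lambda>y. l y W) y Z - D (\<lambda>y. l y Z) y W"
      unfolding D_eqI[OF dl[OF y]] unfolding e
      by (simp add: hv_inv_snd_inner[OF i xS] inner_add_right inner_diff_right)
  qed
qed

end

context flat_connection begin

text \<open>A parallel \<open>b\<close> has constant coefficients in a parallel frame, so the
  vertical part is a constant two-form in the fibre coordinates \<Theta>; the horizontal part is the
  pullback of the closed form \<open>- b\<close>.\<close>

lemma closed_kaehler_J1:
  assumes b: "bilin_field M b" "nondegenerate M b" "alternating M b" and cl: "closed_form M b" and par: "parallel M \<Gamma> b"
  shows "closed_form N (\<lambda>i z Z W. - b i (fst z) (fst Z) (fst W) +
    snd (hv_inv \<Gamma> i z Z) \<bullet> inv (flat_map (b i (fst z))) (snd (hv_inv \<Gamma> i z W)))"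
  unfolding closed_form_def
proof (intro ballI allI)
  fix i and z U V W :: "'c \<times> 'c" assume "i \<in> idx N" and z: "z \<in> coord_dom N i"
  then have i: "i \<in> idx M" and x0: "fst z \<in> coord_dom M i" by (auto simp: idx_N coord_dom_N)
  let ?x0 = "fst z"
  obtain r E \<beta> where r: "r > 0" "ball ?x0 r \<subseteq> coord_dom M i" "\<And>x. linear (E x)" "\<And>k. E ?x0 k = k"
    "\<And>k. smooth_on (ball ?x0 r) (\<lambda>x. E x k)" "smooth_on (ball ?x0 r) (\<beta> :: 'c \<Rightarrow> 'c)"
    "\<And>x k. x \<in> ball ?x0 r \<Longrightarrow> ((\<lambda>x. E x k) has_derivative (\<lambda>v. - \<Gamma> i x v (E x k))) (at x)"
    by (rule parallel_frame[OF codazzi_zero i x0]) (rule that)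
  let ?B = "ball ?x0 r"
  let ?S = "?B \<times> (UNIV :: 'c set)"
  define \<Theta> where "\<Theta> = (\<lambda>z. dual_endo (E (fst z)) (snd z))"
  have "\<forall>x\<in>?B. \<forall>k. ((\<lambda>x. E x k) has_derivative (\<lambda>v. - \<Gamma> i x v (E x k))) (at x)"
    using r(7) by blast
  note fc = fibre_coordinates[OF i r(2,3,5) this, folded \<Theta>_def]
  have o: "open ?S" by (simp add: open_Times)
  have zS: "z \<in> ?S" using r(1) by (simp add: mem_Times_iff)
  have x0B: "?x0 \<in> ?B" using r(1) by simp
  note bl = bilin_fieldD(1)[OF b(1) i]
  interpret p0: pairing "b i ?x0" by (rule pairing_field[OF b(1,2) i x0])
  define L where "L = inv (flat_map (b i ?x0))"
  have const: "b i x (E x k) (E x l) = b i ?x0 k l" if x: "x \<in> ?B" for x k l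
  proof -
    have sb: "smooth_on ?B (\<lambda>x. b i x v w)" for v w by (rule smooth_on_subset[OF bilin_fieldD(2)[OF b(1) i] r(2)])
    have blB: "bilinear (b i x)" if "x \<in> ?B" for x using bl that r(2) by blast
    have sf: "smooth_on ?B (\<lambda>x. b i x (E x k) (E x l))"
      by (rule smooth_on_bilinear_apply[where A="b i", OF open_ball blB sb r(5) r(5)])
    have "((\<lambda>x. b i x (E x k) (E x l)) has_derivative (\<lambda>h. 0)) (at y within ?B)" if y: "y \<in> ?B" for y
    proof -
      have yS: "y \<in> coord_dom M i" using y r(2) by blast
      have "D (\<lambda>x. b i x (E x k) (E x l)) y u = 0" for u
      proof -
        have "D (\<lambda>x. b i x (E x k) (E x l)) y u = D (\<lambda>x. b i x (E y k) (E y l)) y u +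
            b i y (D (\<lambda>x. E x k) y u) (E y l) + b i y (E y k) (D (\<lambda>x. E x l) y u)"
          by (rule smooth_on_D_bilinear_apply[where A="b i", OF open_ball y blB sb r(5) r(5)])
        also have "\<dots> = cov_bilin \<Gamma> b i y u (E y k) (E y l)"
          unfolding D_eqI[OF r(7)[OF y]]
          by (simp add: cov_bilin_def bilinear_lneg[OF bl[OF yS]] bilinear_rneg[OF bl[OF yS]])
        also have "\<dots> = 0" using par i yS unfolding parallel_def by blast
        finally show ?thesis .
      qed
      then have "D (\<lambda>x. b i x (E x k) (E x l)) y = (\<lambda>h. 0)" by blast
      then show ?thesis using has_derivative_at_withinI[OF smooth_on_has_derivative[OF sf y]] by simp
    qed
    from has_derivative_zero_constant[OF convex_ball this]
    obtain c where c: "\<And>x. x \<in> ?B \<Longrightarrow> b i x (E x k) (E x l) = c" by blast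
    show ?thesis using c[OF x] c[OF x0B] by (simp add: r(4))
  qed
  \<comment> \<open>By \<open>const\<close>, a vector killed by \<open>E x\<close> lies in the
    kernel of the form at \<open>x0\<close>.\<close>
  have injE: "inj (E x)" if x: "x \<in> ?B" for x
    unfolding linear_injective_0[OF r(3)]
  proof (intro allI impI)
    fix k assume "E x k = 0"
    then have "b i ?x0 k l = 0" for l
      using const[OF x, of k l] bilinear_lzero[OF bl] x r(2) by (metis subsetD)
    then show "k = 0" using p0.nd by blast
  qed
  have fibre: "snd (hv_inv \<Gamma> i y Z) \<bullet> inv (flat_map (b i (fst y))) (snd (hv_inv \<Gamma> i y W)) = D \<Theta> y Z \<bullet> L (D \<Theta> y W)"
    if y: "y \<in> ?S" for y Z W
  proof -
    have x: "fst y \<in> ?B" "fst y \<in> coord_dom M i" using y r(2) by auto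
    interpret p: pairing "b i (fst y)" by (rule pairing_field[OF b(1,2) i x(2)])
    have D\<Theta>: "D \<Theta> y Z = dual_endo (E (fst y)) (snd (hv_inv \<Gamma> i y Z))" for Z
      using fc(2)[OF x(1), of "hv_inv \<Gamma> i y Z"] by simp
    note Ei = linear_inj_bij[OF r(3) injE[OF x(1)]]
    \<comment> \<open>Since \<open>E\<close> preserves the form, its inverses at the current point
      and at the centre correspond under \<open>E\<close>; this expresses the vertical part by the
      fixed map \<open>L\<close>.\<close>
    have rep: "D \<Theta> y Z = p0.R (inv (E (fst y)) (p.R' (snd (hv_inv \<Gamma> i y Z))))" for Z
    proof (rule inner_eqI)
      fix k
      have "D \<Theta> y Z \<bullet> k = b i (fst y) (p.R' (snd (hv_inv \<Gamma> i y Z))) (E (fst y) k)"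
        by (simp add: D\<Theta> dual_endo_inner[OF r(3)] p.rho_R')
      also have "\<dots> = b i ?x0 (inv (E (fst y)) (p.R' (snd (hv_inv \<Gamma> i y Z)))) k"
        using const[OF x(1), of "inv (E (fst y)) (p.R' (snd (hv_inv \<Gamma> i y Z)))" k] by (simp add: Ei(3))
      finally show "D \<Theta> y Z \<bullet> k = p0.R (inv (E (fst y)) (p.R' (snd (hv_inv \<Gamma> i y Z)))) \<bullet> k"
        by (simp add: p0.R_inner)
    qed
    have "L (D \<Theta> y W) = inv (E (fst y)) (p.R' (snd (hv_inv \<Gamma> i y W)))" unfolding rep L_def by simp
    then show ?thesis by (simp add: D\<Theta> dual_endo_inner[OF r(3)] Ei(3))
  qed
  have Lalt: "p \<bullet> L q = - (q \<bullet> L p)" for p q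
  proof -
    have "b i ?x0 (L p) (L q) = - b i ?x0 (L q) (L p)" using b(3) i x0 unfolding alternating_def by blast
    then show ?thesis by (simp add: L_def p0.rho_R')
  qed
  have linL: "linear L" unfolding L_def by (rule p0.linR')
  note cf = constant_form_closed[OF o zS fc(1) linL Lalt]
  let ?\<Omega> = "\<lambda>y V W. - b i (fst y) (fst V) (fst W) + snd (hv_inv \<Gamma> i y V) \<bullet> inv (flat_map (b i (fst y))) (snd (hv_inv \<Gamma> i y W))"
  have D: "D (\<lambda>y. ?\<Omega> y V W) z U = - D (\<lambda>x. b i x (fst V) (fst W)) ?x0 (fst U) + D (\<lambda>y. D \<Theta> y V \<bullet> L (D \<Theta> y W)) z U" for U V W
  proof -
    have "D (\<lambda>y. ?\<Omega> y V W) z = D (\<lambda>y. - b i (fst y) (fst V) (fst W) + D \<Theta> y V \<bullet> L (D \<Theta> y W)) z"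
      by (rule D_cong_open[OF o zS]) (simp add: fibre)
    also have "\<dots> = (\<lambda>U. - D (\<lambda>x. b i x (fst V) (fst W)) ?x0 (fst U) + D (\<lambda>y. D \<Theta> y V \<bullet> L (D \<Theta> y W)) z U)"
      by (intro D_eqI has_derivative_add has_derivative_minus smooth_on_has_derivative[OF cf(2) zS]
          has_derivative_compose_at[OF has_derivative_fst[OF has_derivative_ident]
            smooth_on_has_derivative[OF bilin_fieldD(2)[OF b(1) i] x0] refl])
    finally show ?thesis by simp
  qed
  have "D (\<lambda>x. b i x (fst V) (fst W)) ?x0 (fst U) + D (\<lambda>x. b i x (fst W) (fst U)) ?x0 (fst V) +
      D (\<lambda>x. b i x (fst U) (fst V)) ?x0 (fst W) = 0"
    using cl i x0 unfolding closed_form_def by blast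
  then show "D (\<lambda>y. ?\<Omega> y V W) z U + D (\<lambda>y. ?\<Omega> y W U) z V + D (\<lambda>y. ?\<Omega> y U V) z W = 0"
    unfolding D using cf(1)[of V W U] by linarith
qed

end

section \<open>The hyper-Hermitian structure\<close>

text \<open>Part (i) for any closed nondegenerate J-invariant two-form \<rho>;
  \<open>omega11\<close> enters through these properties.\<close>

locale hermitian_cotangent = flat_connection +
  fixes J :: "('a, 'c) endo" and \<rho> :: "('a, 'c, real) bilin"
  assumes ac: "almost_complex M J" and intJ: "integrable_acs M J"
    and dJ: "\<And>i x u v. i \<in> idx M \<Longrightarrow> x \<in> coord_dom M i \<Longrightarrow> cov_endo \<Gamma> J i x u v = cov_endo \<Gamma> J i x v u"
    and r: "bilin_field M \<rho>" and rnd: "nondegenerate M \<rho>" and ralt: "alternating M \<rho>" and rcl: "closed_form M \<rho>"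
    and rinv: "\<And>i x v w. i \<in> idx M \<Longrightarrow> x \<in> coord_dom M i \<Longrightarrow> \<rho> i x (J i x v) (J i x w) = \<rho> i x v w"
begin

lemma Jf: "endo_field M J" using ac by (simp add: almost_complex_def)

lemma hp:
  assumes i: "i \<in> idx M" and x: "x \<in> coord_dom M i"
  shows "hermitian_pairing (\<rho> i x) (J i x)"
proof -
  interpret pairing "\<rho> i x" by (rule pairing_field[OF r rnd i x])
  have alt: "\<rho> i x v w = - \<rho> i x w v" for v w using ralt i x unfolding alternating_def by blast
  show ?thesis
    by (intro hermitian_pairing.intro complex_pairing.intro complex_pairing_axioms.intro
        hermitian_pairing_axioms.intro pairing_axioms) (rule almost_complexD(1)[OF ac i x] almost_complexD(3)[OF ac i x] alt rinv[OF i x])+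
qed

definition g where "g = bilin_comp \<rho> J"

lemma g_eq: "g i x = (\<lambda>v. \<rho> i x (J i x v))" by (simp add: g_def bilin_comp_def fun_eq_iff)

abbreviation "K1 \<equiv> J_nabla \<Gamma> J"
abbreviation "K2 \<equiv> J_bilin \<Gamma> \<rho>"
abbreviation "K3 \<equiv> endo_comp K1 K2"
abbreviation "gN \<equiv> diag_metric \<Gamma> g"

lemma g_field: "bilin_field M g"
  using bilin_field_comp2[OF r Jf endo_field_id] by (simp add: g_def bilin_comp_def)

lemma pseudo_riemannian_g: "pseudo_riemannian M g"
  unfolding pseudo_riemannian_def
proof (intro conjI g_field)
  show "symmetric_field M g" "nondegenerate M g"
    unfolding symmetric_field_def nondegenerate_def g_eq
    using hermitian_pairing.g_sym[OF hp] hermitian_pairing.g_nd[OF hp] by blast+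
qed

lemma gnd: "nondegenerate M g" using pseudo_riemannian_g by (simp add: pseudo_riemannian_def)

lemma closed_form_minus: "closed_form M b \<Longrightarrow> bilin_field M b \<Longrightarrow> closed_form M (\<lambda>i x v w. - b i x v w)"
proof -
  assume cl: "closed_form M b" and b: "bilin_field M b"
  have "D (\<lambda>y. - b i y v w) x u = - D (\<lambda>y. b i y v w) x u" if "i \<in> idx M" "x \<in> coord_dom M i" for i x u v w
    using D_eqI[OF has_derivative_minus[OF D_bilin[OF b that]]] by metis
  note D = this
  show ?thesis
    unfolding closed_form_def
  proof (intro ballI allI)
    fix i x u v w assume ix: "i \<in> idx M" "x \<in> coord_dom M i"
    have "D (\<lambda>y. b i y v w) x u + D (\<lambda>y. b i y w u) x v + D (\<lambda>y. b i y u v) x w = 0"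
      using cl ix unfolding closed_form_def by blast
    then show "D (\<lambda>y. - b i y v w) x u + D (\<lambda>y. - b i y w u) x v + D (\<lambda>y. - b i y u v) x w = 0"
      unfolding D[OF ix] by linarith
  qed
qed

lemma kaehler_g: "kaehler M J g"
  unfolding kaehler_def complex_manifold_def
proof (intro conjI ac intJ pseudo_riemannian_g)
  show "orthogonal_endo M g J"
    unfolding orthogonal_endo_def g_eq by (auto simp: rinv)
  \<comment> \<open>The Kaehler form is g(Jv, w) = \<rho>(JJv, w) = -\<rho>(v, w), so its closedness
    is that of \<rho>.\<close>
  have "- \<rho> i x v w = bilin_comp g J i x v w" if "i \<in> idx M" "x \<in> coord_dom M i" for i x v w
    using almost_complexD(3)[OF ac that, of v] bilin_fieldD(1)[OF r that]
    by (simp add: bilin_comp_def g_eq bilinear_lneg)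
  then show "closed_form M (bilin_comp g J)"
    by (rule closed_form_cong[OF _ closed_form_minus[OF rcl r]])
qed

lemma N_point: "i \<in> idx N \<Longrightarrow> z \<in> coord_dom N i \<Longrightarrow> i \<in> idx M \<and> fst z \<in> coord_dom M i"
  by (auto simp: idx_N coord_dom_N)

lemma K1_eq: "K1 i z Z = hv_iso \<Gamma> i z ((\<lambda>(v, a). (J i (fst z) v, dual_endo (J i (fst z)) a)) (hv_inv \<Gamma> i z Z))"
  by (simp add: J_nabla_eq hv_endo_eq J_nabla_hv_def)

lemma K2_eq: "K2 i z Z = hv_iso \<Gamma> i z ((\<lambda>(v, a). (- inv (flat_map (\<rho> i (fst z))) a, flat_map (\<rho> i (fst z)) v)) (hv_inv \<Gamma> i z Z))"
  by (simp add: J_bilin_eq hv_endo_eq J_bilin_hv_def)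

lemma gN_eq:
  "i \<in> idx M \<Longrightarrow> fst z \<in> coord_dom M i \<Longrightarrow>
    gN i z Z W = hermitian_pairing.Q (\<rho> i (fst z)) (J i (fst z)) (hv_inv \<Gamma> i z Z) (hv_inv \<Gamma> i z W)"
  by (simp add: diag_metric_def hv_bilin_eq hermitian_pairing.Q_def[OF hp] g_eq case_prod_unfold)

lemma pseudo_riemannian_gN: "pseudo_riemannian N gN"
  unfolding pseudo_riemannian_def
proof (intro conjI bilin_field_diag_metric g_field gnd)
  show "symmetric_field N gN"
    unfolding symmetric_field_def
  proof (intro ballI allI)
    fix i z Z W assume "i \<in> idx N" "z \<in> coord_dom N i"
    then have i: "i \<in> idx M" "fst z \<in> coord_dom M i" using N_point by auto
    show "gN i z Z W = gN i z W Z" unfolding gN_eq[OF i] by (rule hermitian_pairing.Q_sym[OF hp[OF i]])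
  qed
  show "nondegenerate N gN"
    unfolding nondegenerate_def
  proof (intro ballI allI impI)
    fix i z Z assume "i \<in> idx N" "z \<in> coord_dom N i" and 0: "\<forall>W. gN i z Z W = 0"
    then have i: "i \<in> idx M" "fst z \<in> coord_dom M i" using N_point by auto
    have "hv_inv \<Gamma> i z Z = 0"
    proof (rule hermitian_pairing.Q_nd[OF hp[OF i]])
      show "hermitian_pairing.Q (\<rho> i (fst z)) (J i (fst z)) (hv_inv \<Gamma> i z Z) Y' = 0" for Y'
        using 0[rule_format, of "hv_iso \<Gamma> i z Y'"] gN_eq[OF i, of Z "hv_iso \<Gamma> i z Y'"] by simp
    qed
    then have "Z = hv_iso \<Gamma> i z 0" by (metis hv_iso_inv)
    then show "Z = 0" using linear_0[OF linear_hv_iso[OF i]] by simp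
  qed
qed

lemma anticommute:
  assumes i: "i \<in> idx M" "fst z \<in> coord_dom M i"
  shows "K1 i z (K2 i z Z) = - K2 i z (K1 i z Z)"
  unfolding K1_eq K2_eq hv_inv_iso hermitian_pairing.J1_J2[OF hp[OF i]]
  by (rule linear_neg[OF linear_hv_iso[OF i]])

lemma acK1: "almost_complex N K1" by (rule almost_complex_J_nabla[OF ac])
lemma acK2: "almost_complex N K2" by (rule almost_complex_J_bilin[OF r rnd])

lemma acK3: "almost_complex N K3"
  unfolding almost_complex_def
proof (intro conjI ballI allI smooth_manifold_N)
  show "endo_field N K3"
    unfolding J_nabla_eq J_bilin_eq endo_comp_hv_endo
    by (rule endo_field_hv_endo[OF tcot_endo_comp[OF tcot_endo_J_nabla[OF Jf] tcot_endo_J_bilin[OF r rnd]]])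
  fix i z Z assume iN: "i \<in> idx N" "z \<in> coord_dom N i"
  then have i: "i \<in> idx M" "fst z \<in> coord_dom M i" using N_point by auto
  have "K1 i z (K2 i z (K1 i z (K2 i z Z))) = K1 i z (K2 i z (- K2 i z (K1 i z Z)))"
    by (simp only: anticommute[OF i])
  also have "\<dots> = K1 i z (K1 i z Z)"
    by (simp only: linear_neg[OF almost_complexD(1)[OF acK2 iN]] almost_complexD(3)[OF acK2 iN] minus_minus)
  also have "\<dots> = - Z" by (rule almost_complexD(3)[OF acK1 iN])
  finally show "K3 i z (K3 i z Z) = - Z" by (simp add: endo_comp_def)
qed

lemma orthogonal: "orthogonal_endo N gN K1" "orthogonal_endo N gN K2" "orthogonal_endo N gN K3"
proof -
  have 1: "gN i z (K1 i z Z) (K1 i z W) = gN i z Z W" and 2: "gN i z (K2 i z Z) (K2 i z W) = gN i z Z W"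
    if i: "i \<in> idx M" "fst z \<in> coord_dom M i" for i z Z W
    unfolding gN_eq[OF i] K1_eq K2_eq hv_inv_iso
    by (rule hermitian_pairing.Q_J1[OF hp[OF i]], rule hermitian_pairing.Q_J2[OF hp[OF i]])
  show "orthogonal_endo N gN K1" "orthogonal_endo N gN K2" "orthogonal_endo N gN K3"
    unfolding orthogonal_endo_def endo_comp_def by (auto dest: N_point simp: 1 2)
qed

lemma almost_hyper_hermitian_N: "almost_hyper_hermitian N K1 K2 K3 gN"
  unfolding almost_hyper_hermitian_def
  using pseudo_riemannian_gN acK1 acK2 acK3 orthogonal anticommute N_point
  by (auto simp: endo_comp_def)

lemma standard_K1: "standard_cotangent_complex_structure M J K1"
  by (rule standard_J_nabla[OF ac tf dJ])

lemma integrable_K1: "integrable_acs N K1"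
  by (rule integrable_of_standard[OF intJ standard_K1])

text \<open>The symmetric form for which the third structure is again of the type
  \<open>J_bilin\<close>.\<close>

definition \<sigma> where "\<sigma> = (\<lambda>i x v w. \<rho> i x v (J i x w))"

lemma \<sigma>_field: "bilin_field M \<sigma>"
  using bilin_field_comp2[OF r endo_field_id Jf] by (simp add: \<sigma>_def)

lemma \<sigma>_nd: "nondegenerate M \<sigma>"
  unfolding nondegenerate_def \<sigma>_def
proof (intro ballI allI impI)
  fix i x v assume i: "i \<in> idx M" "x \<in> coord_dom M i" and 0: "\<forall>w. \<rho> i x v (J i x w) = 0"
  interpret hermitian_pairing "\<rho> i x" "J i x" by (rule hp[OF i])
  have "\<rho> i x v w = 0" for w using 0[rule_format, of "- J i x w"] by (simp add: j_simps)
  then show "v = 0" using nd by blast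
qed

lemma K3_eq_J_bilin:
  assumes i: "i \<in> idx M" "fst z \<in> coord_dom M i"
  shows "J_bilin \<Gamma> \<sigma> i z Z = K3 i z Z"
proof -
  interpret hermitian_pairing "\<rho> i (fst z)" "J i (fst z)" by (rule hp[OF i])
  show ?thesis
    by (simp add: J_bilin_eq J_nabla_eq endo_comp_hv_endo hv_endo_eq J_bilin_hv_def J_nabla_hv_def \<sigma>_def
        flat_sigma inv_flat_sigma j_simps split: prod.split)
qed

text \<open>The derivative of \<sigma> at (u, v, w) is \<rho>(v, (\<nabla>_u J) w). It is symmetric
  in v, w like \<sigma> itself and symmetric in u, w by \<open>dJ\<close>, hence totally
  symmetric.\<close>

lemma codazzi_\<sigma>:
  assumes par: "parallel M \<Gamma> \<rho>"
  shows "codazzi M \<Gamma> \<sigma>"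
  unfolding codazzi_def
proof (intro ballI allI)
  fix i x u v w assume i: "i \<in> idx M" and x: "x \<in> coord_dom M i"
  interpret hermitian_pairing "\<rho> i x" "J i x" by (rule hp[OF i x])
  let ?S = "cov_endo \<Gamma> J i x"
  have p: "cov_bilin \<Gamma> \<rho> i x u v w = 0" for u v w using par i x unfolding parallel_def by blast
  have \<sigma>: "cov_bilin \<Gamma> \<sigma> i x u v w = \<rho> i x v (?S u w)" for u v w
    using cov_bilin_comp2[OF r endo_field_id Jf i x, of u v w]
    by (simp add: \<sigma>_def p cov_endo_id bilinear_lzero[OF bil])
  have gsym: "cov_bilin \<Gamma> \<sigma> i x u v w = cov_bilin \<Gamma> \<sigma> i x u w v" for u v w
  proof -
    have alt': "\<rho> i y v (J i y w) = \<rho> i y w (J i y v)" if "y \<in> coord_dom M i" for y v w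
    proof -
      interpret q: hermitian_pairing "\<rho> i y" "J i y" by (rule hp[OF i that])
      show ?thesis using q.g_sym[of v w] q.skew[of v w] q.skew[of w v] by simp
    qed
    have "D (\<lambda>y. \<rho> i y v (J i y w)) x = D (\<lambda>y. \<rho> i y w (J i y v)) x"
      by (rule D_cong_open[OF open_coord_dom[OF i] x alt'])
    then show ?thesis
      using alt'[OF x, of "\<Gamma> i x u v" w] alt'[OF x, of v "\<Gamma> i x u w"] by (simp add: cov_bilin_def \<sigma>_def)
  qed
  have s: "cov_bilin \<Gamma> \<sigma> i x u v w = cov_bilin \<Gamma> \<sigma> i x w v u" for u v w
    unfolding \<sigma> by (simp only: dJ[OF i x, of u w])
  show "cov_bilin \<Gamma> \<sigma> i x u v w = cov_bilin \<Gamma> \<sigma> i x v u w"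
    using gsym[of u v w] s[of u w v] gsym[of v w u] by simp
qed

lemma parallel_imp_codazzi: "parallel M \<Gamma> b \<Longrightarrow> codazzi M \<Gamma> b"
  by (simp add: parallel_def codazzi_def)

lemma integrable_K2_K3:
  assumes par: "parallel M \<Gamma> \<rho>"
  shows "integrable_acs N K2" "integrable_acs N K3"
proof -
  show "integrable_acs N K2" by (rule integrable_J_bilin[OF r rnd parallel_imp_codazzi[OF par]])
  show "integrable_acs N K3"
    by (rule integrable_acs_cong[OF integrable_J_bilin[OF \<sigma>_field \<sigma>_nd codazzi_\<sigma>[OF par]]])
      (use K3_eq_J_bilin N_point in blast)
qed

text \<open>Necessity comes from \<open>K2\<close>: its integrability gives the Codazzi condition,
  which for an alternating form means parallel.\<close>

lemma hyper_hermitian_iff: "hyper_hermitian N K1 K2 K3 gN \<longleftrightarrow> parallel M \<Gamma> \<rho>"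
  using almost_hyper_hermitian_N integrable_K1 integrable_K2_K3
    parallel_of_codazzi[OF r ralt codazzi_of_integrable[OF r rnd]]
  unfolding hyper_hermitian_def by blast

lemma hyper_kaehler_N:
  assumes par: "parallel M \<Gamma> \<rho>"
  shows "hyper_kaehler N K1 K2 K3 gN"
proof -
  interpret N: smooth_mfd N by unfold_locales (rule smooth_manifold_N)
  have "closed_form N (bilin_comp gN K1)"
  proof (rule N.closed_form_cong[OF _ closed_kaehler_J1[OF r rnd ralt rcl par]])
    fix i z Z W assume "i \<in> idx N" "z \<in> coord_dom N i"
    then have i: "i \<in> idx M" "fst z \<in> coord_dom M i" using N_point by auto
    show "- \<rho> i (fst z) (fst Z) (fst W) + snd (hv_inv \<Gamma> i z Z) \<bullet> inv (flat_map (\<rho> i (fst z))) (snd (hv_inv \<Gamma> i z W)) =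
      bilin_comp gN K1 i z Z W"
      using hermitian_pairing.Q_J1_form[OF hp[OF i], of "fst Z" "snd (hv_inv \<Gamma> i z Z)" "fst W" "snd (hv_inv \<Gamma> i z W)"]
      unfolding bilin_comp_def gN_eq[OF i] K1_eq hv_inv_iso by (metis fst_hv_inv prod.collapse)
  qed
  moreover have "closed_form N (bilin_comp gN K2)"
  proof (rule N.closed_form_cong[OF _ closed_canonical[OF Jf tf dJ]])
    fix i z Z W assume "i \<in> idx N" "z \<in> coord_dom N i"
    then have i: "i \<in> idx M" "fst z \<in> coord_dom M i" using N_point by auto
    show "snd (hv_inv \<Gamma> i z Z) \<bullet> J i (fst z) (fst W) - snd (hv_inv \<Gamma> i z W) \<bullet> J i (fst z) (fst Z) = bilin_comp gN K2 i z Z W"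
      using hermitian_pairing.Q_J2_form[OF hp[OF i], of "fst Z" "snd (hv_inv \<Gamma> i z Z)" "fst W" "snd (hv_inv \<Gamma> i z W)"]
      unfolding bilin_comp_def gN_eq[OF i] K2_eq hv_inv_iso by (metis fst_hv_inv prod.collapse)
  qed
  moreover have "closed_form N (bilin_comp gN K3)"
  proof (rule N.closed_form_cong[OF _ closed_canonical[OF endo_field_id tf]])
    fix i z Z W assume "i \<in> idx N" "z \<in> coord_dom N i"
    then have i: "i \<in> idx M" "fst z \<in> coord_dom M i" using N_point by auto
    show "snd (hv_inv \<Gamma> i z Z) \<bullet> fst W - snd (hv_inv \<Gamma> i z W) \<bullet> fst Z = bilin_comp gN K3 i z Z W"
      using hermitian_pairing.Q_J3_form[OF hp[OF i], of "fst Z" "snd (hv_inv \<Gamma> i z Z)" "fst W" "snd (hv_inv \<Gamma> i z W)"]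
      unfolding bilin_comp_def gN_eq[OF i] K1_eq K2_eq endo_comp_def hv_inv_iso by (metis fst_hv_inv prod.collapse)
  qed (simp add: cov_endo_id)
  ultimately show ?thesis
    using hyper_hermitian_iff par acK1 acK2 acK3 integrable_K1 integrable_K2_K3[OF par] pseudo_riemannian_gN orthogonal
    by (simp add: hyper_kaehler_def kaehler_def complex_manifold_def)
qed

end

section \<open>Special symplectic manifolds\<close>

text \<open>The average of \<omega> and its J-transform, written with the scalars on the right to
  fit \<open>bilin_field_comb\<close> and \<open>cov_bilin_comb\<close>.\<close>

lemma omega11_eq:
  assumes "bilinear (\<omega> i x)"
  shows "omega11 J \<omega> i x v w = \<omega> i x v w *\<^sub>R (1/2) + \<omega> i x (J i x v) (J i x w) *\<^sub>R (1/2)"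
  using assms
  by (simp add: omega11_def hodge11_def complex_ext_def proj10_def proj01_def
      bilinear_lmul bilinear_rmul bilinear_lneg bilinear_rneg)

lemma omega_prime_eq:
  assumes "bilinear (\<omega> i x)"
  shows "omega_prime J \<omega> i x v w = \<omega> i x v w *\<^sub>R (1/2) + \<omega> i x (J i x v) (J i x w) *\<^sub>R (-1/2)"
  using assms
  by (simp add: omega_prime_def hodge20_def hodge02_def complex_ext_def proj10_def proj01_def
      bilinear_lmul bilinear_rmul bilinear_lneg bilinear_rneg)

text \<open>A (2,0)-form is complex linear in its first slot and therefore determined by its real
  part, which here is half of \<omega>'.\<close>

lemma hodge20_eq:
  assumes "bilinear (\<omega> i x)" "\<And>v. J i x (J i x v) = - v"
  shows "hodge20 J \<omega> i x v w =
    omega_prime J \<omega> i x v w *\<^sub>R (1/2) + omega_prime J \<omega> i x (J i x v) w *\<^sub>R (- \<i> / 2)"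
  using assms(1)
  by (simp add: omega_prime_eq assms(2) hodge20_def complex_ext_def proj10_def complex_eq_iff
      bilinear_lmul bilinear_rmul bilinear_lneg bilinear_rneg) (simp add: field_simps)

locale special_symplectic_mfd = flat_connection +
  fixes J :: "('a, 'c) endo" and \<omega> :: "('a, 'c, real) bilin"
  assumes ac: "almost_complex M J"
    and dJ: "\<And>i x u v. i \<in> idx M \<Longrightarrow> x \<in> coord_dom M i \<Longrightarrow> cov_endo \<Gamma> J i x u v = cov_endo \<Gamma> J i x v u"
    and om: "bilin_field M \<omega>" and oalt: "alternating M \<omega>" and ocl: "closed_form M \<omega>" and opar: "parallel M \<Gamma> \<omega>"
begin

lemma Jf: "endo_field M J" using ac by (simp add: almost_complex_def)

lemmas J_lin = almost_complexD(1)[OF ac] and J_sq = almost_complexD(3)[OF ac]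

lemma omega_alt: "i \<in> idx M \<Longrightarrow> x \<in> coord_dom M i \<Longrightarrow> \<omega> i x v w = - \<omega> i x w v"
  using oalt unfolding alternating_def by blast

lemma omega_J_field: "bilin_field M (\<lambda>i x v w. \<omega> i x (J i x v) (J i x w))"
  by (rule bilin_field_comp2[OF om Jf Jf])

lemma omega11_on:
  "i \<in> idx M \<Longrightarrow> x \<in> coord_dom M i \<Longrightarrow>
    omega11 J \<omega> i x v w = \<omega> i x v w *\<^sub>R (1/2) + \<omega> i x (J i x v) (J i x w) *\<^sub>R (1/2)"
  by (rule omega11_eq[OF bilin_fieldD(1)[OF om]])

lemma omega_prime_on:
  "i \<in> idx M \<Longrightarrow> x \<in> coord_dom M i \<Longrightarrow>
    omega_prime J \<omega> i x v w = \<omega> i x v w *\<^sub>R (1/2) + \<omega> i x (J i x v) (J i x w) *\<^sub>R (-1/2)"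
  by (rule omega_prime_eq[OF bilin_fieldD(1)[OF om]])

lemma omega11_field: "bilin_field M (omega11 J \<omega>)"
  by (rule bilin_field_cong[OF omega11_on[symmetric] bilin_field_comb[OF om omega_J_field]])

lemma omega_prime_field: "bilin_field M (omega_prime J \<omega>)"
  by (rule bilin_field_cong[OF omega_prime_on[symmetric] bilin_field_comb[OF om omega_J_field]])

lemma omega11_alt: "alternating M (omega11 J \<omega>)"
  unfolding alternating_def
proof (intro ballI allI)
  fix i x v w assume i: "i \<in> idx M" "x \<in> coord_dom M i"
  show "omega11 J \<omega> i x v w = - omega11 J \<omega> i x w v"
    using omega_alt[OF i, of v w] omega_alt[OF i, of "J i x v" "J i x w"] by (simp add: omega11_on[OF i])
qed

lemma omega_prime_alt: "alternating M (omega_prime J \<omega>)"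
  unfolding alternating_def
proof (intro ballI allI)
  fix i x v w assume i: "i \<in> idx M" "x \<in> coord_dom M i"
  show "omega_prime J \<omega> i x v w = - omega_prime J \<omega> i x w v"
    using omega_alt[OF i, of v w] omega_alt[OF i, of "J i x v" "J i x w"] by (simp add: omega_prime_on[OF i])
qed

lemma omega11_inv:
  assumes i: "i \<in> idx M" "x \<in> coord_dom M i"
  shows "omega11 J \<omega> i x (J i x v) (J i x w) = omega11 J \<omega> i x v w"
  by (simp add: omega11_on[OF i] J_sq[OF i] bilinear_lneg[OF bilin_fieldD(1)[OF om i]]
      bilinear_rneg[OF bilin_fieldD(1)[OF om i]])

lemma omega_prime_J:
  assumes i: "i \<in> idx M" "x \<in> coord_dom M i"
  shows "omega_prime J \<omega> i x (J i x v) w = omega_prime J \<omega> i x v (J i x w)"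
  by (simp add: omega_prime_on[OF i] J_sq[OF i] bilinear_lneg[OF bilin_fieldD(1)[OF om i]]
      bilinear_rneg[OF bilin_fieldD(1)[OF om i]])

text \<open>Only the derivatives of \<open>J\<close> contribute, and they cancel in pairs by \<open>d\<^sup>\<nabla>J = 0\<close>.\<close>

lemma omega11_closed: "closed_form M (omega11 J \<omega>)"
proof (rule closed_form_of_cov[OF omega11_field omega11_alt])
  fix i x u v w assume i: "i \<in> idx M" and x: "x \<in> coord_dom M i"
  let ?S = "cov_endo \<Gamma> J i x"
  have "cov_bilin \<Gamma> (omega11 J \<omega>) i x u v w = (\<omega> i x (?S u v) (J i x w) - \<omega> i x (?S u w) (J i x v)) / 2" for u v w
  proof -
    have "cov_bilin \<Gamma> (omega11 J \<omega>) i x u v w =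
      cov_bilin \<Gamma> \<omega> i x u v w *\<^sub>R (1/2) + cov_bilin \<Gamma> (\<lambda>i x v w. \<omega> i x (J i x v) (J i x w)) i x u v w *\<^sub>R (1/2)"
      unfolding cov_bilin_comb[OF om omega_J_field i x, symmetric]
      by (rule cov_bilin_cong[OF omega11_on i x])
    moreover have "cov_bilin \<Gamma> \<omega> i x u v w = 0" for u v w using opar i x unfolding parallel_def by blast
    ultimately show ?thesis
      using omega_alt[OF i x, of "?S u w" "J i x v"] by (simp add: cov_bilin_comp2[OF om Jf Jf i x])
  qed
  note cov = this
  show "cov_bilin \<Gamma> (omega11 J \<omega>) i x u v w + cov_bilin \<Gamma> (omega11 J \<omega>) i x v w u +
      cov_bilin \<Gamma> (omega11 J \<omega>) i x w u v = 0"
    unfolding cov using dJ[OF i x, of u v] dJ[OF i x, of v w] dJ[OF i x, of w u] by (simp add: field_simps)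
qed

lemma hodge20_on:
  assumes i: "i \<in> idx M" "x \<in> coord_dom M i"
  shows "hodge20 J \<omega> i x v w =
    omega_prime J \<omega> i x v w *\<^sub>R (1/2) + omega_prime J \<omega> i x (J i x v) w *\<^sub>R (- \<i> / 2)"
  by (rule hodge20_eq) (rule bilin_fieldD(1)[OF om i], rule J_sq[OF i])

text \<open>One direction takes the real part of \<open>hodge20_on\<close>. For the other, the
  derivative of the imaginary part has to vanish too; it is computed twice, with J in the first and
  in the second slot of \<omega>'.\<close>

lemma parallel_hodge20_iff: "parallel M \<Gamma> (hodge20 J \<omega>) \<longleftrightarrow> parallel M \<Gamma> (omega_prime J \<omega>)"
    if nd: "nondegenerate M (omega_prime J \<omega>)"
proof -
  let ?p = "omega_prime J \<omega>"
  let ?q = "\<lambda>i x v w. ?p i x (J i x v) w"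
  note pf = omega_prime_field
  have qf: "bilin_field M ?q" using bilin_field_comp2[OF pf Jf endo_field_id] by simp
  have eq: "cov_bilin \<Gamma> (hodge20 J \<omega>) i x u v w =
      cov_bilin \<Gamma> ?p i x u v w *\<^sub>R (1/2) + cov_bilin \<Gamma> ?q i x u v w *\<^sub>R (- \<i> / 2)"
    if i: "i \<in> idx M" and x: "x \<in> coord_dom M i" for i x u v w
    unfolding cov_bilin_comb[OF pf qf i x, symmetric]
    by (rule cov_bilin_cong[OF hodge20_on i x])
  show ?thesis
  proof
    assume "parallel M \<Gamma> (hodge20 J \<omega>)"
    then have 0: "cov_bilin \<Gamma> (hodge20 J \<omega>) i x u v w = 0" if "i \<in> idx M" "x \<in> coord_dom M i" for i x u v w
      using that unfolding parallel_def by blast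
    have "cov_bilin \<Gamma> ?p i x u v w = 0" if ix: "i \<in> idx M" "x \<in> coord_dom M i" for i x u v w
      using 0[OF ix, of u v w] unfolding eq[OF ix] by (simp add: complex_eq_iff)
    then show "parallel M \<Gamma> ?p" unfolding parallel_def by blast
  next
    assume par: "parallel M \<Gamma> ?p"
    show "parallel M \<Gamma> (hodge20 J \<omega>)"
      unfolding parallel_def
    proof (intro ballI allI)
      fix i x u v w assume i: "i \<in> idx M" and x: "x \<in> coord_dom M i"
      let ?S = "cov_endo \<Gamma> J i x"
      note bl = bilin_fieldD(1)[OF pf i x]
      have p0: "cov_bilin \<Gamma> ?p i x u v w = 0" for u v w using par i x unfolding parallel_def by blast
      have q: "cov_bilin \<Gamma> ?q i x u v w = ?p i x (?S u v) w" for u v w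
        using cov_bilin_comp2[OF pf Jf endo_field_id i x, of u v w]
        by (simp add: p0 cov_endo_id bilinear_rzero[OF bl])
      have alt: "?p i x v w = - ?p i x w v" for v w
        using omega_prime_alt i x unfolding alternating_def by blast
      have q': "cov_bilin \<Gamma> ?q i x u v w = ?p i x v (?S u w)" for u v w
      proof -
        have "cov_bilin \<Gamma> ?q i x u v w = cov_bilin \<Gamma> (\<lambda>i x v w. ?p i x v (J i x w)) i x u v w"
          by (rule cov_bilin_cong[OF omega_prime_J i x])
        then show ?thesis
          using cov_bilin_comp2[OF pf endo_field_id Jf i x, of u v w]
          by (simp add: p0 cov_endo_id bilinear_lzero[OF bl])
      qed
      \<comment> \<open>\<open>\<omega>'((\<nabla>\<^sub>uJ)v, w)\<close> is symmetric in \<open>u, v\<close> and alternating in \<open>v, w\<close>, hence zero.\<close>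
      have T1: "?p i x (?S u v) w = - ?p i x (?S u w) v" for u v w
        using q[of u v w] q'[of u v w] alt[of v "?S u w"] by simp
      have T2: "?p i x (?S u v) w = ?p i x (?S v u) w" for u v w
        unfolding dJ[OF i x, of u v] ..
      have "?p i x (?S u v) w = 0"
        using T1[of u v w] T2[of u w v] T1[of w u v] T2[of w v u] T1[of v w u] T2[of v u w] by linarith
      then show "cov_bilin \<Gamma> (hodge20 J \<omega>) i x u v w = 0" by (simp add: eq[OF i x] p0 q)
    qed
  qed
qed

text \<open>While \<open>omega11\<close> is J-invariant, \<omega>' changes sign under J. Hence
  \<open>R\<close> intertwines J with its dual, and the two structures commute instead of
  anticommuting.\<close>

lemma almost_para_hypercomplex_N:
  assumes nd: "nondegenerate M (omega_prime J \<omega>)"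
  shows "almost_para_hypercomplex N (J_nabla \<Gamma> J) (J_bilin \<Gamma> (omega_prime J \<omega>))"
  unfolding almost_para_hypercomplex_def
proof (intro conjI ballI allI almost_complex_J_nabla[OF ac] almost_complex_J_bilin[OF omega_prime_field nd])
  fix i z Z assume "i \<in> idx N" "z \<in> coord_dom N i"
  then have i: "i \<in> idx M" "fst z \<in> coord_dom M i" by (auto simp: idx_N coord_dom_N)
  interpret pairing "omega_prime J \<omega> i (fst z)" by (rule pairing_field[OF omega_prime_field nd i])
  have 1: "R (J i (fst z) v) = dual_endo (J i (fst z)) (R v)" for v
    by (rule inner_eqI) (simp add: R_inner dual_endo_inner[OF J_lin[OF i]] omega_prime_J[OF i])
  have 2: "R' (dual_endo (J i (fst z)) a) = J i (fst z) (R' a)" for a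
    by (rule injD[OF injR]) (simp add: 1)
  show "J_nabla \<Gamma> J i z (J_bilin \<Gamma> (omega_prime J \<omega>) i z Z) = J_bilin \<Gamma> (omega_prime J \<omega>) i z (J_nabla \<Gamma> J i z Z)"
    by (simp add: J_nabla_eq J_bilin_eq hv_endo_eq J_nabla_hv_def J_bilin_hv_def 1 2 linear_neg[OF J_lin[OF i]]
        split: prod.split)
qed

lemma integrable_omega_prime_iff:
  assumes nd: "nondegenerate M (omega_prime J \<omega>)"
  shows "integrable_acs N (J_bilin \<Gamma> (omega_prime J \<omega>)) \<longleftrightarrow> parallel M \<Gamma> (hodge20 J \<omega>)"
  unfolding parallel_hodge20_iff[OF nd]
proof
  assume "integrable_acs N (J_bilin \<Gamma> (omega_prime J \<omega>))"
  then show "parallel M \<Gamma> (omega_prime J \<omega>)"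
    by (rule parallel_of_codazzi[OF omega_prime_field omega_prime_alt codazzi_of_integrable[OF omega_prime_field nd]])
next
  assume "parallel M \<Gamma> (omega_prime J \<omega>)"
  then have "codazzi M \<Gamma> (omega_prime J \<omega>)" by (simp add: parallel_def codazzi_def)
  then show "integrable_acs N (J_bilin \<Gamma> (omega_prime J \<omega>))"
    by (rule integrable_J_bilin[OF omega_prime_field nd])
qed

end

theorem theorem11:
  fixes M :: "('i, 'm, 'e::euclidean_space) atlas"
    and J :: "('i, 'e) endo"
    and \<Gamma> :: "('i, 'e, 'e) bilin"
    and \<omega> :: "('i, 'e, real) bilin"
  assumes "special_symplectic M J \<Gamma> \<omega>"
  shows "(nondegenerate M (omega11 J \<omega>) \<longrightarrow>
      (let N = cotangent_bundle M;
           g = bilin_comp (omega11 J \<omega>) J;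
           J1 = J_nabla \<Gamma> J;
           J2 = J_bilin \<Gamma> (omega11 J \<omega>);
           J3 = endo_comp J1 J2;
           gN = diag_metric \<Gamma> g
       in kaehler M J g \<and>
          almost_hyper_hermitian N J1 J2 J3 gN \<and>
          standard_cotangent_complex_structure M J J1 \<and>
          integrable_acs N J1 \<and>
          (hyper_hermitian N J1 J2 J3 gN \<longleftrightarrow> parallel M \<Gamma> (omega11 J \<omega>)) \<and>
          (parallel M \<Gamma> (omega11 J \<omega>) \<longrightarrow> hyper_kaehler N J1 J2 J3 gN))) \<and>
    (nondegenerate M (omega_prime J \<omega>) \<longrightarrow>
      (let N = cotangent_bundle M;
           J1 = J_nabla \<Gamma> J;
           J2 = J_bilin \<Gamma> (omega_prime J \<omega>)
       in almost_para_hypercomplex N J1 J2 \<and>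
          standard_cotangent_complex_structure M J J1 \<and>
          integrable_acs N J1 \<and>
          (para_hypercomplex N J1 J2 \<longleftrightarrow> parallel M \<Gamma> (hodge20 J \<omega>))))"
proof -
  have ss: "almost_complex M J" "integrable_acs M J" "smooth_manifold M" "connection M \<Gamma>" "flat M \<Gamma>" "torsion_free M \<Gamma>"
    "bilin_field M \<omega>" "alternating M \<omega>" "closed_form M \<omega>" "parallel M \<Gamma> \<omega>"
    and dJ: "\<And>i x u v. i \<in> idx M \<Longrightarrow> x \<in> coord_dom M i \<Longrightarrow> cov_endo \<Gamma> J i x u v = cov_endo \<Gamma> J i x v u"
    using assms unfolding special_symplectic_def complex_manifold_def almost_complex_def symplectic_form_def by blast+
  interpret special_symplectic_mfd M \<Gamma> J \<omega>
    by unfold_locales (fact ss dJ)+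
  have std: "standard_cotangent_complex_structure M J (J_nabla \<Gamma> J)"
    by (rule standard_J_nabla[OF ss(1,6) dJ])
  have int: "integrable_acs N (J_nabla \<Gamma> J)"
    by (rule integrable_of_standard[OF ss(2) std])
  have "kaehler M J (bilin_comp (omega11 J \<omega>) J) \<and>
      almost_hyper_hermitian N (J_nabla \<Gamma> J) (J_bilin \<Gamma> (omega11 J \<omega>))
        (endo_comp (J_nabla \<Gamma> J) (J_bilin \<Gamma> (omega11 J \<omega>))) (diag_metric \<Gamma> (bilin_comp (omega11 J \<omega>) J)) \<and>
      (hyper_hermitian N (J_nabla \<Gamma> J) (J_bilin \<Gamma> (omega11 J \<omega>))
        (endo_comp (J_nabla \<Gamma> J) (J_bilin \<Gamma> (omega11 J \<omega>))) (diag_metric \<Gamma> (bilin_comp (omega11 J \<omega>) J)) \<longleftrightarrow>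
        parallel M \<Gamma> (omega11 J \<omega>)) \<and>
      (parallel M \<Gamma> (omega11 J \<omega>) \<longrightarrow> hyper_kaehler N (J_nabla \<Gamma> J) (J_bilin \<Gamma> (omega11 J \<omega>))
        (endo_comp (J_nabla \<Gamma> J) (J_bilin \<Gamma> (omega11 J \<omega>))) (diag_metric \<Gamma> (bilin_comp (omega11 J \<omega>) J)))"
    if nd: "nondegenerate M (omega11 J \<omega>)"
  proof -
    \<comment> \<open>The form \<open>omega11\<close> meets the requirements on \<rho> before
      anything is known about its being parallel; closedness is supplied by
      \<open>omega11_closed\<close>.\<close>
    interpret h: hermitian_cotangent M \<Gamma> J "omega11 J \<omega>"
      by unfold_locales (fact ss dJ omega11_field nd omega11_alt omega11_closed omega11_inv)+
    show ?thesis
      using h.kaehler_g h.almost_hyper_hermitian_N h.hyper_hermitian_iff h.hyper_kaehler_N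
      unfolding h.g_def by blast
  qed
  moreover have "para_hypercomplex N (J_nabla \<Gamma> J) (J_bilin \<Gamma> (omega_prime J \<omega>)) \<longleftrightarrow> parallel M \<Gamma> (hodge20 J \<omega>)"
    if nd: "nondegenerate M (omega_prime J \<omega>)"
    using almost_para_hypercomplex_N[OF nd] int integrable_omega_prime_iff[OF nd]
    unfolding para_hypercomplex_def by blast
  ultimately show ?thesis
    using std int almost_para_hypercomplex_N unfolding Let_def by blast
qed

end
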